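(* Let $\mathscr{T}$ be a hierarchical T-mesh (of $2\times 2$ division) with level $n$, having $V^+$ crossing-vertices, $V^b$ boundary vertices and $E$ interior l-edges, and suppose that every l-edge $t$ of level at least $1$ satisfies $N(t)\geqslant 2$. For $1\leqslant i\leqslant n$ let $\delta_{4i}$ be the number of connected components of $T_i$ that only divide $2\times2$ interior neighbor cells in $\mathscr{T}^{i-1}$ (i.e. the cells of $\mathscr{T}^{i-1}$ divided by the component are exactly four cells, all interior cells, forming a $2\times 2$ block around a common vertex). Put $\delta_4=\sum_{i=1}^n\delta_{4i}$. Then $$\dim \mathbf{S}^3(\mathscr{T})= 3V^b+V^+-2E+4+\delta_4 .$$
   Context: A (regular) T-mesh is a finite set of axis-aligned rectangles (cells) whose union $\Omega$ is a rectangle and such that any two distinct cells meet, if at all, only in boundary points. Vertices are the corner points of cells; an edge is a segment of a grid line joining two consecutive vertices. A vertex on $\partial\Omega$ is a boundary vertex (the four corners of $\Omega$ included), any other is an interior vertex; an interior vertex is a crossing-vertex if it has valence 4 and a T-junction otherwise. An edge on $\partial\Omega$ is a boundary edge, otherwise an interior edge. A cell is an interior cell if all its edges are interior edges, otherwise a boundary cell. An interior l-edge is a longest possible line segment made of connected collinear interior edges; its two end points are T-junctions or boundary vertices. Hierarchical T-mesh of $2\times2$ division: start from a tensor-product mesh $\mathscr{T}^0$ (level 0); given $\mathscr{T}^{k}$, some cells of level $k$ are each divided equally into $2\times 2$ subcells, giving $\mathscr{T}^{k+1}$; the new vertices, edges and cells have level $k+1$. The final mesh is $\mathscr{T}=\mathscr{T}^n$,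 where $n$ is the maximal level number that appears. All edges of an interior l-edge are introduced at the same level, which is the level of the l-edge. For an l-edge $t$ of level $j\geqslant 1$, $N(t)$ is the number of cells of $\mathscr{T}^{j-1}$ that $t$ crosses. $T_i$ is the set of all level $i$ l-edges and all level $i$ vertices of $\mathscr{T}$. For $i\geqslant1$, the connected components of $T_i$ are the parts into which $T_i$ splits so that l-edges of different parts do not intersect (and no part can be split further). A component divides a cell of $\mathscr{T}^{i-1}$ if its l-edges subdivide that cell. Spline space: $\mathbf{S}^d(\mathscr{T})=\{f\in C^{d-1,d-1}(\Omega): f|_\phi\in\mathbb{P}_{dd}\text{ for every cell }\phi\text{ of }\mathscr{T}\}$, where $\mathbb{P}_{dd}$ is the space of polynomials of bi-degree $(d,d)$ and $C^{d-1,d-1}$ denotes functions continuous of order $d-1$ in the $x$-direction and of order $d-1$ in the $y$-direction (i.e. $\partial_x^a\partial_y^b f$ continuous for $0\leqslant a,b\leqslant d-1$). *)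

theory Defs
  imports "HOL-Analysis.Analysis" "HOL-Library.Function_Algebras"
begin

section \<open>Meshes, vertices, edges, l-edges\<close>

text \<open>A cell is given by its lower left and its upper right corner. A mesh is a set of cells.\<close>

type_synonym cell = "(real \<times> real) \<times> (real \<times> real)"

definition region :: "cell \<Rightarrow> (real \<times> real) set" where
  "region c = cbox (fst c) (snd c)"

fun corners :: "cell \<Rightarrow> (real \<times> real) set" where
  "corners ((a, b), (a', b')) = {(a, b), (a', b), (a, b'), (a', b')}"

definition domain :: "cell set \<Rightarrow> (real \<times> real) set" where
  "domain M = (\<Union>c\<in>M. region c)"

definition vertices :: "cell set \<Rightarrow> (real \<times> real) set" where
  "vertices M = (\<Union>c\<in>M. corners c)"

definition grid :: "cell set \<Rightarrow> (real \<times> real) set" where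
  "grid M = (\<Union>c\<in>M. frontier (region c))"

definition edges :: "cell set \<Rightarrow> (real \<times> real) set set" where
  "edges M = {closed_segment p q | p q.
     p \<in> vertices M \<and> q \<in> vertices M \<and> p \<noteq> q \<and> (fst p = fst q \<or> snd p = snd q) \<and>
     closed_segment p q \<subseteq> grid M \<and> open_segment p q \<inter> vertices M = {}}"

definition boundary_vertices :: "cell set \<Rightarrow> (real \<times> real) set" where
  "boundary_vertices M = vertices M \<inter> frontier (domain M)"

definition interior_vertices :: "cell set \<Rightarrow> (real \<times> real) set" where
  "interior_vertices M = vertices M - frontier (domain M)"

text \<open>An edge contains no vertices besides its two end points, so the edges
  containing a vertex are the edges ending there.\<close>

definition valence :: "cell set \<Rightarrow> real \<times> real \<Rightarrow> nat" where
  "valence M v = card {e \<in> edges M. v \<in> e}"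

definition crossing_vertices :: "cell set \<Rightarrow> (real \<times> real) set" where
  "crossing_vertices M = {v \<in> interior_vertices M. valence M v = 4}"

definition interior_edges :: "cell set \<Rightarrow> (real \<times> real) set set" where
  "interior_edges M = {e \<in> edges M. \<not> e \<subseteq> frontier (domain M)}"

definition interior_cells :: "cell set \<Rightarrow> cell set" where
  "interior_cells M =
     {c \<in> M. \<forall>e\<in>edges M. e \<subseteq> frontier (region c) \<longrightarrow> e \<in> interior_edges M}"

definition segment_of_interior_edges :: "cell set \<Rightarrow> (real \<times> real) set \<Rightarrow> bool" where
  "segment_of_interior_edges M s \<longleftrightarrow>
     (\<exists>p q. p \<noteq> q \<and> s = closed_segment p q) \<and> (\<exists>F. F \<subseteq> interior_edges M \<and> s = \<Union>F)"

definition interior_l_edges :: "cell set \<Rightarrow> (real \<times> real) set set" where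
  "interior_l_edges M = {s. segment_of_interior_edges M s \<and>
     (\<forall>s'. segment_of_interior_edges M s' \<and> s \<subseteq> s' \<longrightarrow> s' = s)}"

section \<open>Hierarchical T-meshes of 2 by 2 division\<close>

definition tensor_product_mesh :: "cell set \<Rightarrow> bool" where
  "tensor_product_mesh M \<longleftrightarrow>
     (\<exists>xs ys. sorted_wrt (<) xs \<and> sorted_wrt (<) ys \<and> 2 \<le> length xs \<and> 2 \<le> length ys \<and>
       M = {((xs ! i, ys ! j), (xs ! Suc i, ys ! Suc j)) | i j.
              Suc i < length xs \<and> Suc j < length ys})"

fun subdivide :: "cell \<Rightarrow> cell set" where
  "subdivide ((a, b), (a', b')) =
     (let m = (a + a') / 2; k = (b + b') / 2
      in {((a, b), (m, k)), ((m, b), (a', k)), ((a, k), (m, b')), ((m, k), (a', b'))})"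

text \<open>A hierarchical T-mesh is given by the sequence \<open>T 0, \<dots>, T n\<close> of its stages; values
  of \<open>T\<close> beyond \<open>n\<close> are irrelevant.\<close>

fun level_cells :: "(nat \<Rightarrow> cell set) \<Rightarrow> nat \<Rightarrow> cell set" where
  "level_cells T 0 = T 0"
| "level_cells T (Suc k) = T (Suc k) - T k"

definition hierarchical_T_mesh :: "(nat \<Rightarrow> cell set) \<Rightarrow> nat \<Rightarrow> bool" where
  "hierarchical_T_mesh T n \<longleftrightarrow> tensor_product_mesh (T 0) \<and>
     (\<forall>k<n. \<exists>D. D \<noteq> {} \<and> D \<subseteq> level_cells T k \<and>
        T (Suc k) = (T k - D) \<union> (\<Union>c\<in>D. subdivide c))"

text \<open>Splitting an existing edge by a later vertex does not raise the level of the pieces: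
  an edge gets the level of the first mesh whose grid contains it.\<close>

definition edge_level :: "(nat \<Rightarrow> cell set) \<Rightarrow> (real \<times> real) set \<Rightarrow> nat" where
  "edge_level T e = (LEAST k. e \<subseteq> grid (T k))"

definition level_l_edges :: "(nat \<Rightarrow> cell set) \<Rightarrow> nat \<Rightarrow> nat \<Rightarrow> (real \<times> real) set set" where
  "level_l_edges T n j =
     {t \<in> interior_l_edges (T n). \<forall>e\<in>edges (T n). e \<subseteq> t \<longrightarrow> edge_level T e = j}"

definition crossed_cells :: "cell set \<Rightarrow> (real \<times> real) set \<Rightarrow> cell set" where
  "crossed_cells M t = {c \<in> M. t \<inter> interior (region c) \<noteq> {}}"

text \<open>The connected components of \<open>T\<^sub>i\<close>, for \<open>i \<ge> 1\<close>, represented by their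
  l-edges. Every vertex of level \<open>i\<close> lies on an l-edge of level \<open>i\<close>, so the vertices have
  no influence on how \<open>T\<^sub>i\<close> splits.\<close>

definition l_edges_meet :: "(real \<times> real) set set \<Rightarrow> ((real \<times> real) set \<times> (real \<times> real) set) set" where
  "l_edges_meet L = {(s, t). s \<in> L \<and> t \<in> L \<and> s \<inter> t \<noteq> {}}"

definition level_components :: "(nat \<Rightarrow> cell set) \<Rightarrow> nat \<Rightarrow> nat \<Rightarrow> (real \<times> real) set set set" where
  "level_components T n i = level_l_edges T n i // (l_edges_meet (level_l_edges T n i))\<^sup>+"

definition divided_cells :: "cell set \<Rightarrow> (real \<times> real) set set \<Rightarrow> cell set" where
  "divided_cells M K = (\<Union>t\<in>K. crossed_cells M t)"

definition interior_2x2_block :: "cell set \<Rightarrow> cell set \<Rightarrow> bool" where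
  "interior_2x2_block M C \<longleftrightarrow> C \<subseteq> interior_cells M \<and>
     (\<exists>x0 x1 x2 y0 y1 y2. x0 < x1 \<and> x1 < x2 \<and> y0 < y1 \<and> y1 < y2 \<and>
        C = {((x0, y0), (x1, y1)), ((x1, y0), (x2, y1)),
             ((x0, y1), (x1, y2)), ((x1, y1), (x2, y2))})"

definition delta4_level :: "(nat \<Rightarrow> cell set) \<Rightarrow> nat \<Rightarrow> nat \<Rightarrow> nat" where
  "delta4_level T n i =
     card {K \<in> level_components T n i. interior_2x2_block (T (i - 1)) (divided_cells (T (i - 1)) K)}"

definition delta4 :: "(nat \<Rightarrow> cell set) \<Rightarrow> nat \<Rightarrow> nat" where
  "delta4 T n = (\<Sum>i=1..n. delta4_level T n i)"

section \<open>Spline spaces\<close>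

text \<open>Existence and continuity on \<open>S\<close> of all \<open>\<partial>\<^sub>x\<^sup>a \<partial>\<^sub>y\<^sup>b f\<close> with \<open>a, b \<le> r\<close>, where \<open>D a b\<close>
  is that derivative. On the boundary of \<open>S\<close> the derivatives are one-sided.\<close>

definition C_mixed :: "nat \<Rightarrow> (real \<times> real) set \<Rightarrow> (real \<times> real \<Rightarrow> real) \<Rightarrow> bool" where
  "C_mixed r S f \<longleftrightarrow> (\<exists>D :: nat \<Rightarrow> nat \<Rightarrow> real \<times> real \<Rightarrow> real.
     D 0 0 = f \<and>
     (\<forall>a\<le>r. \<forall>b\<le>r. continuous_on S (D a b)) \<and>
     (\<forall>b<r. \<forall>x y. (x, y) \<in> S \<longrightarrow>
        ((\<lambda>t. D 0 b (x, t)) has_real_derivative D 0 (Suc b) (x, y)) (at y within {t. (x, t) \<in> S})) \<and>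
     (\<forall>a<r. \<forall>b\<le>r. \<forall>x y. (x, y) \<in> S \<longrightarrow>
        ((\<lambda>s. D a b (s, y)) has_real_derivative D (Suc a) b (x, y)) (at x within {s. (s, y) \<in> S})))"

definition bidegree_poly_on :: "nat \<Rightarrow> (real \<times> real) set \<Rightarrow> (real \<times> real \<Rightarrow> real) \<Rightarrow> bool" where
  "bidegree_poly_on d S f \<longleftrightarrow>
     (\<exists>u :: nat \<Rightarrow> nat \<Rightarrow> real. \<forall>x y. (x, y) \<in> S \<longrightarrow> f (x, y) = (\<Sum>i\<le>d. \<Sum>j\<le>d. u i j * x ^ i * y ^ j))"

text \<open>Functions on the domain are represented by their extension by \<open>0\<close>, which makes
  the representation unique. The definition is meant for \<open>d \<ge> 1\<close>.\<close>

definition spline_space :: "nat \<Rightarrow> cell set \<Rightarrow> (real \<times> real \<Rightarrow> real) set" where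
  "spline_space d M = {f. (\<forall>p. p \<notin> domain M \<longrightarrow> f p = 0) \<and>
     C_mixed (d - 1) (domain M) f \<and> (\<forall>c\<in>M. bidegree_poly_on d (region c) f)}"

interpretation fun_space: vector_space "\<lambda>(c :: real) (f :: real \<times> real \<Rightarrow> real) p. c * f p"
  by unfold_locales (auto simp: fun_eq_iff algebra_simps)

lemma C_mixed_add:
  assumes "C_mixed r S f" "C_mixed r S g"
  shows "C_mixed r S (f + g)"
proof -
  from assms(1) obtain D where D: "D 0 0 = f"
    "\<forall>a\<le>r. \<forall>b\<le>r. continuous_on S (D a b)"
    "\<forall>b<r. \<forall>x y. (x, y) \<in> S \<longrightarrow>
        ((\<lambda>t. D 0 b (x, t)) has_real_derivative D 0 (Suc b) (x, y)) (at y within {t. (x, t) \<in> S})"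
    "\<forall>a<r. \<forall>b\<le>r. \<forall>x y. (x, y) \<in> S \<longrightarrow>
        ((\<lambda>s. D a b (s, y)) has_real_derivative D (Suc a) b (x, y)) (at x within {s. (s, y) \<in> S})"
    unfolding C_mixed_def by (elim exE conjE)
  from assms(2) obtain E where E: "E 0 0 = g"
    "\<forall>a\<le>r. \<forall>b\<le>r. continuous_on S (E a b)"
    "\<forall>b<r. \<forall>x y. (x, y) \<in> S \<longrightarrow>
        ((\<lambda>t. E 0 b (x, t)) has_real_derivative E 0 (Suc b) (x, y)) (at y within {t. (x, t) \<in> S})"
    "\<forall>a<r. \<forall>b\<le>r. \<forall>x y. (x, y) \<in> S \<longrightarrow>
        ((\<lambda>s. E a b (s, y)) has_real_derivative E (Suc a) b (x, y)) (at x within {s. (s, y) \<in> S})"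
    unfolding C_mixed_def by (elim exE conjE)
  show ?thesis unfolding C_mixed_def
  proof (intro exI[of _ "\<lambda>a b p. D a b p + E a b p"] conjI allI impI)
    show "(\<lambda>p. D 0 0 p + E 0 0 p) = f + g"
      by (simp add: D(1) E(1) plus_fun_def)
  qed (rule continuous_on_add DERIV_add; use D(2-4) E(2-4) in simp)+
qed

lemma C_mixed_cmult:
  assumes "C_mixed r S f"
  shows "C_mixed r S (\<lambda>p. k * f p)"
proof -
  from assms obtain D where D: "D 0 0 = f"
    "\<forall>a\<le>r. \<forall>b\<le>r. continuous_on S (D a b)"
    "\<forall>b<r. \<forall>x y. (x, y) \<in> S \<longrightarrow>
        ((\<lambda>t. D 0 b (x, t)) has_real_derivative D 0 (Suc b) (x, y)) (at y within {t. (x, t) \<in> S})"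
    "\<forall>a<r. \<forall>b\<le>r. \<forall>x y. (x, y) \<in> S \<longrightarrow>
        ((\<lambda>s. D a b (s, y)) has_real_derivative D (Suc a) b (x, y)) (at x within {s. (s, y) \<in> S})"
    unfolding C_mixed_def by (elim exE conjE)
  show ?thesis unfolding C_mixed_def
  proof (intro exI[of _ "\<lambda>a b p. k * D a b p"] conjI allI impI)
    show "(\<lambda>p. k * D 0 0 p) = (\<lambda>p. k * f p)"
      by (simp add: D(1))
  qed (rule continuous_on_mult_left DERIV_cmult; use D(2-4) in simp)+
qed

lemma subspace_spline_space: "fun_space.subspace (spline_space d M)"
proof (rule fun_space.subspaceI)
  have "C_mixed (d - 1) (domain M) 0"
    unfolding C_mixed_def by (rule exI[of _ "\<lambda>_ _ _. 0"]) (simp add: zero_fun_def)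
  moreover have "bidegree_poly_on d (region c) 0" for c
    unfolding bidegree_poly_on_def by (rule exI[of _ "\<lambda>_ _. 0"]) simp
  ultimately show "0 \<in> spline_space d M"
    by (simp add: spline_space_def)
next
  fix f g assume fg: "f \<in> spline_space d M" "g \<in> spline_space d M"
  have "bidegree_poly_on d (region c) (f + g)" if "c \<in> M" for c
  proof -
    have "bidegree_poly_on d (region c) f" "bidegree_poly_on d (region c) g"
      using fg that by (simp_all add: spline_space_def)
    then obtain u v where uv:
      "\<forall>x y. (x, y) \<in> region c \<longrightarrow> f (x, y) = (\<Sum>i\<le>d. \<Sum>j\<le>d. u i j * x ^ i * y ^ j)"
      "\<forall>x y. (x, y) \<in> region c \<longrightarrow> g (x, y) = (\<Sum>i\<le>d. \<Sum>j\<le>d. v i j * x ^ i * y ^ j)"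
      unfolding bidegree_poly_on_def by (elim exE)
    show ?thesis unfolding bidegree_poly_on_def
      by (rule exI[of _ "\<lambda>i j. u i j + v i j"]) (simp add: uv sum.distrib distrib_right)
  qed
  moreover have "C_mixed (d - 1) (domain M) (f + g)"
    using fg by (intro C_mixed_add) (simp_all add: spline_space_def)
  ultimately show "f + g \<in> spline_space d M"
    using fg by (simp add: spline_space_def)
next
  fix r :: real and f assume f: "f \<in> spline_space d M"
  have "bidegree_poly_on d (region c) (\<lambda>p. r * f p)" if "c \<in> M" for c
  proof -
    have "bidegree_poly_on d (region c) f"
      using f that by (simp add: spline_space_def)
    then obtain u where u:
      "\<forall>x y. (x, y) \<in> region c \<longrightarrow> f (x, y) = (\<Sum>i\<le>d. \<Sum>j\<le>d. u i j * x ^ i * y ^ j)"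
      unfolding bidegree_poly_on_def by (elim exE)
    show ?thesis unfolding bidegree_poly_on_def
      by (rule exI[of _ "\<lambda>i j. r * u i j"]) (simp add: u sum_distrib_left mult.assoc)
  qed
  moreover have "C_mixed (d - 1) (domain M) (\<lambda>p. r * f p)"
    using f by (intro C_mixed_cmult) (simp add: spline_space_def)
  ultimately show "(\<lambda>p. r * f p) \<in> spline_space d M"
    using f by (simp add: spline_space_def)
qed

end

theory Submission
  imports Defs
begin

text \<open>In the tensor product truncated power basis on the finest grid, a spline on the mesh is given by one
  coefficient per interior vertex, cubic initial pieces for the l-edges that start on the boundary, and
  the polynomials of bidegree \<open>(3, 3)\<close>, subject to four linear conditions for every l-edge whose upper end is
  interior. Counting unknowns and conditions gives the formula without the last summand, which is the number of
  linear dependencies among the conditions. Dually, a dependency is a family of cubic polynomials on the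
  l-edges, zero on those that end on the boundary, such that the values of the two polynomials at every vertex
  add up to zero. Consider the lowest level at which a dependency does not vanish. A polynomial there has a zero at
  each crossing with a line of lower level; since every l-edge crosses at least two cells, it is either zero
  or its l-edge crosses exactly two cells, in which case it is determined up to a factor and nonzero in the centers
  of these cells. Hence the crossing l-edges are of the same kind, and they close up to an isolated
  \<open>2 \<times> 2\<close> block of interior cells. Conversely, each such block carries a dependency.\<close>

section \<open>Dimension counts in function spaces\<close>

text \<open>Along a line the coefficient function starts at the lower boundary as a cubic and gains
  a multiple of \<open>(u - c) ^ 3\<close> at every vertex \<open>c\<close>. It has to vanish
  wherever the mesh has no edge, so an l-edge that stops inside must bring it back to zero; the four
  coefficients of a cubic give four conditions, and an l-edge that runs into the upper boundary
  gives none. Up to constants the coefficients of \<open>(u - c) ^ 3\<close> are the powers of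
  \<open>c\<close>, so the transposed system evaluates cubic polynomials at vertices, and the rank
  is found by counting zeros. An l-edge that crosses two cells has three zeros, at its ends and
  between the cells: just one too few to kill a cubic. This is where the blocks come from. The
  dependency of a block also lives on the finer l-edges inside it, so the dimension is counted along
  a filtration by level. Every stage of the hierarchy is the same integer grid with truncated
  levels, so each fact about meshes also applies to the earlier stages, to which divided cells and
  interior cells refer.\<close>

interpretation fv: vector_space "\<lambda>(c :: real) (f :: 'a \<Rightarrow> real) p. c * f p"
  by unfold_locales (auto simp: fun_eq_iff algebra_simps)

text \<open>A predicate instead of an equation for \<open>fv.dim\<close>: it includes the existence
  of a finite basis, so it passes through kernels and images without separate finiteness
  arguments.\<close>

definition has_dim :: "('a \<Rightarrow> real) set \<Rightarrow> nat \<Rightarrow> bool" where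
  "has_dim S k \<longleftrightarrow> (\<exists>b. finite b \<and> fv.independent b \<and> fv.span b = S \<and> card b = k)"

lemma has_dim_imp_dim: "has_dim S k \<Longrightarrow> fv.dim S = k"
  unfolding has_dim_def by (metis fv.dim_eq_card fv.span_span)

lemma has_dim_unique: "has_dim S k \<Longrightarrow> has_dim S l \<Longrightarrow> k = l"
  using has_dim_imp_dim by blast

lemma subspace_apply_iff:
  "fv.subspace S \<longleftrightarrow> (\<lambda>_. 0) \<in> S \<and> (\<forall>f\<in>S. \<forall>g\<in>S. (\<lambda>x. f x + g x) \<in> S) \<and> (\<forall>c. \<forall>f\<in>S. (\<lambda>x. c * f x) \<in> S)"
  by (simp add: fv.subspace_def zero_fun_def plus_fun_def)

lemma has_dim_zero: "has_dim {\<lambda>_. 0} 0"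
  unfolding has_dim_def by (rule exI[of _ "{}"]) (auto simp: fv.independent_empty zero_fun_def)

lemma has_dim_insert:
  assumes "has_dim S k" "v \<notin> S" "\<And>w. w \<in> S' \<longleftrightarrow> (\<exists>c. (\<lambda>x. w x - c * v x) \<in> S)"
  shows "has_dim S' (Suc k)"
proof -
  obtain b where b: "finite b" "fv.independent b" "fv.span b = S" "card b = k"
    using assms(1) unfolding has_dim_def by blast
  have "v \<notin> b" using assms(2) b fv.span_base by blast
  moreover have "fv.span (insert v b) = S'"
    using assms(3) b(3) by (auto simp: fv.span_insert fun_diff_def)
  ultimately show ?thesis unfolding has_dim_def
    using b assms(2) fv.independent_insertI[of v b] by (intro exI[of _ "insert v b"]) auto
qed

text \<open>A vector outside the kernel of a functional spans a complement of the kernel: subtract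
  \<open>ev w / ev v\<close> times \<open>v\<close> from any \<open>w\<close>.\<close>

lemma has_dim_kernel:
  fixes ev :: "('a \<Rightarrow> real) \<Rightarrow> real"
  assumes k: "has_dim {s \<in> S. ev s = 0} k" and S: "fv.subspace S" and v: "v \<in> S" "ev v \<noteq> 0"
    and lin: "\<And>f g c. ev (\<lambda>x. f x - c * g x) = ev f - c * ev g"
  shows "has_dim S (Suc k)"
proof (rule has_dim_insert[OF k, where v = v])
  show "v \<notin> {s \<in> S. ev s = 0}" using v by simp
  fix w
  have sub: "(\<lambda>x. f x - c * g x) \<in> S" if "f \<in> S" "g \<in> S" for f g c
    using fv.subspace_diff[OF S that(1) fv.subspace_scale[OF S that(2), of c]] by (simp add: fun_diff_def)
  have sub': "w \<in> S" if "(\<lambda>x. w x - c * v x) \<in> S" for c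
    using sub[OF that v(1), of "- c"] by simp
  show "w \<in> S \<longleftrightarrow> (\<exists>c. (\<lambda>x. w x - c * v x) \<in> {s \<in> S. ev s = 0})"
    using sub sub' v by (auto simp: lin intro!: exI[of _ "ev w / ev v"])
qed

lemma has_dim_subset:
  assumes "has_dim S k" "fv.subspace S'" "S' \<subseteq> S"
  shows "\<exists>k'. has_dim S' k'"
proof -
  obtain b where b: "finite b" "fv.independent b" "fv.span b = S" "card b = k"
    using assms(1) unfolding has_dim_def by blast
  obtain B where B: "B \<subseteq> S'" "fv.independent B" "S' \<subseteq> fv.span B"
    using fv.maximal_independent_subset[of S'] by blast
  have "finite B" using fv.independent_span_bound[OF b(1) B(2)] B(1) assms(3) b(3) by blast
  moreover have "fv.span B = S'" using B assms(2) by (metis fv.span_subspace)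
  ultimately show ?thesis unfolding has_dim_def using B by blast
qed

lemma has_dim_kernel_family:
  fixes ev :: "'i \<Rightarrow> ('a \<Rightarrow> real) \<Rightarrow> real"
  assumes "finite I" and S: "fv.subspace S"
    and lin: "\<And>i f g c. i \<in> I \<Longrightarrow> ev i (\<lambda>x. f x - c * g x) = ev i f - c * ev i g"
    and v: "\<And>i. i \<in> I \<Longrightarrow> v i \<in> S" "\<And>i. i \<in> I \<Longrightarrow> ev i (v i) \<noteq> 0"
      "\<And>i j. i \<in> I \<Longrightarrow> j \<in> I \<Longrightarrow> i \<noteq> j \<Longrightarrow> ev i (v j) = 0"
    and k: "has_dim {s \<in> S. \<forall>i\<in>I. ev i s = 0} k"
  shows "has_dim S (k + card I)"
proof -
  \<comment> \<open>\<open>J\<close> is the set of conditions that have already been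
    dropped.\<close>
  have "J \<subseteq> I \<Longrightarrow> has_dim {s \<in> S. \<forall>i\<in>I - J. ev i s = 0} (k + card J)" if "finite J" for J
    using that
  proof (induction J)
    case (insert j J)
    let ?S' = "{s \<in> S. \<forall>i\<in>I - insert j J. ev i s = 0}"
    have eq: "{s \<in> ?S'. ev j s = 0} = {s \<in> S. \<forall>i\<in>I - J. ev i s = 0}"
      using insert.hyps insert.prems by auto
    have neg: "ev i (\<lambda>_. 0) = 0" if "i \<in> I" for i
      using lin[OF that, of "v i" 1 "v i"] by simp
    have scale: "ev i (\<lambda>x. c * f x) = c * ev i f" if "i \<in> I" for i c f
      using lin[OF that, of "\<lambda>_. 0" "-c" f] neg[OF that] by simp
    have add: "ev i (\<lambda>x. f x + g x) = ev i f + ev i g" if "i \<in> I" for i f g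
      using lin[OF that, of f "-1" g] by simp
    have "fv.subspace ?S'"
      using S unfolding subspace_apply_iff by (simp add: neg scale add)
    moreover have "v j \<in> ?S'" using insert v by auto
    moreover have "has_dim {s \<in> ?S'. ev j s = 0} (k + card J)"
      using insert unfolding eq by simp
    ultimately have "has_dim ?S' (Suc (k + card J))"
      using insert v lin by (intro has_dim_kernel[where ev = "ev j" and v = "v j"]) auto
    then show ?case using insert by simp
  qed (use k in simp)
  from this[OF assms(1)] show ?thesis by simp
qed

lemma has_dim_supported:
  assumes "finite A"
  shows "has_dim {f :: 'a \<Rightarrow> real. \<forall>x. x \<notin> A \<longrightarrow> f x = 0} (card A)"
proof -
  let ?S = "{f :: 'a \<Rightarrow> real. \<forall>x. x \<notin> A \<longrightarrow> f x = 0}"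
  have "{s \<in> ?S. \<forall>i\<in>A. s i = 0} = {\<lambda>_. 0}" by auto
  then have "has_dim ?S (0 + card A)"
    using has_dim_zero assms
    by (intro has_dim_kernel_family[where ev = "\<lambda>i f. f i" and v = "\<lambda>i j. of_bool (i = j)"])
       (auto simp: subspace_apply_iff)
  then show ?thesis by simp
qed

lemma has_dim_image:
  fixes f :: "('a \<Rightarrow> real) \<Rightarrow> 'b \<Rightarrow> real"
  assumes "has_dim S k" and lin: "\<And>g h. f (\<lambda>x. g x + h x) = (\<lambda>x. f g x + f h x)" "\<And>c g. f (\<lambda>x. c * g x) = (\<lambda>x. c * f g x)"
    and inj: "\<And>g. g \<in> S \<Longrightarrow> f g = (\<lambda>_. 0) \<Longrightarrow> g = (\<lambda>_. 0)"
  shows "has_dim (f ` S) k"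
proof -
  obtain b where b: "finite b" "fv.independent b" "fv.span b = S" "card b = k"
    using assms(1) unfolding has_dim_def by blast
  interpret vector_space_pair "\<lambda>(c :: real) (f :: 'a \<Rightarrow> real) p. c * f p" "\<lambda>(c :: real) (f :: 'b \<Rightarrow> real) p. c * f p" ..
  have l: "Vector_Spaces.linear (\<lambda>(c :: real) (f :: 'a \<Rightarrow> real) p. c * f p) (\<lambda>(c :: real) (f :: 'b \<Rightarrow> real) p. c * f p) f"
    unfolding Vector_Spaces.linear_iff by (simp add: fv.vector_space_axioms lin plus_fun_def)
  have i: "inj_on f (fv.span b)"
    using inj b by (subst linear_inj_on_iff_eq_0[OF l fv.subspace_span]) (auto simp: zero_fun_def)
  have "fv.independent (f ` b)"
    using linear_independent_injective_image[OF l b(2) i] .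
  moreover have "fv.span (f ` b) = f ` S"
    using linear_span_image[OF l, of b] b by simp
  moreover have "card (f ` b) = k" using b i fv.span_superset by (metis card_image inj_on_subset)
  ultimately show ?thesis unfolding has_dim_def using b by blast
qed

text \<open>This is the equality of row rank and column rank.\<close>

lemma has_dim_solutions:
  fixes m :: "'b \<Rightarrow> 'a \<Rightarrow> real"
  assumes "finite A" "finite B"
    and dep: "has_dim {\<kappa>. (\<forall>\<beta>. \<beta> \<notin> B \<longrightarrow> \<kappa> \<beta> = 0) \<and> (\<forall>\<alpha>\<in>A. (\<Sum>\<beta>\<in>B. \<kappa> \<beta> * m \<beta> \<alpha>) = 0)} l"
  shows "\<exists>k. has_dim {\<gamma>. (\<forall>\<alpha>. \<alpha> \<notin> A \<longrightarrow> \<gamma> \<alpha> = 0) \<and> (\<forall>\<beta>\<in>B. (\<Sum>\<alpha>\<in>A. m \<beta> \<alpha> * \<gamma> \<alpha>) = 0)} k \<and>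
    k + card B = card A + l"
proof -
  define G where "G B = {\<gamma> :: 'a \<Rightarrow> real. (\<forall>\<alpha>. \<alpha> \<notin> A \<longrightarrow> \<gamma> \<alpha> = 0) \<and> (\<forall>\<beta>\<in>B. (\<Sum>\<alpha>\<in>A. m \<beta> \<alpha> * \<gamma> \<alpha>) = 0)}" for B
  define D where "D B = {\<kappa> :: 'b \<Rightarrow> real. (\<forall>\<beta>. \<beta> \<notin> B \<longrightarrow> \<kappa> \<beta> = 0) \<and> (\<forall>\<alpha>\<in>A. (\<Sum>\<beta>\<in>B. \<kappa> \<beta> * m \<beta> \<alpha>) = 0)}" for B
  have Gsub: "fv.subspace (G B)" for B
    unfolding subspace_apply_iff G_def
    by (auto simp: distrib_left sum.distrib mult.left_commute simp flip: sum_distrib_left)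
  \<comment> \<open>The second conjunct, on functionals that vanish on all solutions, strengthens
    the induction: a new equation that is redundant is a combination of the old ones and produces a
    dependency; any other one lowers the dimension of the solutions.\<close>
  have "(\<exists>k l. has_dim (G B) k \<and> has_dim (D B) l \<and> k + card B = card A + l) \<and>
     (\<forall>\<phi>. (\<forall>\<gamma>\<in>G B. (\<Sum>\<alpha>\<in>A. \<phi> \<alpha> * \<gamma> \<alpha>) = 0) \<longrightarrow> (\<exists>\<mu>. \<forall>\<alpha>\<in>A. \<phi> \<alpha> = (\<Sum>\<beta>\<in>B. \<mu> \<beta> * m \<beta> \<alpha>)))"
    using assms(2)
  proof (induction B)
    case empty
    have "has_dim (G {}) (card A)" using has_dim_supported[OF assms(1)] by (simp add: G_def)
    moreover have "D {} = {\<lambda>_. 0}" by (auto simp: D_def)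
    then have "has_dim (D {}) 0" using has_dim_zero by simp
    moreover have "\<phi> \<alpha> = 0" if "\<forall>\<gamma>\<in>G {}. (\<Sum>\<alpha>\<in>A. \<phi> \<alpha> * \<gamma> \<alpha>) = 0" "\<alpha> \<in> A" for \<phi> \<alpha>
    proof -
      have "(\<Sum>\<alpha>'\<in>A. \<phi> \<alpha>' * of_bool (\<alpha>' = \<alpha>)) = 0"
        using that by (intro bspec[OF that(1), of "\<lambda>\<alpha>'. of_bool (\<alpha>' = \<alpha>)"]) (auto simp: G_def)
      then show ?thesis using that(2) assms(1)
        by (simp add: sum.delta of_bool_def if_distrib cong: if_cong)
    qed
    ultimately show ?case by fastforce
  next
    case (insert b B)
    obtain k l where kl: "has_dim (G B) k" "has_dim (D B) l" "k + card B = card A + l"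
      using insert.IH by blast
    have ann: "\<exists>\<mu>. \<forall>\<alpha>\<in>A. \<phi> \<alpha> = (\<Sum>\<beta>\<in>B. \<mu> \<beta> * m \<beta> \<alpha>)"
      if "\<forall>\<gamma>\<in>G B. (\<Sum>\<alpha>\<in>A. \<phi> \<alpha> * \<gamma> \<alpha>) = 0" for \<phi>
      using insert.IH that by blast
    have GI: "G (insert b B) = {\<gamma> \<in> G B. (\<Sum>\<alpha>\<in>A. m b \<alpha> * \<gamma> \<alpha>) = 0}"
      by (auto simp: G_def)
    have ext: "(\<Sum>\<beta>\<in>B. (\<mu>(b := c)) \<beta> * f \<beta>) = (\<Sum>\<beta>\<in>B. \<mu> \<beta> * f \<beta>)" for \<mu> c and f :: "'b \<Rightarrow> real"
      using insert.hyps by (intro sum.cong) auto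
    show ?case
    proof (cases "\<forall>\<gamma>\<in>G B. (\<Sum>\<alpha>\<in>A. m b \<alpha> * \<gamma> \<alpha>) = 0")
      case True
      have G: "G (insert b B) = G B" using True GI by auto
      obtain \<mu> where \<mu>: "\<forall>\<alpha>\<in>A. m b \<alpha> = (\<Sum>\<beta>\<in>B. \<mu> \<beta> * m \<beta> \<alpha>)" using ann[OF True] by blast
      \<comment> \<open>The new row minus its expansion in the old rows: the additional
        dependency.\<close>
      define v where "v \<beta> = (if \<beta> = b then 1 else if \<beta> \<in> B then - \<mu> \<beta> else 0)" for \<beta>
      have vB: "(\<Sum>\<beta>\<in>B. v \<beta> * m \<beta> \<alpha>) = - m b \<alpha>" if "\<alpha> \<in> A" for \<alpha>
      proof -
        have "(\<Sum>\<beta>\<in>B. v \<beta> * m \<beta> \<alpha>) = (\<Sum>\<beta>\<in>B. - (\<mu> \<beta> * m \<beta> \<alpha>))"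
          using insert.hyps by (intro sum.cong) (auto simp: v_def)
        then show ?thesis using \<mu> that by (simp add: sum_negf)
      qed
      have "has_dim (D (insert b B)) (Suc l)"
      proof (rule has_dim_kernel[where ev = "\<lambda>w. w b" and v = v])
        have "{s \<in> D (insert b B). s b = 0} = D B"
          using insert.hyps by (auto simp: D_def)
        then show "has_dim {s \<in> D (insert b B). s b = 0} l" using kl by simp
        show "fv.subspace (D (insert b B))"
          unfolding subspace_apply_iff D_def
          by (auto simp: distrib_right sum.distrib mult.assoc simp flip: sum_distrib_left)
        show "v \<in> D (insert b B)"
          using insert.hyps vB by (auto simp: D_def v_def)
      qed (auto simp: v_def)
      moreover have "\<exists>\<mu>. \<forall>\<alpha>\<in>A. \<phi> \<alpha> = (\<Sum>\<beta>\<in>insert b B. \<mu> \<beta> * m \<beta> \<alpha>)"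
        if h: "\<forall>\<gamma>\<in>G B. (\<Sum>\<alpha>\<in>A. \<phi> \<alpha> * \<gamma> \<alpha>) = 0" for \<phi>
      proof -
        obtain \<mu> where "\<forall>\<alpha>\<in>A. \<phi> \<alpha> = (\<Sum>\<beta>\<in>B. \<mu> \<beta> * m \<beta> \<alpha>)" using ann[OF h] by blast
        then show ?thesis using insert.hyps by (intro exI[of _ "\<mu>(b := 0)"]) (simp add: ext del: fun_upd_apply, simp)
      qed
      moreover have "k + card (insert b B) = card A + Suc l" using kl insert.hyps by simp
      ultimately show ?thesis unfolding G using kl(1) by blast
    next
      case False
      then obtain \<gamma>' where \<gamma>': "\<gamma>' \<in> G B" "(\<Sum>\<alpha>\<in>A. m b \<alpha> * \<gamma>' \<alpha>) \<noteq> 0" by blast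
      define q where "q = (\<Sum>\<alpha>\<in>A. m b \<alpha> * \<gamma>' \<alpha>)"
      \<comment> \<open>Normalised to the value 1 of the new equation, so that a multiple of it
        corrects every old solution.\<close>
      define \<gamma>0 where "\<gamma>0 \<alpha> = \<gamma>' \<alpha> / q" for \<alpha>
      have \<gamma>0: "\<gamma>0 \<in> G B"
        using fv.subspace_scale[OF Gsub \<gamma>'(1), of "1 / q"] by (simp add: \<gamma>0_def[abs_def])
      have q1: "(\<Sum>\<alpha>\<in>A. m b \<alpha> * \<gamma>0 \<alpha>) = 1"
        using \<gamma>'(2) by (simp add: \<gamma>0_def flip: q_def sum_divide_distrib)
      have lin: "(\<Sum>\<alpha>\<in>A. \<phi> \<alpha> * (f \<alpha> - c * g \<alpha>)) = (\<Sum>\<alpha>\<in>A. \<phi> \<alpha> * f \<alpha>) - c * (\<Sum>\<alpha>\<in>A. \<phi> \<alpha> * g \<alpha>)"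
        for f g c and \<phi> :: "'a \<Rightarrow> real"
        by (simp add: algebra_simps sum_subtractf sum_distrib_left)
      have sub: "fv.subspace (G (insert b B))" by (rule Gsub)
      obtain k' where k': "has_dim (G (insert b B)) k'"
        using has_dim_subset[OF kl(1) sub] GI by auto
      have "has_dim (G B) (Suc k')"
        using k' unfolding GI by (rule has_dim_kernel[where v = \<gamma>0]) (use Gsub \<gamma>0 q1 lin in auto)
      then have kk: "k = Suc k'" using has_dim_unique kl(1) by blast
      have D: "D (insert b B) = D B"
      proof -
        \<comment> \<open>Pairing a dependency with \<open>\<gamma>0\<close>, which solves all old
          equations, isolates the coefficient of the new row.\<close>
        have "\<kappa> b = 0" if "\<kappa> \<in> D (insert b B)" for \<kappa>
        proof -
          have "0 = (\<Sum>\<alpha>\<in>A. (\<Sum>\<beta>\<in>insert b B. \<kappa> \<beta> * m \<beta> \<alpha>) * \<gamma>0 \<alpha>)"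
            using that by (simp add: D_def)
          also have "\<dots> = (\<Sum>\<beta>\<in>insert b B. \<kappa> \<beta> * (\<Sum>\<alpha>\<in>A. m \<beta> \<alpha> * \<gamma>0 \<alpha>))"
            by (subst (1) sum_distrib_right, subst sum.swap) (simp add: sum_distrib_left mult.assoc)
          also have "\<dots> = \<kappa> b"
            using insert.hyps \<gamma>0 by (simp add: q1 G_def)
          finally show ?thesis by simp
        qed
        moreover have "{\<kappa> \<in> D (insert b B). \<kappa> b = 0} = D B"
          using insert.hyps by (auto simp: D_def)
        ultimately show ?thesis by blast
      qed
      have "\<exists>\<mu>. \<forall>\<alpha>\<in>A. \<phi> \<alpha> = (\<Sum>\<beta>\<in>insert b B. \<mu> \<beta> * m \<beta> \<alpha>)"
        if h: "\<forall>\<gamma>\<in>G (insert b B). (\<Sum>\<alpha>\<in>A. \<phi> \<alpha> * \<gamma> \<alpha>) = 0" for \<phi>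
      proof -
        \<comment> \<open>With this multiple of the new row subtracted, the functional vanishes on
          all old solutions, so that the induction hypothesis applies.\<close>
        define c where "c = (\<Sum>\<alpha>\<in>A. \<phi> \<alpha> * \<gamma>0 \<alpha>)"
        have "(\<Sum>\<alpha>\<in>A. (\<phi> \<alpha> - c * m b \<alpha>) * \<gamma> \<alpha>) = 0" if "\<gamma> \<in> G B" for \<gamma>
        proof -
          define r where "r = (\<Sum>\<alpha>\<in>A. m b \<alpha> * \<gamma> \<alpha>)"
          have "(\<lambda>\<alpha>. \<gamma> \<alpha> - r * \<gamma>0 \<alpha>) \<in> G B"
            using fv.subspace_diff[OF Gsub that fv.subspace_scale[OF Gsub \<gamma>0, of r]] by (simp add: fun_diff_def)
          then have "(\<lambda>\<alpha>. \<gamma> \<alpha> - r * \<gamma>0 \<alpha>) \<in> G (insert b B)"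
            unfolding GI by (simp add: lin q1 r_def)
          then have "(\<Sum>\<alpha>\<in>A. \<phi> \<alpha> * \<gamma> \<alpha>) = r * c" using h by (fastforce simp: lin c_def)
          then show ?thesis
            by (simp add: left_diff_distrib sum_subtractf mult.assoc r_def flip: sum_distrib_left)
        qed
        then obtain \<mu> where \<mu>: "\<forall>\<alpha>\<in>A. \<phi> \<alpha> - c * m b \<alpha> = (\<Sum>\<beta>\<in>B. \<mu> \<beta> * m \<beta> \<alpha>)"
          using ann[of "\<lambda>\<alpha>. \<phi> \<alpha> - c * m b \<alpha>"] by blast
        then show ?thesis using insert.hyps
          by (intro exI[of _ "\<mu>(b := c)"]) (simp add: ext del: fun_upd_apply, simp add: algebra_simps)
      qed
      moreover have "k' + card (insert b B) = card A + l" using kl insert.hyps kk by simp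
      ultimately show ?thesis unfolding D using kl(2) k' by blast
    qed
  qed
  then obtain k' l' where *: "has_dim (G B) k'" "has_dim (D B) l'" "k' + card B = card A + l'" by blast
  moreover have "l' = l" using dep *(2) has_dim_unique unfolding D_def by blast
  ultimately show ?thesis unfolding G_def by blast
qed

section \<open>Univariate cubic splines\<close>

lemma cube_diff_expand:
  "(x - t) ^ 3 = (\<Sum>e\<le>3. (of_nat (3 choose e) * (- t) ^ (3 - e)) * (x :: real) ^ e)"
  by (simp add: numeral_3_eq_3 numeral_2_eq_2 algebra_simps)

lemma cubic_plus_cubes:
  fixes g h c :: "_ \<Rightarrow> real"
  shows "(\<Sum>e\<le>3. g e * x ^ e) + (\<Sum>j\<in>J. h j * (x - c j) ^ 3) =
    (\<Sum>e\<le>3. (g e + (\<Sum>j\<in>J. h j * (of_nat (3 choose e) * (- c j) ^ (3 - e)))) * x ^ e)"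
proof -
  have "(\<Sum>j\<in>J. h j * (x - c j) ^ 3) = (\<Sum>j\<in>J. \<Sum>e\<le>3. h j * (of_nat (3 choose e) * (- c j) ^ (3 - e)) * x ^ e)"
    unfolding cube_diff_expand by (simp add: sum_distrib_left mult.assoc)
  also have "\<dots> = (\<Sum>e\<le>3. (\<Sum>j\<in>J. h j * (of_nat (3 choose e) * (- c j) ^ (3 - e))) * x ^ e)"
    by (subst sum.swap) (simp add: sum_distrib_right)
  finally show ?thesis by (simp add: sum.distrib distrib_right)
qed

lemma cubic_zero_on_interval:
  fixes a :: "nat \<Rightarrow> real"
  assumes "l < r" "\<And>x. l \<le> x \<Longrightarrow> x \<le> r \<Longrightarrow> (\<Sum>e\<le>n. a e * x ^ e) = 0" "e \<le> n"
  shows "a e = 0"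
proof (rule ccontr)
  assume "a e \<noteq> 0"
  then have "finite {x. (\<Sum>e\<le>n. a e * x ^ e) = 0}"
    using polyfun_rootbound_finite[of n a] assms(3) by blast
  moreover have "{l..r} \<subseteq> {x. (\<Sum>e\<le>n. a e * x ^ e) = 0}" using assms(2) by auto
  ultimately show False using assms(1) finite_subset infinite_Icc by blast
qed

lemma cubic_four_roots:
  fixes a :: "nat \<Rightarrow> real"
  assumes "4 \<le> card S" "\<And>x. x \<in> S \<Longrightarrow> (\<Sum>e\<le>3. a e * x ^ e) = 0" "e \<le> 3"
  shows "a e = 0"
proof (rule ccontr)
  assume "a e \<noteq> 0"
  then have *: "finite {x. (\<Sum>e\<le>3. a e * x ^ e) = 0}" "card {x. (\<Sum>e\<le>3. a e * x ^ e) = 0} \<le> 3"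
    using polyfun_rootbound[of 3 a] assms(3) by blast+
  have "card S \<le> card {x. (\<Sum>e\<le>3. a e * x ^ e) = 0}"
    using *(1) assms(2) by (intro card_mono) auto
  then show False using * assms(1) by simp
qed

lemma real_derivative_unique_within_interval:
  assumes "(f has_real_derivative d) (at x within {l..r})" "(f has_real_derivative d') (at x within {l..r})"
    "l < r" "x \<in> {l..r}"
  shows "d = d'"
  using vector_derivative_unique_within_closed_interval[of l r x f d d'] assms
  by (simp add: has_real_derivative_iff_has_vector_derivative)

lemma cubic_deriv:
  "((\<lambda>x. \<Sum>e\<le>3. a e * x ^ e) has_real_derivative a 1 + 2 * a 2 * x + 3 * a 3 * x ^ 2) (at x within S)"
  "((\<lambda>x. a 1 + 2 * a 2 * x + 3 * a 3 * x ^ 2) has_real_derivative 2 * a 2 + 6 * a 3 * x) (at x within S)"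
  by (auto simp: numeral_3_eq_3 numeral_2_eq_2 algebra_simps intro!: derivative_eq_intros)

text \<open>A derivative within \<open>S\<close> is also one within the piece, where derivatives are
  unique because the piece is not a single point. This reaches the end points of the piece, which
  are the knots.\<close>

lemma deriv_of_piece:
  assumes "l < r" "\<And>x. x \<in> {l..r} \<Longrightarrow> (g has_real_derivative g1 x) (at x within S)" "{l..r} \<subseteq> S"
    "\<And>x. x \<in> {l..r} \<Longrightarrow> g x = p x" "\<And>x. (p has_real_derivative p1 x) (at x within {l..r})" "x \<in> {l..r}"
  shows "g1 x = p1 x"
proof (rule real_derivative_unique_within_interval[OF _ assms(5,1,6)])
  have "(g has_real_derivative g1 x) (at x within {l..r})"
    using assms(2)[OF assms(6)] assms(3) by (rule has_field_derivative_subset)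
  then show "(p has_real_derivative g1 x) (at x within {l..r})"
    by (rule has_field_derivative_transform_within[OF _ zero_less_one assms(6)]) (use assms(4) in auto)
qed

text \<open>Values, first and second derivatives of both pieces agree at \<open>k\<close>, so the
  difference of the two cubics has a triple root there.\<close>

lemma cubic_C2_match:
  fixes a b :: "nat \<Rightarrow> real"
  assumes "l < k" "k < r"
    and g: "\<And>x. x \<in> {l..r} \<Longrightarrow> (g has_real_derivative g1 x) (at x within {l..r})"
      "\<And>x. x \<in> {l..r} \<Longrightarrow> (g1 has_real_derivative g2 x) (at x within {l..r})"
    and a: "\<And>x. x \<in> {l..k} \<Longrightarrow> g x = (\<Sum>e\<le>3. a e * x ^ e)"
    and b: "\<And>x. x \<in> {k..r} \<Longrightarrow> g x = (\<Sum>e\<le>3. b e * x ^ e)"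
  shows "(\<Sum>e\<le>3. b e * x ^ e) = (\<Sum>e\<le>3. a e * x ^ e) + (b 3 - a 3) * (x - k) ^ 3"
proof -
  have "g1 x = a 1 + 2 * a 2 * x + 3 * a 3 * x ^ 2" if "x \<in> {l..k}" for x
    by (rule deriv_of_piece[where g = g and S = "{l..r}", OF assms(1) _ _ _ cubic_deriv(1) that])
      (use a g assms(2) in auto)
  note a1 = this
  have "g2 k = 2 * a 2 + 6 * a 3 * k"
    by (rule deriv_of_piece[where g = g1 and S = "{l..r}" and l = l and r = k, OF assms(1) _ _ a1 cubic_deriv(2)])
      (use g assms in auto)
  note a2 = this
  have "g1 x = b 1 + 2 * b 2 * x + 3 * b 3 * x ^ 2" if "x \<in> {k..r}" for x
    by (rule deriv_of_piece[where g = g and S = "{l..r}", OF assms(2) _ _ _ cubic_deriv(1) that])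
      (use b g assms(1) in auto)
  note b1 = this
  have "g2 k = 2 * b 2 + 6 * b 3 * k"
    by (rule deriv_of_piece[where g = g1 and S = "{l..r}" and l = k and r = r, OF assms(2) _ _ b1 cubic_deriv(2)])
      (use g assms in auto)
  note b2 = this
  define d where "d e = b e - a e" for e
  have "2 * d 2 + 6 * d 3 * k = 0" using a2 b2 by (simp add: d_def algebra_simps)
  then have d2: "d 2 = - 3 * d 3 * k" by simp
  have "d 1 + 2 * d 2 * k + 3 * d 3 * k ^ 2 = 0" using a1[of k] b1[of k] assms(1,2) by (simp add: d_def algebra_simps)
  then have d1: "d 1 = 3 * d 3 * k ^ 2" unfolding d2 by (simp add: algebra_simps power2_eq_square)
  have "(\<Sum>e\<le>3. d e * k ^ e) = 0" using a[of k] b[of k] assms(1,2) by (simp add: d_def left_diff_distrib sum_subtractf)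
  then have "d 0 + d 1 * k + d 2 * k ^ 2 + d 3 * k ^ 3 = 0" by (simp add: numeral_3_eq_3 numeral_2_eq_2)
  then have d0: "d 0 = - d 3 * k ^ 3" unfolding d1 d2 by (simp add: algebra_simps power2_eq_square power3_eq_cube)
  have "(\<Sum>e\<le>3. d e * x ^ e) = d 0 + d 1 * x + d 2 * x ^ 2 + d 3 * x ^ 3"
    by (simp add: numeral_3_eq_3 numeral_2_eq_2)
  also have "\<dots> = d 3 * (x - k) ^ 3"
    unfolding d0 d1 d2 by (simp add: algebra_simps power2_eq_square power3_eq_cube)
  finally show ?thesis by (simp add: d_def left_diff_distrib sum_subtractf)
qed

text \<open>The truncated power basis for the knots \<open>c 0 < \<dots> < c m\<close> consists of the functions with
  indices below \<open>m + 3\<close>; index \<open>3 + i\<close> belongs to the interior knot \<open>c i\<close>.\<close>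

definition tpow :: "(nat \<Rightarrow> real) \<Rightarrow> nat \<Rightarrow> real \<Rightarrow> real" where
  "tpow c k x = (if k \<le> 3 then x ^ k else (max 0 (x - c (k - 3))) ^ 3)"

lemma sum_tpow_index:
  fixes f :: "nat \<Rightarrow> real"
  assumes "0 < m"
  shows "(\<Sum>k<m + 3. f k) = (\<Sum>k\<le>3. f k) + (\<Sum>j\<in>{1..<m}. f (3 + j))"
  using assms
proof (induction m rule: nat_induct_non_zero)
  case 1
  have "{..<1 + 3 :: nat} = {..3}" by auto
  then show ?case by simp
next
  case (Suc m)
  have "(\<Sum>k<Suc m + 3. f k) = (\<Sum>k<m + 3. f k) + f (m + 3)"
    by (metis add_Suc sum.lessThan_Suc)
  then show ?case using Suc by (simp add: sum.op_ivl_Suc add.commute)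
qed

text \<open>Truncated powers of knots to the right of \<open>x\<close> vanish, the others are plain
  cubes. In the last interval \<open>x\<close> has no upper bound, as the end point
  \<open>c m\<close> is no knot; the induction in \<open>spline1_representation\<close> evaluates
  the expansion beyond it.\<close>

lemma sum_tpow:
  assumes c: "\<And>i j. i < j \<Longrightarrow> j \<le> m \<Longrightarrow> c i < c j" and "i < m"
    and x: "c i \<le> x" "i + 1 < m \<Longrightarrow> x \<le> c (Suc i)"
  shows "(\<Sum>k<m + 3. g k * tpow c k x) = (\<Sum>k\<le>3. g k * x ^ k) + (\<Sum>j\<in>{1..i}. g (3 + j) * (x - c j) ^ 3)"
proof -
  have "(\<Sum>k<m + 3. g k * tpow c k x) = (\<Sum>k\<le>3. g k * x ^ k) + (\<Sum>j\<in>{1..<m}. g (3 + j) * tpow c (3 + j) x)"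
    using \<open>i < m\<close> by (subst sum_tpow_index) (auto simp: tpow_def)
  also have "(\<Sum>j\<in>{1..<m}. g (3 + j) * tpow c (3 + j) x) = (\<Sum>j\<in>{1..i}. g (3 + j) * (x - c j) ^ 3)"
  proof (rule sum.mono_neutral_cong_right)
    show "\<forall>j\<in>{1..<m} - {1..i}. g (3 + j) * tpow c (3 + j) x = 0"
    proof
      fix j assume j: "j \<in> {1..<m} - {1..i}"
      then have "c (Suc i) \<le> c j" using c[of "Suc i" j] by (cases "j = Suc i") auto
      then show "g (3 + j) * tpow c (3 + j) x = 0" using x j by (auto simp: tpow_def)
    qed
    fix j assume j: "j \<in> {1..i}"
    then have "c j \<le> c i" using c[of j i] assms(2) by (cases "j = i") auto
    then show "g (3 + j) * tpow c (3 + j) x = g (3 + j) * (x - c j) ^ 3" using x j by (simp add: tpow_def)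
  qed (use assms(2) in auto)
  finally show ?thesis .
qed

text \<open>On the first interval only the monomials are active. Every further interval activates
  one more coefficient, which is read off at its right end point.\<close>

lemma tpow_independent:
  assumes c: "\<And>i j. i < j \<Longrightarrow> j \<le> m \<Longrightarrow> c i < c j" and "0 < m"
    and z: "\<And>x. x \<in> {c 0..c m} \<Longrightarrow> (\<Sum>k<m + 3. g k * tpow c k x) = 0" and "k < m + 3"
  shows "g k = 0"
proof -
  have le: "c i \<le> c j" if "i \<le> j" "j \<le> m" for i j using c[of i j] that by (cases "i = j") auto
  have low: "g k = 0" if "k \<le> 3" for k
  proof (rule cubic_zero_on_interval[OF _ _ that])
    show "c 0 < c 1" using c assms(2) by simp
    fix x assume x: "c 0 \<le> x" "x \<le> c 1"
    then show "(\<Sum>e\<le>3. g e * x ^ e) = 0"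
      using sum_tpow[where c = c and m = m and i = 0 and x = x and g = g, OF c] z[of x] le[of 1 m] assms(2) by simp
  qed
  have "g (3 + i) = 0" if "1 \<le> i" "i < m" for i
    using that
  proof (induction i rule: less_induct)
    case (less i)
    have lt: "c i < c (Suc i)" using c less by simp
    have "(\<Sum>k<m + 3. g k * tpow c k (c (Suc i))) = 0"
      using z[of "c (Suc i)"] le less.prems by simp
    then have "(\<Sum>j\<in>{1..i}. g (3 + j) * (c (Suc i) - c j) ^ 3) = 0"
      using sum_tpow[where c = c and m = m and i = i and x = "c (Suc i)" and g = g, OF c] lt less.prems low by simp
    moreover have "{1..i} = insert i {1..<i}" using less.prems by auto
    ultimately show ?case using less lt by simp
  qed
  from this[of "k - 3"] show ?thesis using low assms(4) by (cases "k \<le> 3") auto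
qed

text \<open>The second derivative is taken within the whole interval, so it has a single value at
  each knot; this is the smoothness that \<open>cubic_C2_match\<close> uses.\<close>

definition spline1 :: "(nat \<Rightarrow> real) \<Rightarrow> nat \<Rightarrow> (real \<Rightarrow> real) \<Rightarrow> bool" where
  "spline1 c m g \<longleftrightarrow>
    (\<exists>g1 g2. \<forall>x\<in>{c 0..c m}. (g has_real_derivative g1 x) (at x within {c 0..c m}) \<and>
       (g1 has_real_derivative g2 x) (at x within {c 0..c m})) \<and>
    (\<forall>i<m. \<exists>a. \<forall>x\<in>{c i..c (Suc i)}. g x = (\<Sum>e\<le>3. a e * x ^ e))"

text \<open>Lagrange interpolation: \<open>W e j\<close> is the coefficient of \<open>x ^ e\<close>
  in the \<open>j\<close>-th basis polynomial. \<open>W\<close> is chosen before \<open>a\<close>,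
  so the coefficients depend linearly on the four values.\<close>

lemma cubic_interpolation:
  fixes t0 t1 t2 t3 :: real
  assumes "t0 \<noteq> t1" "t0 \<noteq> t2" "t0 \<noteq> t3" "t1 \<noteq> t2" "t1 \<noteq> t3" "t2 \<noteq> t3"
  shows "\<exists>W. \<forall>a. \<forall>e\<le>3. a e = (\<Sum>j<4. W e j * (\<Sum>i\<le>3. a i * ([t0, t1, t2, t3] ! j) ^ i))"
proof -
  define q where "q r s t = (!) [- (r * s * t), r * s + r * t + s * t, - r - s - t, 1]" for r s t :: real
  have q: "(\<Sum>e\<le>3. q r s t e * x ^ e) = (x - r) * (x - s) * (x - t)" for r s t x
    by (simp add: q_def numeral_3_eq_3 numeral_2_eq_2 algebra_simps)
  have qD: "(\<Sum>e\<le>3. q r s t e * x ^ e / D) = (x - r) * (x - s) * (x - t) / D" for r s t x D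
    by (simp add: q flip: sum_divide_distrib)
  define W where "W e = (!) [q t1 t2 t3 e / ((t0 - t1) * (t0 - t2) * (t0 - t3)),
    q t0 t2 t3 e / ((t1 - t0) * (t1 - t2) * (t1 - t3)),
    q t0 t1 t3 e / ((t2 - t0) * (t2 - t1) * (t2 - t3)),
    q t0 t1 t2 e / ((t3 - t0) * (t3 - t1) * (t3 - t2))]" for e
  have four: "(\<Sum>j<4. f j) = f 0 + f 1 + f 2 + f 3" for f :: "nat \<Rightarrow> real"
    by (simp add: eval_nat_numeral)
  have W: "(\<Sum>e\<le>3. W e 0 * x ^ e) = (x - t1) * (x - t2) * (x - t3) / ((t0 - t1) * (t0 - t2) * (t0 - t3))"
    "(\<Sum>e\<le>3. W e 1 * x ^ e) = (x - t0) * (x - t2) * (x - t3) / ((t1 - t0) * (t1 - t2) * (t1 - t3))"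
    "(\<Sum>e\<le>3. W e 2 * x ^ e) = (x - t0) * (x - t1) * (x - t3) / ((t2 - t0) * (t2 - t1) * (t2 - t3))"
    "(\<Sum>e\<le>3. W e 3 * x ^ e) = (x - t0) * (x - t1) * (x - t2) / ((t3 - t0) * (t3 - t1) * (t3 - t2))" for x
    by (simp_all add: W_def qD)
  have "a e = (\<Sum>j<4. W e j * (\<Sum>i\<le>3. a i * ([t0, t1, t2, t3] ! j) ^ i))" if "e \<le> 3" for a e
  proof -
    define p where "p x = (\<Sum>i\<le>3. a i * x ^ i)" for x
    define b where "b e = (\<Sum>j<4. W e j * p ([t0, t1, t2, t3] ! j))" for e
    have b: "(\<Sum>e\<le>3. b e * x ^ e) = (\<Sum>j<4. (\<Sum>e\<le>3. W e j * x ^ e) * p ([t0, t1, t2, t3] ! j))" for x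
      unfolding b_def sum_distrib_right by (subst sum.swap) (simp add: mult_ac)
    have "a e - b e = 0"
    proof (rule cubic_four_roots[OF _ _ that])
      show "4 \<le> card {t0, t1, t2, t3}" using assms by simp
      fix x assume "x \<in> {t0, t1, t2, t3}"
      then have "(\<Sum>e\<le>3. b e * x ^ e) = p x"
        unfolding b four W using assms by auto
      then show "(\<Sum>e\<le>3. (a e - b e) * x ^ e) = 0" by (simp add: p_def left_diff_distrib sum_subtractf)
    qed
    then show ?thesis by (simp add: b_def p_def)
  qed
  then show ?thesis by blast
qed

text \<open>The coefficients depend on finitely many values only. Applied to one variable of a function
  of two variables this makes the coefficients splines in the other variable.\<close>

lemma spline1_representation:
  assumes c: "\<And>i j. i < j \<Longrightarrow> j \<le> m \<Longrightarrow> c i < c j" and "0 < m"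
  shows "\<exists>W t. (\<forall>j<m + 3. t j \<in> {c 0..c m}) \<and>
    (\<forall>g. spline1 c m g \<longrightarrow> (\<forall>x\<in>{c 0..c m}. g x = (\<Sum>k<m + 3. (\<Sum>j<m + 3. W k j * g (t j)) * tpow c k x)))"
  using \<open>0 < m\<close> c
proof (induction m rule: nat_induct_non_zero)
  case 1
  define t where "t = (!) [c 0, (2 * c 0 + c 1) / 3, (c 0 + 2 * c 1) / 3, c 1]"
  have lt: "c 0 < c 1" using 1 by simp
  then obtain W where W: "\<And>a e. e \<le> 3 \<Longrightarrow> a e = (\<Sum>j<4. W e j * (\<Sum>i\<le>3. a i * t j ^ i))"
    using cubic_interpolation[of "c 0" "(2 * c 0 + c 1) / 3" "(c 0 + 2 * c 1) / 3" "c 1"]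
    unfolding t_def[symmetric] by auto
  have t: "t j \<in> {c 0..c 1}" if "j < 4" for j
  proof -
    have "j = 0 \<or> j = 1 \<or> j = 2 \<or> j = 3" using that by auto
    then show ?thesis using lt by (auto simp: t_def)
  qed
  have "g x = (\<Sum>k<4. (\<Sum>j<4. W k j * g (t j)) * tpow c k x)"
    if g: "spline1 c 1 g" and x: "x \<in> {c 0..c 1}" for g x
  proof -
    obtain a where a: "\<And>x. x \<in> {c 0..c 1} \<Longrightarrow> g x = (\<Sum>e\<le>3. a e * x ^ e)"
      using g by (auto simp: spline1_def)
    have "g x = (\<Sum>k\<le>3. a k * x ^ k)" using a x by simp
    also have "\<dots> = (\<Sum>k\<le>3. (\<Sum>j<4. W k j * g (t j)) * x ^ k)"
    proof (rule sum.cong[OF refl])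
      fix k :: nat assume "k \<in> {..3}"
      then have "a k = (\<Sum>j<4. W k j * (\<Sum>i\<le>3. a i * t j ^ i))" by (intro W) auto
      also have "\<dots> = (\<Sum>j<4. W k j * g (t j))" using t a by (intro sum.cong) auto
      finally show "a k * x ^ k = (\<Sum>j<4. W k j * g (t j)) * x ^ k" by simp
    qed
    also have "\<dots> = (\<Sum>k<4. (\<Sum>j<4. W k j * g (t j)) * tpow c k x)"
      by (rule sum.cong) (auto simp: tpow_def)
    finally show ?thesis .
  qed
  then show ?case using t by (intro exI[of _ W] exI[of _ t]) simp
next
  case (Suc m)
  have le: "c i \<le> c j" if "i \<le> j" "j \<le> Suc m" for i j using Suc.prems[of i j] that by (cases "i = j") auto
  have lt: "c m < c (Suc m)" "c (m - 1) < c m" using Suc.prems Suc.hyps by auto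
  have "\<exists>W t. (\<forall>j<m + 3. t j \<in> {c 0..c m}) \<and>
    (\<forall>g. spline1 c m g \<longrightarrow> (\<forall>x\<in>{c 0..c m}. g x = (\<Sum>k<m + 3. (\<Sum>j<m + 3. W k j * g (t j)) * tpow c k x)))"
    by (rule Suc.IH) (use Suc.prems in auto)
  then obtain W t where Wt: "(\<forall>j<m + 3. t j \<in> {c 0..c m}) \<and>
    (\<forall>g. spline1 c m g \<longrightarrow> (\<forall>x\<in>{c 0..c m}. g x = (\<Sum>k<m + 3. (\<Sum>j<m + 3. W k j * g (t j)) * tpow c k x)))"
    by (elim exE)
  have t: "t j \<in> {c 0..c m}" if "j < m + 3" for j using Wt that by blast
  have W: "g x = (\<Sum>k<m + 3. (\<Sum>j<m + 3. W k j * g (t j)) * tpow c k x)"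
    if "spline1 c m g" "x \<in> {c 0..c m}" for g x
    using conjunct2[OF Wt] that by blast
  \<comment> \<open>The one new node is the new end point. The coefficient of the new truncated
    power is the value there minus that of the old expansion, divided by the value \<open>h\<close>
    of the new truncated power.\<close>
  define h where "h = (c (Suc m) - c m) ^ 3"
  define t' where "t' j = (if j < m + 3 then t j else c (Suc m))" for j
  define W' where "W' k j = (if k < m + 3 then (if j < m + 3 then W k j else 0)
     else if j < m + 3 then - (\<Sum>k<m + 3. W k j * tpow c k (c (Suc m))) / h else 1 / h)" for k j
  have "g x = (\<Sum>k<Suc m + 3. (\<Sum>j<Suc m + 3. W' k j * g (t' j)) * tpow c k x)"
    if g: "spline1 c (Suc m) g" and x: "x \<in> {c 0..c (Suc m)}" for g x
  proof -
    obtain g1 g2 where der: "\<And>x. x \<in> {c 0..c (Suc m)} \<Longrightarrow> (g has_real_derivative g1 x) (at x within {c 0..c (Suc m)})"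
       "\<And>x. x \<in> {c 0..c (Suc m)} \<Longrightarrow> (g1 has_real_derivative g2 x) (at x within {c 0..c (Suc m)})"
      using g unfolding spline1_def by blast
    have pieces: "\<exists>a. \<forall>x\<in>{c i..c (Suc i)}. g x = (\<Sum>e\<le>3. a e * x ^ e)" if "i < Suc m" for i
      using g that unfolding spline1_def by blast
    have "{c 0..c m} \<subseteq> {c 0..c (Suc m)}" using lt by auto
    then have "\<forall>x\<in>{c 0..c m}. (g has_real_derivative g1 x) (at x within {c 0..c m}) \<and>
       (g1 has_real_derivative g2 x) (at x within {c 0..c m})"
      using der has_field_derivative_subset by blast
    then have gm: "spline1 c m g"
      unfolding spline1_def using pieces less_SucI by blast
    define G where "G k = (\<Sum>j<m + 3. W k j * g (t j))" for k
    define G' where "G' k = (\<Sum>j<Suc m + 3. W' k j * g (t' j))" for k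
    have low: "g x = (\<Sum>k<m + 3. G k * tpow c k x)" if "x \<in> {c 0..c m}" for x
      using W[OF gm that] by (simp add: G_def)
    have Suc3: "(\<Sum>j<Suc m + 3. f j) = (\<Sum>j<m + 3. f j) + f (m + 3)" for f :: "nat \<Rightarrow> real"
      by (metis add_Suc sum.lessThan_Suc)
    have G': "G' k = G k" if "k < m + 3" for k
      unfolding G'_def G_def Suc3 using that by (simp add: W'_def t'_def)
    define Q where "Q j = (\<Sum>k<m + 3. W k j * tpow c k (c (Suc m)))" for j
    have "G' (m + 3) = (g (c (Suc m)) - (\<Sum>j<m + 3. Q j * g (t j))) / h"
      unfolding G'_def Suc3
      by (simp add: W'_def t'_def diff_divide_distrib sum_negf sum_divide_distrib flip: Q_def)
    also have "(\<Sum>j<m + 3. Q j * g (t j)) = (\<Sum>k<m + 3. G k * tpow c k (c (Suc m)))"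
      unfolding G_def Q_def sum_distrib_right by (subst sum.swap) (simp add: mult_ac)
    finally have G'm: "G' (m + 3) * h = g (c (Suc m)) - (\<Sum>k<m + 3. G k * tpow c k (c (Suc m)))"
      using lt by (simp add: h_def)
    have Gs: "(\<Sum>k<Suc m + 3. G' k * tpow c k x) = (\<Sum>k<m + 3. G k * tpow c k x) + G' (m + 3) * max 0 (x - c m) ^ 3" for x
      unfolding Suc3 using G' Suc.hyps by (simp add: tpow_def[of c "m + 3"])
    define p where "p e = G e + (\<Sum>j\<in>{1..m - 1}. G (3 + j) * (of_nat (3 choose e) * (- c j) ^ (3 - e)))" for e
    have p: "(\<Sum>k\<le>3. G k * x ^ k) + (\<Sum>j\<in>{1..m - 1}. G (3 + j) * (x - c j) ^ 3) = (\<Sum>e\<le>3. p e * x ^ e)" for x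
      unfolding p_def by (rule cubic_plus_cubes)
    \<comment> \<open>Beyond \<open>c (m - 1)\<close> the old expansion is a single cubic, also to
      the right of its former end point \<open>c m\<close>.\<close>
    have right: "(\<Sum>k<m + 3. G k * tpow c k x) = (\<Sum>e\<le>3. p e * x ^ e)" if "c (m - 1) \<le> x" for x
      unfolding p[symmetric] using that Suc.hyps Suc.prems
      by (intro sum_tpow) auto
    obtain q where q: "\<And>x. x \<in> {c m..c (Suc m)} \<Longrightarrow> g x = (\<Sum>e\<le>3. q e * x ^ e)"
      using pieces[of m] by auto
    have c0: "c 0 \<le> c (m - 1)" by (rule le) auto
    have sub: "{c (m - 1)..c (Suc m)} \<subseteq> {c 0..c (Suc m)}" using c0 by auto
    have match: "(\<Sum>e\<le>3. q e * x ^ e) = (\<Sum>e\<le>3. p e * x ^ e) + (q 3 - p 3) * (x - c m) ^ 3" for x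
    proof (rule cubic_C2_match[OF lt(2,1) _ _ _ q])
      fix x assume "x \<in> {c (m - 1)..c (Suc m)}"
      then have x: "x \<in> {c 0..c (Suc m)}" using sub by auto
      show "(g has_real_derivative g1 x) (at x within {c (m - 1)..c (Suc m)})"
        "(g1 has_real_derivative g2 x) (at x within {c (m - 1)..c (Suc m)})"
        using der[OF x] sub has_field_derivative_subset by blast+
    next
      fix x assume "x \<in> {c (m - 1)..c m}"
      then show "g x = (\<Sum>e\<le>3. p e * x ^ e)" using low[of x] right[of x] c0 by auto
    qed
    have "g (c (Suc m)) = (\<Sum>e\<le>3. q e * c (Suc m) ^ e)" using lt by (intro q) simp
    also have "\<dots> = (\<Sum>e\<le>3. p e * c (Suc m) ^ e) + (q 3 - p 3) * h" unfolding h_def by (rule match)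
    also have "(\<Sum>e\<le>3. p e * c (Suc m) ^ e) = (\<Sum>k<m + 3. G k * tpow c k (c (Suc m)))"
      using lt by (intro right[symmetric]) simp
    finally have "G' (m + 3) * h = (q 3 - p 3) * h" unfolding G'm by linarith
    then have G'q: "G' (m + 3) = q 3 - p 3" using lt by (simp add: h_def)
    have "g x = (\<Sum>k<Suc m + 3. G' k * tpow c k x)"
    proof (cases "x \<le> c m")
      case True
      then have "max 0 (x - c m) = 0" by simp
      then show ?thesis unfolding Gs using low[of x] x True by simp
    next
      case False
      then have "g x = (\<Sum>e\<le>3. q e * x ^ e)" using x by (intro q) auto
      also have "\<dots> = (\<Sum>e\<le>3. p e * x ^ e) + (q 3 - p 3) * (x - c m) ^ 3" by (rule match)
      also have "(\<Sum>e\<le>3. p e * x ^ e) = (\<Sum>k<m + 3. G k * tpow c k x)"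
        using False lt by (intro right[symmetric]) simp
      finally show ?thesis unfolding Gs G'q using False by simp
    qed
    then show ?thesis by (simp only: G'_def)
  qed
  note rep = this
  have pts: "t' j \<in> {c 0..c (Suc m)}" if "j < Suc m + 3" for j
  proof -
    have "c 0 \<le> c (Suc m)" by (rule le) auto
    then show ?thesis using t[of j] lt by (cases "j < m + 3") (auto simp: t'_def)
  qed
  show ?case
  proof (rule exI[of _ W'], rule exI[of _ t'], rule conjI)
    show "\<forall>j<Suc m + 3. t' j \<in> {c 0..c (Suc m)}" using pts by (intro allI impI)
    show "\<forall>g. spline1 c (Suc m) g \<longrightarrow> (\<forall>x\<in>{c 0..c (Suc m)}.
        g x = (\<Sum>k<Suc m + 3. (\<Sum>j<Suc m + 3. W' k j * g (t' j)) * tpow c k x))"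
    proof (intro allI impI ballI)
      fix g x assume "spline1 c (Suc m) g" "x \<in> {c 0..c (Suc m)}"
      then show "g x = (\<Sum>k<Suc m + 3. (\<Sum>j<Suc m + 3. W' k j * g (t' j)) * tpow c k x)"
        by (rule rep[of g x])
    qed
  qed
qed

section \<open>Hierarchical meshes on an integer grid\<close>

text \<open>Grid points, grid lines and unit squares are addressed by integers on the finest grid, the
  lines having coordinates \<open>C True i\<close> (horizontally) and \<open>C False j\<close> (vertically). A
  direction \<open>d\<close> is \<open>True\<close> for horizontal; the pair \<open>i\<close>, \<open>q\<close> then means index \<open>i\<close> along
  direction \<open>d\<close> and \<open>q\<close> across it. The mesh is encoded by the level \<open>lev i j\<close> of the cell
  that contains the unit square \<open>(i, j)\<close>: a box of level \<open>k\<close> is divided iff \<open>k < lev\<close> on it.\<close>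

locale hmesh =
  fixes C :: "bool \<Rightarrow> nat \<Rightarrow> real" and N :: "bool \<Rightarrow> nat" and n :: nat and lev :: "nat \<Rightarrow> nat \<Rightarrow> nat"
  assumes C_less: "i < j \<Longrightarrow> j \<le> N d \<Longrightarrow> C d i < C d j"
    and N_pos: "0 < N d" and N_dvd: "2 ^ n dvd N d"
    and lev_le: "lev i j \<le> n"
    and lev_box: "i div 2 ^ (n - k) = i' div 2 ^ (n - k) \<Longrightarrow> j div 2 ^ (n - k) = j' div 2 ^ (n - k) \<Longrightarrow>
      k < lev i j \<Longrightarrow> k < lev i' j'"
begin

text \<open>A cell of level \<open>k\<close> is \<open>w k\<close> grid units wide, \<open>llev q\<close> is the level of the grid line with
  index \<open>q\<close>, and \<open>U d i q\<close> says that the unit edge in direction \<open>d\<close> from \<open>i\<close> to \<open>i + 1\<close> on the line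
  \<open>q\<close> belongs to the mesh. The elements \<open>(d, q, a, b)\<close> of \<open>L\<close> are the interior l-edges.\<close>

definition w :: "nat \<Rightarrow> nat" where "w k = 2 ^ (n - k)"

definition llev :: "nat \<Rightarrow> nat" where "llev q = (LEAST k. w k dvd q)"

definition lv :: "bool \<Rightarrow> nat \<Rightarrow> nat \<Rightarrow> nat" where "lv d i q = (if d then lev i q else lev q i)"

definition U :: "bool \<Rightarrow> nat \<Rightarrow> nat \<Rightarrow> bool" where "U d i q \<longleftrightarrow> llev q \<le> lv d i q"

definition inc :: "bool \<Rightarrow> nat \<Rightarrow> nat \<Rightarrow> bool" where
  "inc d i q \<longleftrightarrow> 0 < i \<and> U d (i - 1) q \<or> i < N d \<and> U d i q"

text \<open>The corner points of cells are the grid points that are incident to edges of both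
  directions, see \<open>vertices_iff\<close>.\<close>

definition vtx :: "bool \<Rightarrow> nat \<Rightarrow> nat \<Rightarrow> bool" where
  "vtx d i q \<longleftrightarrow> inc d i q \<and> inc (\<not> d) q i"

definition L :: "(bool \<times> nat \<times> nat \<times> nat) set" where
  "L = {(d, q, a, b). 0 < q \<and> q < N (\<not> d) \<and> a < b \<and> b \<le> N d \<and> (\<forall>i. a \<le> i \<and> i < b \<longrightarrow> U d i q) \<and>
     (a = 0 \<or> \<not> U d (a - 1) q) \<and> (b = N d \<or> \<not> U d b q)}"

section \<open>Lines, levels and unit edges\<close>

lemma C_le: "i \<le> j \<Longrightarrow> j \<le> N d \<Longrightarrow> C d i \<le> C d j"
  using C_less[of i j d] by (cases "i = j") auto

lemma C_eq_iff: "i \<le> N d \<Longrightarrow> j \<le> N d \<Longrightarrow> C d i = C d j \<longleftrightarrow> i = j"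
  by (metis C_less less_irrefl linorder_neqE_nat)

text \<open>Truncating the levels at \<open>k\<close> yields stage \<open>k\<close> of the hierarchy
  over the same finest grid, so all facts of the locale hold for every stage.\<close>

lemma hmesh_min: "hmesh C N n (\<lambda>i j. min k (lev i j))"
proof
  fix i i' j j' k' assume *: "i div 2 ^ (n - k') = i' div 2 ^ (n - k')" "j div 2 ^ (n - k') = j' div 2 ^ (n - k')" "k' < min k (lev i j)"
  show "k' < min k (lev i' j')" using lev_box[OF *(1,2)] *(3) by simp
qed (use C_less N_pos N_dvd lev_le in \<open>auto simp: min_def intro: le_trans\<close>)

lemma w_pos [simp]: "0 < w k" by (simp add: w_def)

lemma w_Suc: "k < n \<Longrightarrow> w k = 2 * w (Suc k)"
  unfolding w_def by (metis Suc_diff_Suc power_Suc)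

lemma w_dvd: "k \<le> l \<Longrightarrow> w l dvd w k"
  unfolding w_def by (simp add: le_imp_power_dvd)

lemma w_ge_n: "n \<le> k \<Longrightarrow> w k = 1" by (simp add: w_def)

lemma llev_le_iff: "llev q \<le> k \<longleftrightarrow> w k dvd q"
proof
  have "w n dvd q" by (simp add: w_ge_n)
  then have "w (llev q) dvd q" unfolding llev_def by (rule LeastI)
  then show "llev q \<le> k \<Longrightarrow> w k dvd q" using w_dvd dvd_trans by blast
qed (simp add: llev_def Least_le)

lemma llev_le_n: "llev q \<le> n" by (simp add: llev_le_iff w_ge_n)

lemma llev_0 [simp]: "llev 0 = 0" using llev_le_iff[of 0 0] by simp

lemma llev_N [simp]: "llev (N d) = 0" using llev_le_iff[of "N d" 0] N_dvd by (simp add: w_def)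

lemma lv_le: "lv d i q \<le> n" by (simp add: lv_def lev_le)

lemma lv_swap: "lv (\<not> d) i q = lv d q i" by (simp add: lv_def)

lemma lv_box: "i div w k = i' div w k \<Longrightarrow> q div w k = q' div w k \<Longrightarrow> k < lv d i q \<longleftrightarrow> k < lv d i' q'"
  using lev_box[of i k i' q q'] lev_box[of i' k i q' q] lev_box[of q k q' i i'] lev_box[of q' k q i' i]
  by (auto simp: lv_def w_def)

lemma div_pred: "\<not> m dvd q \<Longrightarrow> (q - 1) div m = q div (m :: nat)"
  by (cases q) (auto simp: div_Suc dvd_eq_mod_eq_0)

lemma lv_pred: "k < llev q \<Longrightarrow> k < lv d i (q - 1) \<longleftrightarrow> k < lv d i q"
  using llev_le_iff[of q k] by (intro lv_box div_pred) auto

text \<open>A line of level \<open>l > 0\<close> runs through the inside of boxes of level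
  \<open>l - 1\<close>, so the unit squares on its two sides are divided to level \<open>l\<close>
  together. Hence \<open>U\<close> may look at one side only.\<close>

lemma U_pred: "U d i q \<longleftrightarrow> llev q \<le> lv d i (q - 1)"
  using lv_pred[of "llev q - 1" q d i] by (cases "llev q") (auto simp: U_def Suc_le_eq)

lemma U_0 [simp]: "U d i 0" and U_N [simp]: "U d i (N d')" by (simp_all add: U_def)

lemma inc_boundary [simp]: "inc d i 0" "inc d i (N d')" if "i \<le> N d"
  using that N_pos by (auto simp: inc_def)

text \<open>The squares on both sides of line \<open>i\<close> share a box of each level below
  \<open>llev i\<close>, so their levels can only differ from \<open>llev i\<close> on.\<close>

lemma lv_eq_of_less:
  assumes "lv d i q < llev i" shows "lv d (i - 1) q = lv d i q"
proof -
  have "k < lv d (i - 1) q \<longleftrightarrow> k < lv d i q" if "k < llev i" for k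
    using lv_pred[OF that, of "\<not> d" q] by (simp add: lv_swap)
  then show ?thesis using assms by (metis linorder_less_linear not_less_iff_gr_or_eq order.strict_trans)
qed

text \<open>Where a line stops, the levels differ across the line \<open>i\<close>, in the rows on
  both sides of the stopping line. By \<open>lv_eq_of_less\<close> the line \<open>i\<close> is
  present in both rows: the end is a T-junction, never an L-shaped corner.\<close>

lemma no_L_corner:
  assumes "U d (i - 1) q \<noteq> U d i q"
  shows "U (\<not> d) (q - 1) i" "U (\<not> d) q i"
proof -
  show "U (\<not> d) q i"
    using assms lv_eq_of_less[of d i q] by (cases "lv d i q < llev i") (auto simp: U_def lv_swap)
  show "U (\<not> d) (q - 1) i"
    using assms lv_eq_of_less[of d i "q - 1"] unfolding U_pred[of d _ q]
    by (cases "lv d i (q - 1) < llev i") (auto simp: U_def lv_swap)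
qed

lemma vtx_swap: "vtx (\<not> d) i q = vtx d q i" by (auto simp: vtx_def)

lemma inc_of_end:
  assumes "U d (i - 1) q \<noteq> U d i q" "0 < q" shows "inc (\<not> d) q i"
  using no_L_corner[OF assms(1)] assms(2) by (auto simp: inc_def)

lemma L_iff: "(d, q, a, b) \<in> L \<longleftrightarrow> 0 < q \<and> q < N (\<not> d) \<and> a < b \<and> b \<le> N d \<and> (\<forall>i. a \<le> i \<and> i < b \<longrightarrow> U d i q) \<and>
     (a = 0 \<or> \<not> U d (a - 1) q) \<and> (b = N d \<or> \<not> U d b q)"
  by (simp add: L_def)

lemma L_D:
  assumes "(d, q, a, b) \<in> L"
  shows "0 < q" "q < N (\<not> d)" "a < b" "b \<le> N d" "a \<le> i \<Longrightarrow> i < b \<Longrightarrow> U d i q"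
    "0 < a \<Longrightarrow> \<not> U d (a - 1) q" "b < N d \<Longrightarrow> \<not> U d b q"
  using assms by (auto simp: L_iff)

text \<open>Even a common end point is impossible for two different l-edges on one line, since each
  of them would extend the other against its maximality.\<close>

lemma L_unique:
  assumes "(d, q, a, b) \<in> L" "(d, q, a', b') \<in> L" "a \<le> i" "i \<le> b" "a' \<le> i" "i \<le> b'"
  shows "a = a'" "b = b'"
proof -
  note D = L_D[OF assms(1)] and D' = L_D[OF assms(2)]
  have le: "\<not> x < y" if 1: "(d, q, x, z) \<in> L" and 2: "(d, q, y, u) \<in> L" and i: "x \<le> i" "i \<le> z" "y \<le> i" for x y z u
  proof
    assume "x < y"
    then show False using L_D(5)[OF 1, of "y - 1"] L_D(6)[OF 2] i by auto
  qed
  have ge: "\<not> z < u" if 1: "(d, q, x, z) \<in> L" and 2: "(d, q, y, u) \<in> L" and i: "i \<le> z" "y \<le> i" for x y z u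
  proof
    assume "z < u"
    then show False using L_D(5)[OF 2, of z] L_D(7)[OF 1] L_D(4)[OF 2] i by auto
  qed
  show "a = a'" using le[OF assms(1,2)] le[OF assms(2,1)] assms(3-6) by (meson linorder_neqE_nat)
  show "b = b'" using ge[OF assms(1,2)] ge[OF assms(2,1)] assms(3-6) by (meson linorder_neqE_nat)
qed

lemma L_exists:
  assumes "U d i q" "i < N d" "0 < q" "q < N (\<not> d)"
  shows "\<exists>a b. (d, q, a, b) \<in> L \<and> a \<le> i \<and> i < b"
proof -
  define b where "b = (LEAST b. i < b \<and> (b = N d \<or> \<not> U d b q))"
  have b: "i < b" "b = N d \<or> \<not> U d b q"
    unfolding b_def using LeastI[of "\<lambda>b. i < b \<and> (b = N d \<or> \<not> U d b q)" "N d"] assms by auto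
  have b_min: "k < b \<Longrightarrow> i < k \<Longrightarrow> k \<noteq> N d \<and> U d k q" for k
    unfolding b_def using not_less_Least by blast
  define a where "a = (LEAST a. \<forall>k. a \<le> k \<and> k \<le> i \<longrightarrow> U d k q)"
  have a: "\<forall>k. a \<le> k \<and> k \<le> i \<longrightarrow> U d k q"
    unfolding a_def by (rule LeastI[of _ i]) (use assms in auto)
  have ai: "a \<le> i" unfolding a_def by (rule Least_le) (use assms in auto)
  have "a = 0 \<or> \<not> U d (a - 1) q"
  proof (rule ccontr)
    assume h: "\<not> ?thesis"
    then have "\<forall>k. a - 1 \<le> k \<and> k \<le> i \<longrightarrow> U d k q"
      using a by (metis One_nat_def Suc_leI Suc_pred le_neq_implies_less not_gr0)
    then have "a \<le> a - 1" unfolding a_def by (rule Least_le)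
    then show False using h by arith
  qed
  moreover have "b \<le> N d" using b_min[of "N d"] assms by force
  moreover have "U d k q" if "a \<le> k" "k < b" for k
    using that a b_min[of k] by (cases "k \<le> i") auto
  ultimately show ?thesis using ai b assms by (intro exI[of _ a] exI[of _ b]) (auto simp: L_iff)
qed

lemma L_exists_inc:
  assumes "inc d i q" "i \<le> N d" "0 < q" "q < N (\<not> d)"
  shows "\<exists>a b. (d, q, a, b) \<in> L \<and> a \<le> i \<and> i \<le> b"
proof -
  consider "0 < i" "U d (i - 1) q" | "i < N d" "U d i q" using assms(1) by (auto simp: inc_def)
  then show ?thesis
  proof cases
    case 1
    then show ?thesis using L_exists[of d "i - 1" q] assms by fastforce
  next
    case 2
    then show ?thesis using L_exists[of d i q] assms by fastforce
  qed
qed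

lemma L_inc: "(d, q, a, b) \<in> L \<Longrightarrow> a \<le> i \<Longrightarrow> i \<le> b \<Longrightarrow> inc d i q"
  using L_D[of d q a b] L_D(5)[of d q a b "i - 1"] L_D(5)[of d q a b i] by (cases "i < b") (auto simp: inc_def)

text \<open>At an inner end the crossing line is present by \<open>no_L_corner\<close>; at an outer
  end it is the boundary itself.\<close>

lemma L_end_vtx:
  assumes "(d, q, a, b) \<in> L" shows "vtx d a q" "vtx d b q"
proof -
  note D = L_D[OF assms]
  have "inc (\<not> d) q a"
    using inc_of_end[of d a q] D(1,2,3,6) D(5)[of a] by (cases "a = 0") auto
  then show "vtx d a q" using L_inc[OF assms, of a] D by (simp add: vtx_def)
  have "inc (\<not> d) q b"
    using inc_of_end[of d b q] D(1-4,7) D(5)[of "b - 1"] by (cases "b = N d") auto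
  then show "vtx d b q" using L_inc[OF assms, of b] D by (simp add: vtx_def)
qed

lemma finite_L: "finite L"
proof (rule finite_subset)
  show "L \<subseteq> UNIV \<times> {..<max (N True) (N False)} \<times> {..max (N True) (N False)} \<times> {..max (N True) (N False)}"
    unfolding L_def
  proof (clarify, goal_cases)
    case (1 d q a b)
    then show ?case by (cases d) auto
  qed
qed auto

definition L0 :: "(bool \<times> nat \<times> nat \<times> nat) set" where "L0 = {(d, q, a, b). (d, q, a, b) \<in> L \<and> a = 0}"
definition LN :: "(bool \<times> nat \<times> nat \<times> nat) set" where "LN = {(d, q, a, b). (d, q, a, b) \<in> L \<and> b = N d}"

definition Vint :: "(nat \<times> nat) set" where
  "Vint = {(i, j). 0 < i \<and> i < N True \<and> 0 < j \<and> j < N False \<and> vtx True i j}"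
definition Vcross :: "(nat \<times> nat) set" where
  "Vcross = {(i, j). 0 < i \<and> i < N True \<and> 0 < j \<and> j < N False \<and>
     U True (i - 1) j \<and> U True i j \<and> U False (j - 1) i \<and> U False j i}"
definition Vbd :: "(nat \<times> nat) set" where
  "Vbd = {(i, j). i \<le> N True \<and> j \<le> N False \<and> vtx True i j \<and> (i = 0 \<or> i = N True \<or> j = 0 \<or> j = N False)}"

definition flip :: "bool \<Rightarrow> nat \<Rightarrow> nat \<Rightarrow> nat \<times> nat" where "flip d i q = (if d then (i, q) else (q, i))"

lemma finite_V: "finite Vint" "finite Vcross" "finite Vbd"
  by (rule finite_subset[of _ "{..N True} \<times> {..N False}"]; force simp: Vint_def Vcross_def Vbd_def)+

section \<open>Counting vertices by the ends of l-edges\<close>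

lemma card_L0: "card L0 = card {(d, q). 0 < q \<and> q < N (\<not> d) \<and> U d 0 q}"
proof (rule bij_betw_same_card[of "\<lambda>(d, q, a, b). (d, q)"], rule bij_betw_imageI)
  show "inj_on (\<lambda>(d, q, a, b). (d, q)) L0"
    unfolding inj_on_def L0_def using L_unique(2)[where i = 0] by fastforce
  show "(\<lambda>(d, q, a, b). (d, q)) ` L0 = {(d, q). 0 < q \<and> q < N (\<not> d) \<and> U d 0 q}"
  proof (intro equalityI subsetI, goal_cases)
    case (1 x)
    then show ?case by (auto simp: L0_def L_iff)
  next
    case (2 x)
    then obtain d q where x: "x = (d, q)" "0 < q" "q < N (\<not> d)" "U d 0 q" by auto
    then obtain a b where "(d, q, a, b) \<in> L" "a \<le> 0" using L_exists[of d 0 q] N_pos[of d] by blast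
    then show ?case using x by (force simp: L0_def)
  qed
qed

lemma card_LN: "card LN = card {(d, q). 0 < q \<and> q < N (\<not> d) \<and> U d (N d - 1) q}"
proof (rule bij_betw_same_card[of "\<lambda>(d, q, a, b). (d, q)"], rule bij_betw_imageI)
  show "inj_on (\<lambda>(d, q, a, b). (d, q)) LN"
    unfolding inj_on_def LN_def
  proof (clarify, goal_cases)
    case (1 d q a b d' q' a' b')
    then show ?case using L_unique(1)[of d' q' a "N d'" a' "N d'" "N d'"] L_D(3)[of d' q' a "N d'"] L_D(3)[of d' q' a' "N d'"] by auto
  qed
  show "(\<lambda>(d, q, a, b). (d, q)) ` LN = {(d, q). 0 < q \<and> q < N (\<not> d) \<and> U d (N d - 1) q}"
  proof (intro equalityI subsetI, goal_cases)
    case (1 x)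
    then show ?case by (auto simp: LN_def L_iff)
  next
    case (2 x)
    then obtain d q where x: "x = (d, q)" "0 < q" "q < N (\<not> d)" "U d (N d - 1) q" by auto
    then obtain a b where ab: "(d, q, a, b) \<in> L" "N d - 1 < b" using L_exists[of d "N d - 1" q] N_pos by auto
    then have "b = N d" using L_D(4)[OF ab(1)] by auto
    then show ?case using x ab by (force simp: LN_def)
  qed
qed

text \<open>The T-junctions, each with the direction of the line that stops there, which is unique
  by \<open>no_L_corner\<close>.\<close>

definition TJ :: "(bool \<times> nat \<times> nat) set" where
  "TJ = {(d, i, q). 0 < i \<and> i < N d \<and> 0 < q \<and> q < N (\<not> d) \<and> U d (i - 1) q \<noteq> U d i q}"

text \<open>A T-junction is an end of exactly one l-edge: a lower end if the line continues after
  it, an upper end otherwise. Inner lower ends belong to \<open>L - L0\<close>, inner upper ends to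
  \<open>L - LN\<close>.\<close>

lemma card_TJ: "card TJ = card (L - L0) + card (L - LN)"
proof -
  let ?S = "{(d, i, q). (d, i, q) \<in> TJ \<and> U d i q}" and ?E = "{(d, i, q). (d, i, q) \<in> TJ \<and> \<not> U d i q}"
  have fin: "finite TJ"
  proof (rule finite_subset)
    show "TJ \<subseteq> UNIV \<times> {..max (N True) (N False)} \<times> {..max (N True) (N False)}"
      unfolding TJ_def
    proof (clarify, goal_cases)
      case (1 d i q)
      then show ?case by (cases d) auto
    qed
  qed auto
  have "bij_betw (\<lambda>(d, q, a, b). (d, a, q)) (L - L0) ?S"
  proof (rule bij_betw_imageI)
    show "inj_on (\<lambda>(d, q, a, b). (d, a, q)) (L - L0)"
      unfolding inj_on_def
    proof (clarify, goal_cases)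
      case (1 d q a b d' q' a' b')
      then show ?case using L_unique(2)[of d' q' a' b a' b' a'] L_D(3)[of d' q' a' b] L_D(3)[of d' q' a' b'] by auto
    qed
    show "(\<lambda>(d, q, a, b). (d, a, q)) ` (L - L0) = ?S"
    proof (intro equalityI subsetI, goal_cases)
      case (1 x)
      then show ?case by (auto simp: L0_def TJ_def L_iff)
    next
      case (2 x)
      then obtain d i q where x: "x = (d, i, q)" "0 < i" "i < N d" "0 < q" "q < N (\<not> d)" "U d i q" "\<not> U d (i - 1) q"
        by (auto simp: TJ_def)
      then obtain a b where ab: "(d, q, a, b) \<in> L" "a \<le> i" "i < b" using L_exists[of d i q] by auto
      then have "a = i" using L_D(5)[OF ab(1), of "i - 1"] x by force
      then have "(d, q, i, b) \<in> L - L0" using ab x by (auto simp: L0_def)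
      then show ?case using x by force
    qed
  qed
  moreover have "bij_betw (\<lambda>(d, q, a, b). (d, b, q)) (L - LN) ?E"
  proof (rule bij_betw_imageI)
    show "inj_on (\<lambda>(d, q, a, b). (d, b, q)) (L - LN)"
      unfolding inj_on_def
    proof (clarify, goal_cases)
      case (1 d q a b d' q' a' b')
      then show ?case using L_unique(1)[of d' q' a b' a' b' b'] L_D(3)[of d' q' a b'] L_D(3)[of d' q' a' b'] by auto
    qed
    show "(\<lambda>(d, q, a, b). (d, b, q)) ` (L - LN) = ?E"
    proof (intro equalityI subsetI, goal_cases)
      case (1 x)
      then obtain d q a b where x: "x = (d, b, q)" "(d, q, a, b) \<in> L" "b \<noteq> N d" by (auto simp: LN_def)
      then show ?case using L_D[OF x(2)] L_D(5)[OF x(2), of "b - 1"] by (auto simp: TJ_def)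
    next
      case (2 x)
      then obtain d i q where x: "x = (d, i, q)" "0 < i" "i < N d" "0 < q" "q < N (\<not> d)" "\<not> U d i q" "U d (i - 1) q"
        by (auto simp: TJ_def)
      then have "i - 1 < N d" by simp
      then obtain a b where ab: "(d, q, a, b) \<in> L" "a \<le> i - 1" "i - 1 < b" using L_exists[of d "i - 1" q] x by blast
      then have "b = i" using L_D(5)[OF ab(1), of i] x by force
      then have "(d, q, a, i) \<in> L - LN" using ab x by (auto simp: LN_def)
      then show ?case using x by force
    qed
  qed
  moreover have "TJ = ?S \<union> ?E" "?S \<inter> ?E = {}" by auto
  then have "card TJ = card ?S + card ?E" using fin by (metis (no_types, lifting) card_Un_disjoint finite_Un)
  ultimately show ?thesis by (simp add: bij_betw_same_card)
qed

lemma card_Vint: "card Vint = card Vcross + card TJ"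
proof -
  have sub: "Vcross \<subseteq> Vint" by (auto simp: Vcross_def Vint_def vtx_def inc_def)
  have "bij_betw (\<lambda>(d, i, q). flip d i q) TJ (Vint - Vcross)"
  proof (rule bij_betw_imageI)
    show "inj_on (\<lambda>(d, i, q). flip d i q) TJ"
      unfolding inj_on_def
    proof (clarify, goal_cases)
      case (1 d i q d' i' q')
      then have *: "U d (i - 1) q \<noteq> U d i q" "U d' (i' - 1) q' \<noteq> U d' i' q'" by (auto simp: TJ_def)
      show ?case
      proof (cases "d' = d")
        case True
        then show ?thesis using 1 by (auto simp: flip_def split: if_splits)
      next
        case False
        then have "d' = (\<not> d)" "i' = q" "q' = i" using 1 by (auto simp: flip_def split: if_splits)
        then show ?thesis using * no_L_corner[OF *(1)] by auto
      qed
    qed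
    show "(\<lambda>(d, i, q). flip d i q) ` TJ = Vint - Vcross"
    proof (intro equalityI subsetI, goal_cases)
      case (1 x)
      then obtain d i q where x: "x = flip d i q" "(d, i, q) \<in> TJ" by auto
      then have "vtx d i q" using inc_of_end[of d i q] by (auto simp: vtx_def inc_def TJ_def)
      then show ?case using x vtx_swap[of d q i]
        by (cases d) (auto simp: flip_def TJ_def Vint_def Vcross_def vtx_def)
    next
      case (2 x)
      then obtain i j where x: "x = (i, j)" "0 < i" "i < N True" "0 < j" "j < N False" "vtx True i j"
        "\<not> (U True (i - 1) j \<and> U True i j \<and> U False (j - 1) i \<and> U False j i)"
        by (auto simp: Vint_def Vcross_def)
      show ?case
      proof (cases "U True (i - 1) j = U True i j")
        case True
        \<comment> \<open>Incidence excludes that both horizontal unit edges are absent. So both are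
          present and the missing one is vertical.\<close>
        then have "(False, j, i) \<in> TJ" using x by (auto simp: TJ_def vtx_def inc_def)
        then show ?thesis using x by (force simp: flip_def)
      next
        case False
        then have "(True, i, j) \<in> TJ" using x by (auto simp: TJ_def)
        then show ?thesis using x by (force simp: flip_def)
      qed
    qed
  qed
  then have "card (Vint - Vcross) = card TJ" by (simp add: bij_betw_same_card)
  moreover have "card Vint = card Vcross + card (Vint - Vcross)"
    using sub finite_V by (metis card_Diff_subset card_mono le_add_diff_inverse)
  ultimately show ?thesis by simp
qed

text \<open>Apart from the four corners, a boundary vertex is the end of one l-edge, which meets the
  boundary at a right angle.\<close>

lemma card_Vbd: "card Vbd = 4 + card L0 + card LN"
proof -
  let ?c = "{(0, 0), (N True, 0), (0, N False), (N True, N False)}"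
  let ?A = "{(d, q). 0 < q \<and> q < N (\<not> d) \<and> U d 0 q}" and ?B = "{(d, q). 0 < q \<and> q < N (\<not> d) \<and> U d (N d - 1) q}"
  let ?f = "\<lambda>(d, q). flip d 0 q" and ?g = "\<lambda>(d, q). flip d (N d) q"
  have V: "Vbd = ?c \<union> ?f ` ?A \<union> ?g ` ?B"
  proof (intro equalityI subsetI, goal_cases)
    case (1 x)
    then obtain i j where x: "x = (i, j)" "i \<le> N True" "j \<le> N False" "vtx True i j" "i = 0 \<or> i = N True \<or> j = 0 \<or> j = N False"
      by (auto simp: Vbd_def)
    have inc: "inc True i j" "inc False j i" using x by (auto simp: vtx_def)
    consider "(i = 0 \<or> i = N True) \<and> (j = 0 \<or> j = N False)" | "i = 0" "0 < j" "j < N False" | "i = N True" "0 < j" "j < N False"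
      | "j = 0" "0 < i" "i < N True" | "j = N False" "0 < i" "i < N True" using x by force
    then show ?case
    proof cases
      case 1
      then show ?thesis using x by auto
    next
      case 2
      then have "(True, j) \<in> ?A" "x = ?f (True, j)" using inc x by (auto simp: inc_def flip_def)
      then show ?thesis by blast
    next
      case 3
      then have "(True, j) \<in> ?B" "x = ?g (True, j)" using inc x by (auto simp: inc_def flip_def)
      then show ?thesis by blast
    next
      case 4
      then have "(False, i) \<in> ?A" "x = ?f (False, i)" using inc x by (auto simp: inc_def flip_def)
      then show ?thesis by blast
    next
      case 5
      then have "(False, i) \<in> ?B" "x = ?g (False, i)" using inc x by (auto simp: inc_def flip_def)
      then show ?thesis by blast
    qed
  next
    case (2 x)
    consider "x \<in> ?c" | "x \<in> ?f ` ?A" | "x \<in> ?g ` ?B" using 2 by blast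
    then show ?case
    proof cases
      case 1
      then show ?thesis by (auto simp: Vbd_def vtx_def)
    next
      case 2
      then obtain d q where "x = flip d 0 q" "0 < q" "q < N (\<not> d)" "U d 0 q" by auto
      then show ?thesis using N_pos[of d] by (cases d) (auto simp: Vbd_def vtx_def inc_def flip_def)
    next
      case 3
      then obtain d q where "x = flip d (N d) q" "0 < q" "q < N (\<not> d)" "U d (N d - 1) q" by auto
      then show ?thesis using N_pos[of d] N_pos[of "\<not> d"] by (cases d) (auto simp: Vbd_def vtx_def inc_def flip_def)
    qed
  qed
  have fin: "finite (?f ` ?A)" "finite (?g ` ?B)" "finite ?c" using finite_V(3) unfolding V by auto
  have inj: "inj_on ?f ?A" "inj_on ?g ?B"
    by (auto simp: inj_on_def flip_def split: if_splits)
  have "card ?c = 4" using N_pos[of True] N_pos[of False] by simp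
  moreover have d1: "?c \<inter> ?f ` ?A = {}"
    using N_pos[of True] N_pos[of False] by (auto simp: flip_def split: if_splits)
  moreover have "(?c \<union> ?f ` ?A) \<inter> ?g ` ?B = {}"
    using N_pos[of True] N_pos[of False] by (auto simp: flip_def split: if_splits)
  ultimately show ?thesis
    unfolding V card_L0 card_LN using fin inj
    by (simp only: card_Un_disjoint card_image finite_UnI)
qed

lemma L0_sub: "L0 \<subseteq> L" "LN \<subseteq> L" by (auto simp: L0_def LN_def)

text \<open>Of the \<open>2 * card L\<close> ends of l-edges, \<open>card L0 + card LN\<close> lie
  on the boundary; the others are the T-junctions.\<close>

lemma card_Vint_eq: "card Vint + card L0 + card LN = card Vcross + 2 * card L"
proof -
  have "card (L - L0) = card L - card L0" "card (L - LN) = card L - card LN" "card L0 \<le> card L" "card LN \<le> card L"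
    using L0_sub finite_L by (auto simp: card_Diff_subset finite_subset card_mono)
  then show ?thesis using card_Vint card_TJ by linarith
qed

end

section \<open>Dependencies among the conformality conditions\<close>

lemma dvd_less_add:
  fixes x y m :: nat
  assumes "m dvd x" "m dvd y" "x < y" shows "x + m \<le> y"
proof -
  have "m dvd y - x" using assms by (simp add: dvd_diff_nat)
  then have "m \<le> y - x" using assms(3) by (simp add: dvd_imp_le)
  then show ?thesis using assms(3) by simp
qed

context hmesh
begin

text \<open>A dependency attaches to every l-edge \<open>t\<close> a cubic polynomial \<open>pp \<kappa> t\<close> in the coordinate along
  \<open>t\<close>. It vanishes if \<open>t\<close> ends on the boundary, because such an l-edge imposes no condition or one
  that involves free coefficients of its own.\<close>

definition pp :: "((bool \<times> nat \<times> nat \<times> nat) \<times> nat \<Rightarrow> real) \<Rightarrow> bool \<times> nat \<times> nat \<times> nat \<Rightarrow> real \<Rightarrow> real" where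
  "pp \<kappa> t u = (\<Sum>e\<le>3. \<kappa> (t, e) * u ^ e)"

definition Wd :: "((bool \<times> nat \<times> nat \<times> nat) \<times> nat \<Rightarrow> real) set" where
  "Wd = {\<kappa>. (\<forall>t e. t \<notin> L - L0 - LN \<or> 3 < e \<longrightarrow> \<kappa> (t, e) = 0) \<and>
    (\<forall>d q a b q' a' b'. (d, q, a, b) \<in> L \<longrightarrow> (\<not> d, q', a', b') \<in> L \<longrightarrow> a \<le> q' \<longrightarrow> q' \<le> b \<longrightarrow> a' \<le> q \<longrightarrow> q \<le> b' \<longrightarrow>
       pp \<kappa> (d, q, a, b) (C d q') + pp \<kappa> (\<not> d, q', a', b') (C (\<not> d) q) = 0)}"

text \<open>The filtration by level: \<open>Wk 0\<close> is all of \<open>Wd\<close>, because the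
  lines of level 0 reach the boundary, and \<open>Wk n\<close> is zero.\<close>

definition Wk :: "nat \<Rightarrow> ((bool \<times> nat \<times> nat \<times> nat) \<times> nat \<Rightarrow> real) set" where
  "Wk m = {\<kappa> \<in> Wd. \<forall>d q a b e. (d, q, a, b) \<in> L \<longrightarrow> llev q \<le> m \<longrightarrow> \<kappa> ((d, q, a, b), e) = 0}"

text \<open>The boxes of level \<open>k\<close> with lower left corners in \<open>{A, A + w k} \<times> {B, B + w k}\<close> are divided, and
  the dividing l-edges do not leave their union.\<close>

definition blk :: "nat \<Rightarrow> bool \<Rightarrow> nat \<Rightarrow> nat \<Rightarrow> bool" where
  "blk k d A B \<longleftrightarrow> (\<forall>x\<in>{w (Suc k), 3 * w (Suc k)}. (d, B + x, A, A + 4 * w (Suc k)) \<in> L \<and> (\<not> d, A + x, B, B + 4 * w (Suc k)) \<in> L) \<and>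
     0 < A \<and> A + 4 * w (Suc k) < N d \<and> 0 < B \<and> B + 4 * w (Suc k) < N (\<not> d) \<and> w k dvd A \<and> w k dvd B"

definition blocks :: "nat \<Rightarrow> (nat \<times> nat) set" where "blocks k = {(A, B). blk k True A B}"

lemma blk_swap: "blk k (\<not> d) A B = blk k d B A"
  by (auto simp: blk_def)

lemma WdD:
  assumes "\<kappa> \<in> Wd"
  shows "t \<in> L0 \<Longrightarrow> \<kappa> (t, e) = 0" "t \<in> LN \<Longrightarrow> \<kappa> (t, e) = 0"
    "(d, q, a, b) \<in> L \<Longrightarrow> (\<not> d, q', a', b') \<in> L \<Longrightarrow> a \<le> q' \<Longrightarrow> q' \<le> b \<Longrightarrow> a' \<le> q \<Longrightarrow> q \<le> b' \<Longrightarrow>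
       pp \<kappa> (d, q, a, b) (C d q') = - pp \<kappa> (\<not> d, q', a', b') (C (\<not> d) q)"
proof -
  show "t \<in> L0 \<Longrightarrow> \<kappa> (t, e) = 0" "t \<in> LN \<Longrightarrow> \<kappa> (t, e) = 0" using assms unfolding Wd_def by blast+
  assume "(d, q, a, b) \<in> L" "(\<not> d, q', a', b') \<in> L" "a \<le> q'" "q' \<le> b" "a' \<le> q" "q \<le> b'"
  then have "pp \<kappa> (d, q, a, b) (C d q') + pp \<kappa> (\<not> d, q', a', b') (C (\<not> d) q) = 0"
    using assms unfolding Wd_def by blast
  then show "pp \<kappa> (d, q, a, b) (C d q') = - pp \<kappa> (\<not> d, q', a', b') (C (\<not> d) q)" by simp
qed

text \<open>Being divided beyond level \<open>k\<close> is constant on boxes of level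
  \<open>k\<close>, so on a line of level \<open>k + 1\<close> edges begin and stop only at
  multiples of \<open>w k\<close>.\<close>

lemma aligned:
  assumes "(d, q, a, b) \<in> L" "llev q = Suc k"
  shows "w k dvd a" "w k dvd b"
proof -
  note D = L_D[OF assms(1)]
  have eq: "U d (i - 1) q \<longleftrightarrow> U d i q" if "\<not> w k dvd i" for i
  proof -
    have "k < lv d (i - 1) q \<longleftrightarrow> k < lv d i q" using that by (intro lv_box div_pred) auto
    then show ?thesis by (simp add: U_def assms(2) Suc_le_eq)
  qed
  show "w k dvd a"
  proof (rule ccontr)
    assume h: "\<not> w k dvd a"
    then have "0 < a" by (rule contrapos_np) auto
    then show False using eq[OF h] D(3,6) D(5)[of a] by simp
  qed
  show "w k dvd b"
  proof (rule ccontr)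
    assume h: "\<not> w k dvd b"
    have "w k dvd N d" using llev_le_iff[of "N d" k] by simp
    then have "b < N d" using h D(4) by (metis le_neq_implies_less)
    moreover have "U d (b - 1) q" using D(3) by (intro D(5)) auto
    ultimately show False using eq[OF h] D(7) by simp
  qed
qed

section \<open>Nonzero polynomials of the lowest level close up to a block\<close>

context
  fixes k :: nat and h :: nat
  assumes k: "k < n" and h_def: "h = w (Suc k)"
begin

lemma half_width: "0 < h" "w k = 2 * h" using k by (simp_all add: h_def w_Suc)

text \<open>Cells of level \<open>k\<close> have width \<open>2 * h\<close>; the lines of level
  \<open>k + 1\<close> are the odd multiples of \<open>h\<close>, that is the center lines of these
  cells.\<close>

lemma llev_Suc:
  assumes "llev q = Suc k" shows "2 * h dvd q + h" "2 * h dvd q - h" "h \<le> q" "\<not> 2 * h dvd q"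
proof -
  have "h dvd q" using llev_le_iff[of q "Suc k"] assms by (simp add: h_def)
  then obtain z where z: "q = h * z" by blast
  have "\<not> w k dvd q" using llev_le_iff[of q k] assms by simp
  then have nd: "\<not> 2 * h dvd q" by (simp add: half_width)
  then have "odd z" unfolding z by (auto simp: mult.commute)
  then obtain y where y: "z = 2 * y + 1" by (rule oddE)
  show "2 * h dvd q + h" "2 * h dvd q - h" "h \<le> q" "\<not> 2 * h dvd q"
    using nd by (auto simp: z y algebra_simps intro: dvdI[of _ _ y] dvdI[of _ _ "Suc y"])
qed

lemma llev_center: "2 * h dvd m \<Longrightarrow> llev (m + h) = Suc k" "2 * h dvd m \<Longrightarrow> llev (m + 3 * h) = Suc k"
proof -
  have *: "llev (m + h) = Suc k" if "2 * h dvd m" for m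
  proof -
    have "h dvd m + h" using that by (meson dvd_add dvd_mult_right dvd_refl)
    then have "llev (m + h) \<le> Suc k" by (simp add: llev_le_iff h_def)
    moreover have "\<not> 2 * h dvd m + h" using that half_width(1) by (simp add: dvd_add_right_iff nat_dvd_not_less)
    then have "\<not> llev (m + h) \<le> k" by (simp add: llev_le_iff half_width)
    ultimately show ?thesis by simp
  qed
  show "2 * h dvd m \<Longrightarrow> llev (m + h) = Suc k" by (rule *)
  show "2 * h dvd m \<Longrightarrow> llev (m + 3 * h) = Suc k"
    using *[of "m + 2 * h"] by (simp add: algebra_simps)
qed

text \<open>A cell of level \<open>k\<close> that has one center line is divided, so it also has the
  other one. That one reaches from side to side, since the ends of its l-edge are multiples of
  \<open>2 * h\<close>.\<close>

lemma crossing: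
  assumes t: "(d, q, a, b) \<in> L" "llev q = Suc k" and m: "2 * h dvd m" "a \<le> m" "m < b"
  shows "\<exists>\<alpha> \<beta>. (\<not> d, m + h, \<alpha>, \<beta>) \<in> L \<and> \<alpha> + h \<le> q \<and> q + h \<le> \<beta>"
proof -
  note D = L_D[OF t(1)]
  have al: "2 * h dvd b" using aligned(2)[OF t(1), of k] t(2) by (simp add: half_width)
  have le: "m + 2 * h \<le> b" by (rule dvd_less_add[OF m(1) al m(3)])
  have "(m + h) div w k = m div w k" using m(1) half_width by (auto elim!: dvdE)
  then have "k < lv d (m + h) q \<longleftrightarrow> k < lv d m q" by (intro lv_box) auto
  then have "U (\<not> d) q (m + h)"
    using D(5)[of m] m t(2) by (simp add: U_def lv_swap llev_center Suc_le_eq)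
  moreover have "m + h < N d" using le D(4) half_width by linarith
  ultimately obtain \<alpha> \<beta> where ab: "(\<not> d, m + h, \<alpha>, \<beta>) \<in> L" "\<alpha> \<le> q" "q < \<beta>"
    using L_exists[of "\<not> d" q "m + h"] D(1,2) half_width by auto
  have al2: "2 * h dvd \<alpha>" "2 * h dvd \<beta>" using aligned[OF ab(1), of k] m(1) by (simp_all add: half_width llev_center)
  have "\<alpha> + 2 * h \<le> q + h" by (rule dvd_less_add) (use al2 llev_Suc[OF t(2)] ab half_width in auto)
  moreover have "q - h + 2 * h \<le> \<beta>" by (rule dvd_less_add) (use al2 llev_Suc[OF t(2)] ab half_width in auto)
  ultimately show ?thesis using ab llev_Suc(3)[OF t(2)] by (intro exI[of _ \<alpha>] exI[of _ \<beta>]) auto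
qed

lemma pp_four_roots:
  assumes "\<kappa> \<in> Wd" "card S = 4" "\<And>i. i \<in> S \<Longrightarrow> i \<le> N d \<and> pp \<kappa> t (C d i) = 0"
  shows "\<kappa> (t, e) = 0"
proof (cases "e \<le> 3")
  case True
  show ?thesis
  proof (rule cubic_four_roots[OF _ _ True])
    show "4 \<le> card (C d ` S)"
      using assms(2,3) by (subst card_image) (auto simp: inj_on_def C_eq_iff)
  qed (use assms(3) in \<open>auto simp: pp_def\<close>)
next
  case False
  then have "3 < e" by simp
  then show ?thesis using assms(1) unfolding Wd_def by blast
qed

lemma pp_zero: "(\<And>e. \<kappa> (t, e) = 0) \<Longrightarrow> pp \<kappa> t u = 0" by (simp add: pp_def)

text \<open>The line \<open>m\<close> has level at most \<open>k\<close>, so its l-edge at this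
  vertex carries the zero polynomial and the vertex condition hands the zero over. On the boundary
  of the domain the polynomial of the given l-edge is itself zero.\<close>

lemma pp_at_lower_level:
  assumes \<kappa>: "\<kappa> \<in> Wk k" and t: "(d, q, a, b) \<in> L" "llev q = Suc k" and m: "2 * h dvd m" "a \<le> m" "m \<le> b"
  shows "pp \<kappa> (d, q, a, b) (C d m) = 0"
proof -
  have \<kappa>': "\<kappa> \<in> Wd" using \<kappa> by (simp add: Wk_def)
  note D = L_D[OF t(1)]
  have lm: "llev m \<le> k" using m(1) by (simp add: llev_le_iff half_width)
  consider "m = 0" | "m = N d" | "0 < m" "m < N d" using m D(4) by force
  then show ?thesis
  proof cases
    case 1
    then show ?thesis using m t WdD(1)[OF \<kappa>'] by (intro pp_zero) (auto simp: L0_def)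
  next
    case 2
    then show ?thesis using m t D(4) WdD(2)[OF \<kappa>'] by (intro pp_zero) (auto simp: LN_def)
  next
    case 3
    have "inc (\<not> d) q m"
    proof (cases "m < b")
      case True
      then have "U (\<not> d) q m" using D(5)[of m] m(2) lm t(2) by (simp add: U_def lv_swap)
      then show ?thesis using D(2) by (simp add: inc_def)
    next
      case False
      \<comment> \<open>At the upper end of the l-edge the level is read off from the last square
        before \<open>m\<close>.\<close>
      then have "U d (m - 1) q" using D(3) D(5)[of "m - 1"] m(3) by auto
      then have "U (\<not> d) q m" using lm t(2) by (subst U_pred) (simp add: U_def lv_swap)
      then show ?thesis using D(2) by (simp add: inc_def)
    qed
    then obtain \<alpha> \<beta> where ab: "(\<not> d, m, \<alpha>, \<beta>) \<in> L" "\<alpha> \<le> q" "q \<le> \<beta>"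
      using L_exists_inc[of "\<not> d" q m] D(1,2) 3 by auto
    have "pp \<kappa> (\<not> d, m, \<alpha>, \<beta>) (C (\<not> d) q) = 0" using \<kappa> ab(1) lm by (intro pp_zero) (auto simp: Wk_def)
    then show ?thesis using WdD(3)[OF \<kappa>' t(1) ab(1)] m ab by simp
  qed
qed

definition nz :: "((bool \<times> nat \<times> nat \<times> nat) \<times> nat \<Rightarrow> real) \<Rightarrow> bool \<times> nat \<times> nat \<times> nat \<Rightarrow> bool" where
  "nz \<kappa> t \<longleftrightarrow> (\<exists>e. \<kappa> (t, e) \<noteq> 0)"

context
  fixes \<kappa>
  assumes \<kappa>: "\<kappa> \<in> Wk k"
    and long: "\<And>d q a b. (d, q, a, b) \<in> L \<Longrightarrow> llev q = Suc k \<Longrightarrow> a + 4 * h \<le> b"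
begin

lemma \<kappa>_Wd: "\<kappa> \<in> Wd" using \<kappa> by (simp add: Wk_def)

lemma nz_L: "nz \<kappa> t \<Longrightarrow> t \<in> L" using \<kappa>_Wd unfolding Wd_def nz_def by blast

text \<open>All multiples of \<open>2 * h\<close> from \<open>a\<close> to \<open>b\<close> are
  zeros. A length of \<open>6 * h\<close> would give four of them, so \<open>long\<close> leaves
  just \<open>4 * h\<close> with three zeros, and a further zero in the center of a cell would again
  make the cubic vanish.\<close>

lemma nz_length:
  assumes nz: "nz \<kappa> (d, q, a, b)" and q: "llev q = Suc k"
  shows "b = a + 4 * h" "2 * h dvd a" "0 < a" "b < N d"
    "pp \<kappa> (d, q, a, b) (C d (a + h)) \<noteq> 0" "pp \<kappa> (d, q, a, b) (C d (a + 3 * h)) \<noteq> 0"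
proof -
  have t: "(d, q, a, b) \<in> L" by (rule nz_L[OF nz])
  note D = L_D[OF t]
  have al: "2 * h dvd a" "2 * h dvd b" using aligned[OF t q] by (simp_all add: half_width)
  then have al': "2 * h dvd a + 2 * h" "2 * h dvd a + 4 * h" "2 * h dvd a + 6 * h"
    by (auto elim!: dvdE intro!: dvd_add)
  have le: "a + 4 * h \<le> b" by (rule long[OF t q])
  have root: "pp \<kappa> (d, q, a, b) (C d m) = 0" if "2 * h dvd m" "a \<le> m" "m \<le> b" for m
    by (rule pp_at_lower_level[OF \<kappa> t q that])
  have no4: False if "card S = 4" "\<And>i. i \<in> S \<Longrightarrow> i \<le> b \<and> pp \<kappa> (d, q, a, b) (C d i) = 0" for S
    using pp_four_roots[OF \<kappa>_Wd that(1), of d "(d, q, a, b)"] that(2) D(4) nz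
    unfolding nz_def using le_trans by blast
  show b: "b = a + 4 * h"
  proof (rule ccontr)
    assume "b \<noteq> a + 4 * h"
    then have "a + 4 * h + 2 * h \<le> b" using le by (intro dvd_less_add al al') simp
    then show False
      by (intro no4[of "{a, a + 2 * h, a + 4 * h, a + 6 * h}"]) (use half_width(1) root al al' in auto)
  qed
  show "2 * h dvd a" by (rule al)
  obtain e where e: "\<kappa> ((d, q, a, b), e) \<noteq> 0" using nz by (auto simp: nz_def)
  have "(d, q, a, b) \<notin> L0" "(d, q, a, b) \<notin> LN" using e WdD(1,2)[OF \<kappa>_Wd, of "(d, q, a, b)" e] by auto
  then show "0 < a" "b < N d" using t D(4) by (auto simp: L0_def LN_def)
  have r: "pp \<kappa> (d, q, a, b) (C d a) = 0" "pp \<kappa> (d, q, a, b) (C d (a + 2 * h)) = 0"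
    "pp \<kappa> (d, q, a, b) (C d (a + 4 * h)) = 0"
    using root[OF al(1)] root[OF al'(1)] root[OF al'(2)] b by simp_all
  show "pp \<kappa> (d, q, a, b) (C d (a + h)) \<noteq> 0"
  proof
    assume "pp \<kappa> (d, q, a, b) (C d (a + h)) = 0"
    then have "i \<le> b \<and> pp \<kappa> (d, q, a, b) (C d i) = 0" if "i \<in> {a, a + h, a + 2 * h, a + 4 * h}" for i
      using that r b by auto
    moreover have "card {a, a + h, a + 2 * h, a + 4 * h} = 4" using half_width(1) by (simp add: card_insert_if)
    ultimately show False by (intro no4)
  qed
  show "pp \<kappa> (d, q, a, b) (C d (a + 3 * h)) \<noteq> 0"
  proof
    assume "pp \<kappa> (d, q, a, b) (C d (a + 3 * h)) = 0"
    then have "i \<le> b \<and> pp \<kappa> (d, q, a, b) (C d i) = 0" if "i \<in> {a, a + 2 * h, a + 3 * h, a + 4 * h}" for i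
      using that r b by auto
    moreover have "card {a, a + 2 * h, a + 3 * h, a + 4 * h} = 4" using half_width(1) by (simp add: card_insert_if)
    ultimately show False by (intro no4)
  qed
qed

text \<open>The nonzero value in the center of a cell is passed on by the vertex condition. The
  transversal l-edge is then nonzero too, so it has length \<open>4 * h\<close>, and
  \<open>q\<close> passes through the center of one of its two cells.\<close>

lemma nz_crossing:
  assumes nz: "nz \<kappa> (d, q, a, b)" and q: "llev q = Suc k" and x: "x = h \<or> x = 3 * h"
  shows "llev (a + x) = Suc k"
    "\<exists>\<alpha>. nz \<kappa> (\<not> d, a + x, \<alpha>, \<alpha> + 4 * h) \<and> (\<not> d, a + x, \<alpha>, \<alpha> + 4 * h) \<in> L \<and> (q = \<alpha> + h \<or> q = \<alpha> + 3 * h)"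
proof -
  have t: "(d, q, a, b) \<in> L" by (rule nz_L[OF nz])
  note l = nz_length[OF nz q]
  show ll: "llev (a + x) = Suc k" using x l(2) llev_center by auto
  define m where "m = a + x - h"
  have m: "m + h = a + x" "a \<le> m" "m < b" "2 * h dvd m" using x l(1,2) half_width(1) by (auto simp: m_def)
  obtain \<alpha> \<beta> where ab: "(\<not> d, a + x, \<alpha>, \<beta>) \<in> L" "\<alpha> + h \<le> q" "q + h \<le> \<beta>"
    using crossing[OF t q m(4,2,3)] unfolding m(1) by blast
  have "pp \<kappa> (d, q, a, b) (C d (a + x)) = - pp \<kappa> (\<not> d, a + x, \<alpha>, \<beta>) (C (\<not> d) q)"
    using x l(1) ab by (intro WdD(3)[OF \<kappa>_Wd t ab(1)]) auto
  then have "pp \<kappa> (\<not> d, a + x, \<alpha>, \<beta>) (C (\<not> d) q) \<noteq> 0" using x l(5,6) by auto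
  then have nz': "nz \<kappa> (\<not> d, a + x, \<alpha>, \<beta>)" unfolding nz_def using pp_zero by blast
  note l' = nz_length[OF nz' ll]
  have "2 * h dvd q - h" "h \<le> q" using llev_Suc[OF q] by auto
  then obtain y where y: "q = h + 2 * h * y" by (metis dvdE le_add_diff_inverse)
  obtain z where z: "\<alpha> = 2 * h * z" using l'(2) by blast
  have "2 * h * z \<le> 2 * h * y" using ab(2) by (simp add: y z)
  then have "z \<le> y" using half_width(1) by simp
  moreover have "2 * h * (y + 1) \<le> 2 * h * (z + 2)" using ab(3) l'(1) by (simp add: y z algebra_simps)
  then have "y + 1 \<le> z + 2" using half_width(1) by (simp only: nat_mult_le_cancel_disj mult_eq_0_iff)
  ultimately have "y = z \<or> y = z + 1" by linarith
  then have "q = \<alpha> + h \<or> q = \<alpha> + 3 * h" by (auto simp: y z)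
  then show "\<exists>\<alpha>. nz \<kappa> (\<not> d, a + x, \<alpha>, \<alpha> + 4 * h) \<and> (\<not> d, a + x, \<alpha>, \<alpha> + 4 * h) \<in> L \<and> (q = \<alpha> + h \<or> q = \<alpha> + 3 * h)"
    using nz' ab(1) l'(1) by blast
qed

text \<open>Both cells of the row are divided by the transversal l-edges, so the center line of the
  row runs through both. The two pieces touch at \<open>a + 2 * h\<close> and thus belong to one
  l-edge.\<close>

lemma parallel_extent:
  assumes v: "(\<not> d, a + h, \<alpha>, \<alpha> + 4 * h) \<in> L" "(\<not> d, a + 3 * h, \<alpha>, \<alpha> + 4 * h) \<in> L"
    and a: "2 * h dvd a" and y: "y = h \<or> y = 3 * h"
    and t: "(d, \<alpha> + y, a', b') \<in> L" "a' \<le> a + x" "a + x \<le> b'" "x \<le> 4 * h"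
  shows "a' \<le> a" "a + 4 * h \<le> b'"
proof -
  have q: "llev (a + h) = Suc k" "llev (a + 3 * h) = Suc k" using a llev_center by auto
  have al: "2 * h dvd \<alpha>" using aligned(1)[OF v(1) q(1)] by (simp add: half_width)
  define m where "m = \<alpha> + y - h"
  have m: "m + h = \<alpha> + y" "2 * h dvd m" "\<alpha> \<le> m" "m < \<alpha> + 4 * h" using y al half_width(1) by (auto simp: m_def)
  obtain a1 b1 where 1: "(d, \<alpha> + y, a1, b1) \<in> L" "a1 + h \<le> a + h" "a + h + h \<le> b1"
    using crossing[OF v(1) q(1) m(2-4)] unfolding m(1) by auto
  obtain a2 b2 where 2: "(d, \<alpha> + y, a2, b2) \<in> L" "a2 + h \<le> a + 3 * h" "a + 3 * h + h \<le> b2"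
    using crossing[OF v(2) q(2) m(2-4)] unfolding m(1) by auto
  have "a1 = a2" "b1 = b2" using L_unique[OF 1(1) 2(1), of "a + 2 * h"] 1 2 by auto
  moreover have "a' = a1" "b' = b1" using L_unique[OF t(1) 1(1), of "a + x"] 1 2 t calculation by auto
  ultimately show "a' \<le> a" "a + 4 * h \<le> b'" using 1 2 by auto
qed

text \<open>Otherwise the nonzero l-edges would form a staircase, which the induction follows downwards.\<close>

lemma crossing_extents_agree:
  assumes "nz \<kappa> (d, q, a, b)" "llev q = Suc k" "(\<not> d, a + h, \<alpha>1, \<alpha>1 + 4 * h) \<in> L" "(\<not> d, a + 3 * h, \<alpha>2, \<alpha>2 + 4 * h) \<in> L"
    "q = \<alpha>1 + h \<or> q = \<alpha>1 + 3 * h" "q = \<alpha>2 + h \<or> q = \<alpha>2 + 3 * h"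
  shows "\<alpha>1 = \<alpha>2"
  using assms
proof (induction q arbitrary: a b \<alpha>1 \<alpha>2 rule: less_induct)
  case (less q)
  show ?case
  proof (rule ccontr)
    assume ne: "\<alpha>1 \<noteq> \<alpha>2"
    \<comment> \<open>If the extents differ, one transversal reaches from \<open>q - 3 * h\<close>
      to \<open>q + h\<close> and the other from \<open>q - h\<close> to
      \<open>q + 3 * h\<close>.\<close>
    obtain x x' \<alpha> \<alpha>' where x: "(x = h \<and> x' = 3 * h) \<or> (x = 3 * h \<and> x' = h)"
      "(\<not> d, a + x, \<alpha>, \<alpha> + 4 * h) \<in> L" "(\<not> d, a + x', \<alpha>', \<alpha>' + 4 * h) \<in> L" "q = \<alpha> + 3 * h" "q = \<alpha>' + h"
    proof (cases "q = \<alpha>1 + 3 * h")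
      case True
      then have "q = \<alpha>2 + h" using less.prems(6) ne by auto
      then show ?thesis using that[of h "3 * h" \<alpha>1 \<alpha>2] True less.prems by auto
    next
      case False
      then have "q = \<alpha>1 + h" "q = \<alpha>2 + 3 * h" using less.prems(5,6) ne by auto
      then show ?thesis using that[of "3 * h" h \<alpha>2 \<alpha>1] less.prems by auto
    qed
    have xh: "x = h \<or> x = 3 * h" using x(1) by auto
    note l = nz_length[OF less.prems(1,2)]
    obtain \<beta> where v: "nz \<kappa> (\<not> d, a + x, \<beta>, \<beta> + 4 * h)" "(\<not> d, a + x, \<beta>, \<beta> + 4 * h) \<in> L" "q = \<beta> + h \<or> q = \<beta> + 3 * h"
      using nz_crossing(2)[OF less.prems(1,2) xh] by blast
    have "\<beta> = \<alpha>" using L_unique(1)[OF v(2) x(2), of q] v(3) x(4) by auto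
    then have nzv: "nz \<kappa> (\<not> d, a + x, \<alpha>, \<alpha> + 4 * h)" using v by simp
    have lx: "llev (a + x) = Suc k" using nz_crossing(1)[OF less.prems(1,2) xh] .
    obtain a' where h': "nz \<kappa> (d, \<alpha> + h, a', a' + 4 * h)" "a + x = a' + h \<or> a + x = a' + 3 * h"
      using nz_crossing(2)[OF nzv lx, of h] by auto
    have lh: "llev (\<alpha> + h) = Suc k" using nz_crossing(1)[OF nzv lx, of h] by simp
    obtain \<alpha>1' where v1: "(\<not> d, a' + h, \<alpha>1', \<alpha>1' + 4 * h) \<in> L" "\<alpha> + h = \<alpha>1' + h \<or> \<alpha> + h = \<alpha>1' + 3 * h"
      using nz_crossing(2)[OF h'(1) lh, of h] by auto
    obtain \<alpha>2' where v2: "(\<not> d, a' + 3 * h, \<alpha>2', \<alpha>2' + 4 * h) \<in> L" "\<alpha> + h = \<alpha>2' + h \<or> \<alpha> + h = \<alpha>2' + 3 * h"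
      using nz_crossing(2)[OF h'(1) lh, of "3 * h"] by auto
    \<comment> \<open>The other row of the transversal that reaches down has a smaller index, so
      both transversals of the l-edge in that row have equal extents by induction. One of them is
      the transversal at \<open>a + x\<close>.\<close>
    have "\<alpha> + h < q" using x(4) half_width(1) by simp
    then have eq: "\<alpha>1' = \<alpha>2'" by (rule less.IH[OF _ h'(1) lh v1(1) v2(1) v1(2) v2(2)])
    have "\<alpha>1' = \<alpha> \<or> \<alpha>2' = \<alpha>"
      using h'(2)
    proof
      assume "a + x = a' + h"
      then show ?thesis using L_unique(1)[OF v1(1), of \<alpha> "\<alpha> + 4 * h" "\<alpha> + h"] x(2) v1(2) by auto
    next
      assume "a + x = a' + 3 * h"
      then show ?thesis using L_unique(1)[OF v2(1), of \<alpha> "\<alpha> + 4 * h" "\<alpha> + h"] x(2) v2(2) by auto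
    qed
    then have e: "\<alpha>1' = \<alpha>" "\<alpha>2' = \<alpha>" using eq by auto
    have t: "(d, \<alpha> + 3 * h, a, b) \<in> L" using nz_L[OF less.prems(1)] x(4) by simp
    have a'2: "2 * h dvd a'" using nz_length(2)[OF h'(1) lh] .
    \<comment> \<open>Both transversals of the lower row also cross the line \<open>q\<close>, so
      the l-edge on \<open>q\<close> covers the extent of the lower one; both have length
      \<open>4 * h\<close>.\<close>
    have "a \<le> a'" "a' + 4 * h \<le> b"
      using parallel_extent[where y = "3 * h" and x = "a + x - a'", OF v1(1)[unfolded e] v2(1)[unfolded e] a'2 _ t] h'(2) x(1) l(1)
      by auto
    then have "a' = a" using l(1) by simp
    \<comment> \<open>The l-edges on \<open>q\<close> and on the lower row thus have the same two
      transversals, which contradicts the extent found for the one at \<open>a + x'\<close>.\<close>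
    then have "(\<not> d, a + x', \<alpha>, \<alpha> + 4 * h) \<in> L" using v1(1) v2(1) e x(1) by auto
    then have "\<alpha>' = \<alpha>" using L_unique(1)[OF x(3), of \<alpha> "\<alpha> + 4 * h" q] x(4,5) by auto
    then show False using x(4,5) half_width(1) by simp
  qed
qed

text \<open>The two transversals have the same extent and both are nonzero, so
  \<open>parallel_extent\<close> and the fixed length determine the two rows as well. Center values
  are provided for both directions, since \<open>d\<close> is arbitrary while \<open>blocks\<close>
  refers to \<open>True\<close>.\<close>

lemma nz_block:
  assumes nz: "nz \<kappa> (d, q, a, b)" and q: "llev q = Suc k"
  shows "\<exists>\<alpha>. blk k d a \<alpha> \<and> pp \<kappa> (d, \<alpha> + h, a, a + 4 * h) (C d (a + h)) \<noteq> 0 \<and>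
    pp \<kappa> (\<not> d, a + h, \<alpha>, \<alpha> + 4 * h) (C (\<not> d) (\<alpha> + h)) \<noteq> 0"
proof -
  note l = nz_length[OF nz q]
  obtain \<alpha> where v1: "nz \<kappa> (\<not> d, a + h, \<alpha>, \<alpha> + 4 * h)" "(\<not> d, a + h, \<alpha>, \<alpha> + 4 * h) \<in> L" "q = \<alpha> + h \<or> q = \<alpha> + 3 * h"
    using nz_crossing(2)[OF nz q, of h] by auto
  obtain \<alpha>2 where v2: "nz \<kappa> (\<not> d, a + 3 * h, \<alpha>2, \<alpha>2 + 4 * h)" "(\<not> d, a + 3 * h, \<alpha>2, \<alpha>2 + 4 * h) \<in> L" "q = \<alpha>2 + h \<or> q = \<alpha>2 + 3 * h"
    using nz_crossing(2)[OF nz q, of "3 * h"] by auto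
  have e: "\<alpha>2 = \<alpha>" using crossing_extents_agree[OF nz q v1(2) v2(2) v1(3) v2(3)] by simp
  have lh: "llev (a + h) = Suc k" using nz_crossing(1)[OF nz q, of h] by simp
  note lv = nz_length[OF v1(1) lh]
  have row: "nz \<kappa> (d, \<alpha> + y, a, a + 4 * h) \<and> (d, \<alpha> + y, a, a + 4 * h) \<in> L" if y: "y = h \<or> y = 3 * h" for y
  proof -
    obtain a' where h': "nz \<kappa> (d, \<alpha> + y, a', a' + 4 * h)" "(d, \<alpha> + y, a', a' + 4 * h) \<in> L" "a + h = a' + h \<or> a + h = a' + 3 * h"
      using nz_crossing(2)[OF v1(1) lh y] by auto
    have "a' \<le> a" "a + 4 * h \<le> a' + 4 * h"
      using parallel_extent[OF v1(2) v2(2)[unfolded e] l(2) y h'(2), of h] h'(3) by auto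
    then show ?thesis using h' by simp
  qed
  have "llev (\<alpha> + h) = Suc k" using nz_crossing(1)[OF v1(1) lh, of h] by simp
  then have p: "pp \<kappa> (d, \<alpha> + h, a, a + 4 * h) (C d (a + h)) \<noteq> 0" using nz_length(5)[of d "\<alpha> + h" a "a + 4 * h"] row[of h] by simp
  have "blk k d a \<alpha>"
    unfolding blk_def h_def[symmetric] using row v1(2) v2(2) e l lv by (auto simp: half_width(2))
  then show ?thesis using p lv(5) by blast
qed

end

end


section \<open>The dependency carried by a block\<close>

context
  fixes k :: nat and h :: nat
  assumes k: "k < n" and h_def: "h = w (Suc k)"
begin

lemmas half_width' = half_width[OF k h_def]

text \<open>On the block with corner \<open>P\<close> the dependency is the restriction to the l-edges of the bicubic
  polynomial that vanishes on all grid lines of lower level through the block; on vertical l-edges it is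
  taken with the opposite sign.\<close>

definition rootp :: "(bool \<Rightarrow> nat) \<Rightarrow> bool \<Rightarrow> real \<Rightarrow> real" where
  "rootp P d u = (u - C d (P d)) * (u - C d (P d + 2 * h)) * (u - C d (P d + 4 * h))"

definition rootc :: "(bool \<Rightarrow> nat) \<Rightarrow> bool \<Rightarrow> nat \<Rightarrow> real" where
  "rootc P d e = (let r = C d (P d); s = C d (P d + 2 * h); t = C d (P d + 4 * h)
     in [- (r * s * t), r * s + r * t + s * t, - r - s - t, 1] ! e)"

text \<open>The l-edges of higher levels inside the block take part: where they meet lines of level
  \<open>k + 1\<close>, the vertex conditions would in general fail with zero polynomials on
  them.\<close>

definition blkdep :: "(bool \<Rightarrow> nat) \<Rightarrow> (bool \<times> nat \<times> nat \<times> nat) \<times> nat \<Rightarrow> real" where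
  "blkdep P = (\<lambda>((d, q, a, b), e).
     if (d, q, a, b) \<in> L \<and> P d \<le> a \<and> b \<le> P d + 4 * h \<and> P (\<not> d) < q \<and> q < P (\<not> d) + 4 * h \<and> e \<le> 3
     then (if d then 1 else -1) * rootc P d e * rootp P (\<not> d) (C (\<not> d) q) else 0)"

lemma rootc: "(\<Sum>e\<le>3. rootc P d e * u ^ e) = rootp P d u"
  by (simp add: rootc_def rootp_def Let_def numeral_3_eq_3 numeral_2_eq_2 algebra_simps)

lemma pp_blkdep:
  "pp (blkdep P) (d, q, a, b) u =
     (if (d, q, a, b) \<in> L \<and> P d \<le> a \<and> b \<le> P d + 4 * h \<and> P (\<not> d) < q \<and> q < P (\<not> d) + 4 * h
      then (if d then 1 else -1) * rootp P d u * rootp P (\<not> d) (C (\<not> d) q) else 0)" (is "_ = (if ?c then _ else _)")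
proof (cases ?c)
  case True
  then have "pp (blkdep P) (d, q, a, b) u = (\<Sum>e\<le>3. (rootc P d e * u ^ e) * ((if d then 1 else -1) * rootp P (\<not> d) (C (\<not> d) q)))"
    unfolding pp_def blkdep_def by (intro sum.cong) auto
  also have "\<dots> = rootp P d u * ((if d then 1 else -1) * rootp P (\<not> d) (C (\<not> d) q))"
    unfolding sum_distrib_right[symmetric] rootc ..
  finally show ?thesis using True by simp
qed (auto simp: pp_def blkdep_def)

context
  fixes P :: "bool \<Rightarrow> nat"
  assumes P: "blk k True (P True) (P False)"
begin

lemma blkO: "blk k d (P d) (P (\<not> d))"
  using P blk_swap[of k True "P False" "P True"] by (cases d) auto

lemma blkO_D:
  "(d, P (\<not> d) + h, P d, P d + 4 * h) \<in> L" "(d, P (\<not> d) + 3 * h, P d, P d + 4 * h) \<in> L"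
  "0 < P d" "P d + 4 * h < N d" "2 * h dvd P d"
  using blkO[of d] by (auto simp: blk_def half_width' simp flip: h_def)

lemma lower_level_inside:
  assumes "llev q \<le> k" "P d < q" "q < P d + 4 * h" shows "q = P d + 2 * h"
proof -
  have qd: "2 * h dvd q" using assms(1) by (simp add: llev_le_iff half_width')
  have e: "2 * h dvd P d + 4 * h" using blkO_D(5)[of d] by (intro dvd_add) (auto intro!: dvdI[of _ _ 2])
  have "P d + 2 * h \<le> q" "q + 2 * h \<le> P d + 4 * h"
    by (rule dvd_less_add[OF blkO_D(5) qd assms(2)], rule dvd_less_add[OF qd e assms(3)])
  then show ?thesis by simp
qed

text \<open>An edge of level above \<open>k\<close> shows that its box of level \<open>k\<close> is
  divided, so the center line of the same row is present next to it. As the center lines of a block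
  end at its sides, no l-edge of such a level can leave the block.\<close>

lemma center_U:
  assumes q: "P (\<not> d) < q" "q < P (\<not> d) + 4 * h" and U: "U d i q" "k < llev q"
  shows "U d i (P (\<not> d) + h) \<or> U d i (P (\<not> d) + 3 * h)"
proof -
  obtain z where z: "P (\<not> d) = 2 * h * z" using blkO_D(5)[of "\<not> d"] by blast
  have kl: "k < lv d i q" using U by (simp add: U_def)
  have ctr: "llev (P (\<not> d) + h) = Suc k" "llev (P (\<not> d) + 3 * h) = Suc k"
    using llev_center[OF k h_def blkO_D(5)[of "\<not> d"]] by auto
  show ?thesis
  proof (cases "q < P (\<not> d) + 2 * h")
    case True
    have "q div w k = z"
      using q True by (intro div_nat_eqI) (auto simp: half_width' z algebra_simps)
    moreover have "(P (\<not> d) + h) div w k = z"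
      using half_width'(1) by (intro div_nat_eqI) (auto simp: half_width' z algebra_simps)
    ultimately have "k < lv d i (P (\<not> d) + h)" using kl lv_box[of i k i q "P (\<not> d) + h"] by simp
    then show ?thesis using ctr by (simp add: U_def Suc_le_eq)
  next
    case False
    have "q div w k = z + 1"
      using q False by (intro div_nat_eqI) (auto simp: half_width' z algebra_simps)
    moreover have "(P (\<not> d) + 3 * h) div w k = z + 1"
      using half_width'(1) by (intro div_nat_eqI) (auto simp: half_width' z algebra_simps)
    ultimately have "k < lv d i (P (\<not> d) + 3 * h)" using kl lv_box[of i k i q "P (\<not> d) + 3 * h"] by simp
    then show ?thesis using ctr by (simp add: U_def Suc_le_eq)
  qed
qed

text \<open>Up to the sign of the direction the value depends on the point only, hence the vertex
  conditions. For an l-edge not inside the block, the common points lie on zero lines of the bicubic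
  polynomial; the remaining case, an l-edge of level above \<open>k\<close> that leaves the block,
  is excluded by \<open>center_U\<close>.\<close>

lemma pp_blkdep_at:
  assumes t: "(d, q, a, b) \<in> L" and i: "a \<le> i" "i \<le> b"
  shows "pp (blkdep P) (d, q, a, b) (C d i) = (if d then 1 else -1) *
     (if P d \<le> i \<and> i \<le> P d + 4 * h \<and> P (\<not> d) \<le> q \<and> q \<le> P (\<not> d) + 4 * h
      then rootp P d (C d i) * rootp P (\<not> d) (C (\<not> d) q) else 0)"
proof (cases "P d \<le> a \<and> b \<le> P d + 4 * h \<and> P (\<not> d) < q \<and> q < P (\<not> d) + 4 * h")
  case True
  then show ?thesis using t i unfolding pp_blkdep by auto
next
  case False
  note D = L_D[OF t]
  have "rootp P d (C d i) * rootp P (\<not> d) (C (\<not> d) q) = 0"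
    if *: "P d \<le> i" "i \<le> P d + 4 * h" "P (\<not> d) \<le> q" "q \<le> P (\<not> d) + 4 * h"
  proof (cases "q = P (\<not> d) \<or> q = P (\<not> d) + 4 * h \<or> q = P (\<not> d) + 2 * h \<or> i = P d \<or> i = P d + 4 * h")
    case True
    then show ?thesis by (auto simp: rootp_def)
  next
    case ne: False
    then have q: "P (\<not> d) < q" "q < P (\<not> d) + 4 * h" using * by auto
    then have lq: "k < llev q" using lower_level_inside[of q "\<not> d"] ne by force
    consider "a < P d" | "P d + 4 * h < b" using False q by force
    then show ?thesis
    proof cases
      case 1
      then have "U d (P d - 1) q" using D(5)[of "P d - 1"] i * ne by auto
      then have "U d (P d - 1) (P (\<not> d) + h) \<or> U d (P d - 1) (P (\<not> d) + 3 * h)"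
        using center_U[OF q _ lq] by blast
      then show ?thesis using L_D(6)[OF blkO_D(1)[of d]] L_D(6)[OF blkO_D(2)[of d]] blkO_D(3)[of d] by auto
    next
      case 2
      then have "U d (P d + 4 * h) q" using D(5)[of "P d + 4 * h"] i * ne by auto
      then have "U d (P d + 4 * h) (P (\<not> d) + h) \<or> U d (P d + 4 * h) (P (\<not> d) + 3 * h)"
        using center_U[OF q _ lq] by blast
      then show ?thesis using L_D(7)[OF blkO_D(1)[of d]] L_D(7)[OF blkO_D(2)[of d]] blkO_D(4)[of d] by auto
    qed
  qed
  then show ?thesis using False t unfolding pp_blkdep by auto
qed

lemma blkdep_Wk: "blkdep P \<in> Wk k"
proof -
  have "blkdep P (t, e) = 0" if "t \<notin> L - L0 - LN \<or> 3 < e" for t e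
  proof -
    obtain d q a b where t: "t = (d, q, a, b)" by (cases t)
    show ?thesis using that blkO_D(3,4)[of d] by (auto simp: t blkdep_def L0_def LN_def)
  qed
  moreover have "pp (blkdep P) (d, q, a, b) (C d q') + pp (blkdep P) (\<not> d, q', a', b') (C (\<not> d) q) = 0"
    if "(d, q, a, b) \<in> L" "(\<not> d, q', a', b') \<in> L" "a \<le> q'" "q' \<le> b" "a' \<le> q" "q \<le> b'" for d q a b q' a' b'
    using that by (simp add: pp_blkdep_at)
  moreover have "blkdep P ((d, q, a, b), e) = 0" if "(d, q, a, b) \<in> L" "llev q \<le> k" for d q a b e
  proof (cases "P (\<not> d) < q \<and> q < P (\<not> d) + 4 * h")
    case True
    then have "q = P (\<not> d) + 2 * h" using that(2) by (intro lower_level_inside) auto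
    then show ?thesis by (simp add: blkdep_def rootp_def)
  qed (auto simp: blkdep_def)
  ultimately show ?thesis unfolding Wk_def Wd_def by blast
qed

lemma blkdep_center: "pp (blkdep P) (True, P False + h, P True, P True + 4 * h) (C True (P True + h)) \<noteq> 0"
proof -
  have ne: "rootp P d (C d (P d + h)) \<noteq> 0" for d
    using blkO_D(4)[of d] half_width'(1) by (auto simp: rootp_def C_eq_iff)
  then show ?thesis using blkO_D(1)[of True] half_width'(1) ne[of True] ne[of False] by (simp add: pp_blkdep)
qed

text \<open>If the l-edge of another block lay inside this one, equal lengths would give equal
  columns; the transversals of both blocks would then overlap on one line and coincide, and so would
  the blocks.\<close>

lemma blkdep_other:
  assumes B': "blk k True A' B'" and ne: "(A', B') \<noteq> (P True, P False)"
  shows "pp (blkdep P) (True, B' + h, A', A' + 4 * h) u = 0"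
proof -
  have B: "(True, B' + h, A', A' + 4 * h) \<in> L" "(False, A' + h, B', B' + 4 * h) \<in> L" "2 * h dvd B'"
    using B' by (auto simp: blk_def half_width' simp flip: h_def)
  have False if "P True \<le> A'" "A' + 4 * h \<le> P True + 4 * h" "P False < B' + h" "B' + h < P False + 4 * h"
  proof -
    have A: "A' = P True" using that by simp
    have v: "(False, A' + h, P False, P False + 4 * h) \<in> L" using blkO_D(1)[of False] A by simp
    obtain z where z: "B' = 2 * h * z" using B(3) by blast
    obtain y where y: "P False = 2 * h * y" using blkO_D(5)[of False] by blast
    have "2 * h * y < 2 * h * (z + 1)" using that(3) half_width'(1) by (simp add: y z)
    then have "y < z + 1" by (simp only: nat_mult_less_cancel_disj)
    then have "2 * h * y \<le> 2 * h * z" by simp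
    then have "B' = P False" using L_unique(1)[OF B(2) v, of "B' + h"] that(3,4) by (simp add: y z)
    then show False using ne A by simp
  qed
  then show ?thesis unfolding pp_blkdep by force
qed

end

end

section \<open>The dimension of the space of dependencies\<close>

lemma Wd_subspace: "fv.subspace Wd"
  unfolding subspace_apply_iff Wd_def
proof (intro conjI ballI allI, goal_cases)
  case 1
  then show ?case by (simp add: pp_def)
next
  case (2 f g)
  have "pp (\<lambda>x. f x + g x) t u = pp f t u + pp g t u" for t u
    by (simp add: pp_def distrib_right sum.distrib)
  then show ?case using 2 by (simp, smt (verit))
next
  case (3 c f)
  have "pp (\<lambda>x. c * f x) t u = c * pp f t u" for t u
    by (simp add: pp_def sum_distrib_left mult.assoc)
  then show ?case using 3 by (simp flip: distrib_left)
qed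

lemma Wk_subspace: "fv.subspace (Wk m)"
  using Wd_subspace unfolding subspace_apply_iff Wk_def by simp

lemma finite_blocks: "finite (blocks k)"
proof (rule finite_subset)
  show "blocks k \<subseteq> {..N True} \<times> {..N False}" by (auto simp: blocks_def blk_def)
qed auto

text \<open>The functionals evaluate at the center of the lower left cell of each block. By
  \<open>nz_block\<close> their common kernel in \<open>Wk k\<close> is \<open>Wk (Suc k)\<close>,
  and the \<open>blkdep\<close> form the dual family.\<close>

lemma Wk_step:
  assumes k: "k < n"
    and long: "\<And>d q a b. (d, q, a, b) \<in> L \<Longrightarrow> llev q = Suc k \<Longrightarrow> a + 4 * w (Suc k) \<le> b"
    and dim: "has_dim (Wk (Suc k)) m"
  shows "has_dim (Wk k) (m + card (blocks k))"
proof -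
  define h where "h = w (Suc k)"
  define ev :: "nat \<times> nat \<Rightarrow> ((bool \<times> nat \<times> nat \<times> nat) \<times> nat \<Rightarrow> real) \<Rightarrow> real"
    where "ev = (\<lambda>(A, B) \<kappa>. pp \<kappa> (True, B + h, A, A + 4 * h) (C True (A + h)))"
  define v where "v = (\<lambda>(A, B). blkdep h (\<lambda>d. if d then A else B))"
  have eq: "{\<kappa> \<in> Wk k. \<forall>i\<in>blocks k. ev i \<kappa> = 0} = Wk (Suc k)"
  proof (intro equalityI subsetI)
    fix \<kappa> assume "\<kappa> \<in> {\<kappa> \<in> Wk k. \<forall>i\<in>blocks k. ev i \<kappa> = 0}"
    then have \<kappa>: "\<kappa> \<in> Wk k" and ev0: "\<And>A B. (A, B) \<in> blocks k \<Longrightarrow> ev (A, B) \<kappa> = 0" by auto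
    have "\<kappa> ((d, q, a, b), e) = 0" if t: "(d, q, a, b) \<in> L" "llev q \<le> Suc k" for d q a b e
    proof (rule ccontr)
      assume ne: "\<kappa> ((d, q, a, b), e) \<noteq> 0"
      then have q: "llev q = Suc k" using \<kappa> t by (auto simp: Wk_def le_Suc_eq)
      have nz: "nz \<kappa> (d, q, a, b)" using ne unfolding nz_def[OF k refl] by blast
      obtain \<alpha> where \<alpha>: "blk k d a \<alpha>" "pp \<kappa> (d, \<alpha> + h, a, a + 4 * h) (C d (a + h)) \<noteq> 0"
        "pp \<kappa> (\<not> d, a + h, \<alpha>, \<alpha> + 4 * h) (C (\<not> d) (\<alpha> + h)) \<noteq> 0"
        using nz_block[OF k h_def \<kappa> _ nz q] long unfolding h_def by blast
      show False
      proof (cases d)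
        case True
        then show ?thesis using \<alpha>(1,2) ev0[of a \<alpha>] by (simp add: blocks_def ev_def)
      next
        case False
        then have "blk k True \<alpha> a" using \<alpha>(1) blk_swap[of k True a \<alpha>] by simp
        then show ?thesis using \<alpha>(3) False ev0[of \<alpha> a] by (simp add: blocks_def ev_def)
      qed
    qed
    then show "\<kappa> \<in> Wk (Suc k)" using \<kappa> by (auto simp: Wk_def)
  next
    fix \<kappa> assume \<kappa>: "\<kappa> \<in> Wk (Suc k)"
    have "ev (A, B) \<kappa> = 0" if "(A, B) \<in> blocks k" for A B
    proof -
      have *: "(True, B + h, A, A + 4 * h) \<in> L" "w k dvd B" using that by (auto simp: blocks_def blk_def simp flip: h_def)
      then have "llev (B + h) = Suc k" using llev_center(1)[OF k h_def] w_Suc[OF k] by (simp add: h_def)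
      then have "\<kappa> ((True, B + h, A, A + 4 * h), e) = 0" for e using \<kappa> *(1) by (auto simp: Wk_def)
      then show ?thesis by (simp add: ev_def pp_def)
    qed
    then show "\<kappa> \<in> {\<kappa> \<in> Wk k. \<forall>i\<in>blocks k. ev i \<kappa> = 0}" using \<kappa> by (auto simp: Wk_def)
  qed
  show ?thesis
  proof (rule has_dim_kernel_family[where ev = ev and v = v])
    show "has_dim {s \<in> Wk k. \<forall>i\<in>blocks k. ev i s = 0} m" unfolding eq by (rule dim)
    show "ev i (\<lambda>x. f x - c * g x) = ev i f - c * ev i g" for i f g c
      by (cases i) (simp add: ev_def pp_def left_diff_distrib sum_subtractf sum_distrib_left mult.assoc)
  next
    fix i assume "i \<in> blocks k"
    then obtain A B where i: "i = (A, B)" "blk k True A B" by (auto simp: blocks_def)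
    then have P: "blk k True ((\<lambda>d. if d then A else B) True) ((\<lambda>d. if d then A else B) False)" by simp
    show "v i \<in> Wk k" using blkdep_Wk[OF k h_def P] by (simp add: v_def i)
    show "ev i (v i) \<noteq> 0" using blkdep_center[OF k h_def P] by (simp add: v_def ev_def i)
    fix j assume "j \<in> blocks k" "j \<noteq> i"
    then obtain A' B' where j: "j = (A', B')" "blk k True A' B'" by (auto simp: blocks_def)
    then show "ev j (v i) = 0" using blkdep_other[OF k h_def P j(2)] \<open>j \<noteq> i\<close> by (auto simp: v_def ev_def i)
  qed (use finite_blocks Wk_subspace in auto)
qed

lemma has_dim_Wd:
  assumes "\<And>k d q a b. (d, q, a, b) \<in> L \<Longrightarrow> llev q = Suc k \<Longrightarrow> a + 4 * w (Suc k) \<le> b"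
  shows "has_dim Wd (\<Sum>k<n. card (blocks k))"
proof -
  have "has_dim (Wk (n - j)) (\<Sum>k=n - j..<n. card (blocks k))" if "j \<le> n" for j
    using that
  proof (induction j)
    case 0
    have "\<kappa> (t, e) = 0" if "\<kappa> \<in> Wk n" for \<kappa> t e
    proof (cases "t \<in> L")
      case True
      then show ?thesis using that llev_le_n by (cases t) (auto simp: Wk_def)
    next
      case False
      then show ?thesis using that unfolding Wk_def Wd_def by blast
    qed
    then have "Wk n = {\<lambda>_. 0}" using Wk_subspace[of n] unfolding subspace_apply_iff by force
    then show ?case using has_dim_zero by simp
  next
    case (Suc j)
    define k where "k = n - Suc j"
    have k: "k < n" "n - j = Suc k" using Suc.prems by (auto simp: k_def)
    have "has_dim (Wk k) ((\<Sum>k=Suc k..<n. card (blocks k)) + card (blocks k))"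
      using Suc.IH Suc.prems unfolding k(2) by (intro Wk_step k(1) assms) auto
    then show ?case unfolding k_def[symmetric] using k(1) by (simp add: sum.atLeast_Suc_lessThan add.commute)
  qed
  from this[of n] have "has_dim (Wk 0) (\<Sum>k<n. card (blocks k))" by (simp add: atLeast0LessThan)
  moreover have "Wk 0 = Wd"
  proof -
    have "\<kappa> ((d, q, a, b), e) = 0" if "\<kappa> \<in> Wd" "(d, q, a, b) \<in> L" "llev q = 0" for \<kappa> d q a b e
    proof -
      \<comment> \<open>A line of level 0 has all its edges, so its l-edge starts on the boundary
        and carries the zero polynomial.\<close>
      have "U d i q" for i using that(3) by (simp add: U_def)
      then have "a = 0" using L_D(6)[OF that(2)] by blast
      then show ?thesis using WdD(1)[OF that(1)] that(2) by (simp add: L0_def)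
    qed
    then show ?thesis by (auto simp: Wk_def)
  qed
  ultimately show ?thesis by simp
qed

end

section \<open>Vertices, edges and l-edges of a mesh on an integer grid\<close>

text \<open>\<open>u\<close> is the coordinate along direction \<open>d\<close> and \<open>v\<close>
  the one across it; one statement then serves horizontal and vertical segments.\<close>

definition mk :: "bool \<Rightarrow> real \<Rightarrow> real \<Rightarrow> real \<times> real" where "mk d u v = (if d then (u, v) else (v, u))"

lemma mk_inj [simp]: "mk d u v = mk d u' v' \<longleftrightarrow> u = u' \<and> v = v'" by (auto simp: mk_def)

lemma mk_swap: "mk (\<not> d) u v = mk d v u" by (simp add: mk_def)

lemma mk_cases: obtains u v where "p = mk d u v"
  by (cases p, cases d) (auto simp: mk_def)

lemma mk_affine: "(1 - t) *\<^sub>R mk d u v + t *\<^sub>R mk d u' v' = mk d ((1 - t) * u + t * u') ((1 - t) * v + t * v')"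
  by (simp add: mk_def)

lemma closed_segment_mk:
  assumes "u \<le> u'" shows "closed_segment (mk d u v) (mk d u' v) = (\<lambda>x. mk d x v) ` {u..u'}"
proof -
  have "closed_segment (mk d u v) (mk d u' v) = (\<lambda>x. mk d x v) ` closed_segment u u'"
    unfolding closed_segment_def setcompr_eq_image image_image mk_affine by (simp add: algebra_simps)
  then show ?thesis using assms by (simp add: closed_segment_eq_real_ivl)
qed

lemma frontier_region: "frontier (region c) = region c - interior (region c)"
  by (simp add: region_def frontier_def closure_cbox)

lemma mem_region: "mk d u v \<in> region (mk d a b, mk d a' b') \<longleftrightarrow> a \<le> u \<and> u \<le> a' \<and> b \<le> v \<and> v \<le> b'"
  by (auto simp: region_def mk_def cbox_Pair_eq)

lemma mem_interior_region: "mk d u v \<in> interior (region (mk d a b, mk d a' b')) \<longleftrightarrow> a < u \<and> u < a' \<and> b < v \<and> v < b'"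
  by (cases d) (auto simp: region_def mk_def cbox_Pair_eq interior_Times interior_atLeastAtMost_real simp del: interior_cbox)

lemma mem_frontier_region:
  "mk d u v \<in> frontier (region (mk d a b, mk d a' b')) \<longleftrightarrow>
     a \<le> u \<and> u \<le> a' \<and> b \<le> v \<and> v \<le> b' \<and> (u = a \<or> u = a' \<or> v = b \<or> v = b')"
  unfolding frontier_region by (auto simp: mem_region mem_interior_region)

lemma corners_mk: "corners (mk d a b, mk d a' b') = {mk d a b, mk d a' b, mk d a b', mk d a' b'}"
  by (auto simp: mk_def)

text \<open>\<open>y'\<close> is a unit square on one of the two sides of line \<open>y\<close>,
  which is then a lower or an upper side of the box of width \<open>s\<close> around that
  square.\<close>

lemma multiple_of_pred:
  fixes s :: nat
  assumes "s dvd y" "0 < s" "y' = y \<or> y' = y - 1 \<and> 0 < y"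
  shows "y = s * (y' div s) \<or> y = s * (y' div s) + s"
proof -
  obtain z where z: "y = s * z" using assms(1) by blast
  show ?thesis
  proof (cases "y' = y")
    case False
    then obtain x where x: "z = Suc x" using assms(3) z by (cases z) auto
    have "y' div s = x" using False assms(2,3) by (intro div_nat_eqI) (auto simp: z x algebra_simps)
    then show ?thesis by (simp add: z x)
  qed (use assms in simp)
qed

context hmesh
begin

section \<open>Cells, grid and vertices in integer coordinates\<close>

definition pt :: "bool \<Rightarrow> nat \<Rightarrow> nat \<Rightarrow> real \<times> real" where "pt d i q = mk d (C d i) (C (\<not> d) q)"

definition seg :: "bool \<Rightarrow> nat \<Rightarrow> nat \<Rightarrow> nat \<Rightarrow> (real \<times> real) set" where
  "seg d q a b = (\<lambda>u. mk d u (C (\<not> d) q)) ` {C d a..C d b}"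

definition lo :: "bool \<Rightarrow> nat \<Rightarrow> nat \<Rightarrow> nat" where "lo d i q = w (lv d i q) * (i div w (lv d i q))"

definition cell :: "bool \<Rightarrow> nat \<Rightarrow> nat \<Rightarrow> cell" where
  "cell d i q = (mk d (C d (lo d i q)) (C (\<not> d) (lo (\<not> d) q i)),
     mk d (C d (lo d i q + w (lv d i q))) (C (\<not> d) (lo (\<not> d) q i + w (lv d i q))))"

text \<open>Every cell arises from each of the unit squares it contains.\<close>

definition M :: "cell set" where "M = {cell True i j | i j. i < N True \<and> j < N False}"

lemma pt_swap: "pt (\<not> d) i q = pt d q i" by (simp add: pt_def mk_swap)

lemma cell_swap: "cell (\<not> d) i q = cell d q i" by (simp add: cell_def mk_swap lv_swap)

lemma M_iff: "c \<in> M \<longleftrightarrow> (\<exists>i q. i < N d \<and> q < N (\<not> d) \<and> c = cell d i q)"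
proof (cases d)
  case False
  then show ?thesis using cell_swap[of False] unfolding M_def by auto
qed (auto simp: M_def)

lemma C_less_iff: "i \<le> N d \<Longrightarrow> j \<le> N d \<Longrightarrow> C d i < C d j \<longleftrightarrow> i < j"
  by (meson C_le C_less leD linorder_not_le)

lemma C_le_iff: "i \<le> N d \<Longrightarrow> j \<le> N d \<Longrightarrow> C d i \<le> C d j \<longleftrightarrow> i \<le> j"
  by (meson C_le C_less leD linorder_not_le)

lemma locate:
  assumes "a < b" "b \<le> N d" "C d a \<le> u" "u \<le> C d b"
  shows "\<exists>i. a \<le> i \<and> i < b \<and> C d i \<le> u \<and> u \<le> C d (Suc i)"
  using assms
proof (induction b)
  case (Suc b)
  show ?case
  proof (cases "C d b \<le> u")
    case True
    then show ?thesis using Suc.prems by (intro exI[of _ b]) auto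
  next
    case False
    then have "a < b" using Suc.prems by (metis less_antisym)
    then show ?thesis using Suc.IH Suc.prems False by auto
  qed
qed simp

lemma pt_in_seg: "a \<le> b \<Longrightarrow> b \<le> N d \<Longrightarrow> i \<le> N d \<Longrightarrow> p \<le> N (\<not> d) \<Longrightarrow> q \<le> N (\<not> d) \<Longrightarrow>
    pt d i p \<in> seg d q a b \<longleftrightarrow> p = q \<and> a \<le> i \<and> i \<le> b"
  by (auto simp: pt_def seg_def C_eq_iff C_le_iff image_iff)

lemma w_dvd_N: "w k dvd N d" using llev_le_iff[of "N d" k] by simp

lemma lo_bounds:
  assumes "i < N d" shows "lo d i q \<le> i" "i < lo d i q + w (lv d i q)" "lo d i q + w (lv d i q) \<le> N d"
proof -
  let ?s = "w (lv d i q)"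
  have e: "lo d i q + i mod ?s = i" by (simp add: lo_def)
  show "lo d i q \<le> i" using e by linarith
  show 1: "i < lo d i q + ?s" using e mod_less_divisor[OF w_pos, of i "lv d i q"] by linarith
  obtain z where z: "N d = ?s * z" using w_dvd_N by blast
  have "?s * (i div ?s) < ?s * z" using assms e z unfolding lo_def by linarith
  then have "?s * (i div ?s + 1) \<le> ?s * z" by (intro mult_le_mono2) simp
  then show "lo d i q + ?s \<le> N d" by (simp add: lo_def z)
qed

text \<open>Box invariance at the level \<open>l\<close> of the cell excludes higher levels in the
  cell, and at \<open>l - 1\<close> it excludes lower ones.\<close>

lemma lv_same_cell:
  assumes "i' div w (lv d i q) = i div w (lv d i q)" "q' div w (lv d i q) = q div w (lv d i q)"
  shows "lv d i' q' = lv d i q"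
proof -
  define l where "l = lv d i q"
  have 1: "\<not> l < lv d i' q'" using lv_box[of i' l i q' q d] assms by (simp add: l_def)
  have "l \<le> lv d i' q'"
  proof (cases l)
    case (Suc k)
    have "w k = w l * 2" using Suc lv_le[of d i q] w_Suc[of k] by (simp add: l_def)
    then have "i' div w k = i div w k" "q' div w k = q div w k"
      using assms by (simp_all add: div_mult2_eq l_def)
    then have "k < lv d i' q' \<longleftrightarrow> k < lv d i q" by (rule lv_box)
    then show ?thesis using Suc by (simp add: l_def)
  qed simp
  then show ?thesis using 1 by (simp add: l_def)
qed

lemma lo_div:
  assumes "lo d i q \<le> i'" "i' < lo d i q + w (lv d i q)"
  shows "i' div w (lv d i q) = i div w (lv d i q)"
  using assms by (intro div_nat_eqI) (auto simp: lo_def algebra_simps)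

lemma lv_in_cell:
  assumes "lo d i q \<le> i'" "i' < lo d i q + w (lv d i q)"
    "lo (\<not> d) q i \<le> q'" "q' < lo (\<not> d) q i + w (lv d i q)"
  shows "lv d i' q' = lv d i q"
  using lo_div[OF assms(1,2)] lo_div[of "\<not> d" q i q'] assms(3,4) by (intro lv_same_cell) (auto simp: lv_swap)

lemma U_cell_side:
  assumes "i < N d" "q < N (\<not> d)" "lo d i q \<le> i'" "i' < lo d i q + w (lv d i q)"
    "p = lo (\<not> d) q i \<or> p = lo (\<not> d) q i + w (lv d i q)"
  shows "U d i' p"
proof -
  have "w (lv d i q) dvd p" using assms(5) by (auto simp: lo_def lv_swap)
  then have le: "llev p \<le> lv d i q" by (simp add: llev_le_iff)
  note q = lo_bounds[OF assms(2), of i, unfolded lv_swap]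
  show ?thesis
    using assms(5)
  proof
    assume p: "p = lo (\<not> d) q i"
    have "lv d i' p = lv d i q" by (rule lv_in_cell) (use assms q p in auto)
    then show ?thesis using le by (simp add: U_def)
  next
    assume p: "p = lo (\<not> d) q i + w (lv d i q)"
    \<comment> \<open>The square behind the upper side may belong to another cell, so the last
      square inside is used, through \<open>U_pred\<close>.\<close>
    have "0 < w (lv d i q)" by simp
    then have "lv d i' (p - 1) = lv d i q" by (intro lv_in_cell) (use assms q p in linarith)+
    then show ?thesis using le by (simp add: U_pred[of d i' p])
  qed
qed

lemma grid_iff: "p \<in> grid M \<longleftrightarrow> (\<exists>d i q. i < N d \<and> q \<le> N (\<not> d) \<and> U d i q \<and> p \<in> seg d q i (Suc i))"
proof
  assume "p \<in> grid M"
  then obtain c where c: "c \<in> M" "p \<in> frontier (region c)" by (auto simp: grid_def)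
  have side: "\<exists>i q. i < N d \<and> q \<le> N (\<not> d) \<and> U d i q \<and> p \<in> seg d q i (Suc i)"
    if p: "p = mk d u v" and i: "i < N d" "q < N (\<not> d)" "c = cell d i q"
      and v: "v = C (\<not> d) (lo (\<not> d) q i) \<or> v = C (\<not> d) (lo (\<not> d) q i + w (lv d i q))" for d u v i q
  proof -
    have u: "C d (lo d i q) \<le> u" "u \<le> C d (lo d i q + w (lv d i q))"
      using c(2) unfolding p i(3) cell_def by (simp_all add: mem_frontier_region)
    obtain r where r: "r = lo (\<not> d) q i \<or> r = lo (\<not> d) q i + w (lv d i q)" "v = C (\<not> d) r" using v by blast
    note b = lo_bounds[OF i(1), of q] and b' = lo_bounds[OF i(2), of i, unfolded lv_swap]
    obtain i' where i': "lo d i q \<le> i'" "i' < lo d i q + w (lv d i q)" "C d i' \<le> u" "u \<le> C d (Suc i')"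
      using locate[OF _ b(3) u] by auto
    have "U d i' r" by (rule U_cell_side[OF i(1,2) i'(1,2) r(1)])
    moreover have "i' < N d" "r \<le> N (\<not> d)" using i' b b' r(1) by auto
    moreover have "p \<in> seg d r i' (Suc i')" using i' r(2) p by (simp add: seg_def)
    ultimately show ?thesis by blast
  qed
  obtain i j where ij: "i < N True" "j < N False" "c = cell True i j" using c(1) by (auto simp: M_def)
  have c': "c = cell False j i" using ij(3) cell_swap[of True j i] by simp
  obtain u v where p: "p = mk True u v" by (rule mk_cases)
  then have p': "p = mk False v u" using mk_swap[of True v u] by simp
  have "v = C False (lo False j i) \<or> v = C False (lo False j i + w (lv True i j)) \<or>
      u = C True (lo True i j) \<or> u = C True (lo True i j + w (lv False j i))"
    using c(2) unfolding p ij(3) cell_def mem_frontier_region lv_swap[of True j i, simplified] by auto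
  then consider "v = C False (lo False j i) \<or> v = C False (lo False j i + w (lv True i j))"
    | "u = C True (lo True i j) \<or> u = C True (lo True i j + w (lv False j i))" by blast
  then show "\<exists>d i q. i < N d \<and> q \<le> N (\<not> d) \<and> U d i q \<and> p \<in> seg d q i (Suc i)"
  proof cases
    case 1
    then show ?thesis by (intro exI[of _ True]) (use side[OF p, of i j] ij in auto)
  next
    case 2
    then show ?thesis by (intro exI[of _ False]) (use side[OF p', of j i] ij c' in auto)
  qed
next
  assume "\<exists>d i q. i < N d \<and> q \<le> N (\<not> d) \<and> U d i q \<and> p \<in> seg d q i (Suc i)"
  then obtain d i q u where *: "i < N d" "q \<le> N (\<not> d)" "U d i q" "p = mk d u (C (\<not> d) q)" "C d i \<le> u" "u \<le> C d (Suc i)"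
    by (auto simp: seg_def)
  \<comment> \<open>\<open>r\<close> is the row of a unit square whose cell has the edge on its
    frontier; at the upper boundary line only the row before the line exists.\<close>
  obtain r where r: "r < N (\<not> d)" "w (lv d i r) dvd q" "r = q \<or> r = q - 1 \<and> 0 < q"
  proof (cases "q < N (\<not> d)")
    case True
    then show ?thesis using that[of q] *(3) by (auto simp: U_def llev_le_iff)
  next
    case False
    then show ?thesis using that[of "q - 1"] *(2,3) N_pos[of "\<not> d"] by (auto simp: w_dvd_N)
  qed
  note b = lo_bounds[OF *(1), of r] and b' = lo_bounds[OF r(1), of i, unfolded lv_swap]
  let ?s = "w (lv d i r)"
  have "q = lo (\<not> d) r i \<or> q = lo (\<not> d) r i + ?s"
    using multiple_of_pred[OF r(2) _ r(3)] by (simp add: lo_def lv_swap)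
  moreover have "C d (lo d i r) \<le> u" "u \<le> C d (lo d i r + ?s)"
    using C_le[of "lo d i r" i d] C_le[of "Suc i" "lo d i r + ?s" d] b * by auto
  moreover have "C (\<not> d) (lo (\<not> d) r i) \<le> C (\<not> d) (lo (\<not> d) r i + ?s)" using b' by (intro C_le) auto
  ultimately have "p \<in> frontier (region (cell d i r))"
    unfolding *(4) cell_def mem_frontier_region by auto
  then show "p \<in> grid M" using *(1) r(1) M_iff[of _ d] unfolding grid_def by blast
qed

text \<open>Strictly between neighbouring grid lines a point is on no transversal unit edge, and on
  no parallel one but its own.\<close>

lemma grid_unit:
  assumes "mk d u (C (\<not> d) q) \<in> grid M" "C d i < u" "u < C d (Suc i)" "i < N d" "q \<le> N (\<not> d)"
  shows "U d i q"
proof -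
  obtain d' i' q' where *: "i' < N d'" "q' \<le> N (\<not> d')" "U d' i' q'" "mk d u (C (\<not> d) q) \<in> seg d' q' i' (Suc i')"
    using assms(1) grid_iff by auto
  show ?thesis
  proof (cases "d' = d")
    case True
    then have "C (\<not> d) q = C (\<not> d) q'" "C d i' \<le> u" "u \<le> C d (Suc i')" using * by (auto simp: seg_def)
    moreover from this have "C d i' < C d (Suc i)" "C d i < C d (Suc i')" using assms by linarith+
    then have "i' < Suc i" "i < Suc i'" using * assms True by (simp_all add: C_less_iff)
    then have "i' = i" by simp
    ultimately show ?thesis using * assms(5) True by (simp add: C_eq_iff)
  next
    case False
    then have d': "d' = (\<not> d)" by auto
    then have "u = C d q'" using *(4) by (auto simp: seg_def mk_swap)
    then have "i < q'" "q' < Suc i" using assms * d' by (simp_all add: C_less_iff)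
    then show ?thesis by simp
  qed
qed

lemma vertices_iff: "p \<in> vertices M \<longleftrightarrow> (\<exists>i q. i \<le> N d \<and> q \<le> N (\<not> d) \<and> vtx d i q \<and> p = pt d i q)"
proof -
  have inc: "inc d x y" if "i < N d" "q < N (\<not> d)" "x = lo d i q \<or> x = lo d i q + w (lv d i q)"
     "y = lo (\<not> d) q i \<or> y = lo (\<not> d) q i + w (lv d i q)" for d i q x y
  proof -
    note b = lo_bounds[OF that(1), of q]
    show ?thesis using that(3)
    proof
      assume "x = lo d i q"
      then show ?thesis using U_cell_side[OF that(1,2) _ _ that(4), of x] b by (auto simp: inc_def)
    next
      assume "x = lo d i q + w (lv d i q)"
      then show ?thesis using U_cell_side[OF that(1,2) _ _ that(4), of "x - 1"] b by (auto simp: inc_def)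
    qed
  qed
  show ?thesis
  proof
    assume "p \<in> vertices M"
    then obtain c where "c \<in> M" "p \<in> corners c" by (auto simp: vertices_def)
    then obtain i q where iq: "i < N d" "q < N (\<not> d)" "p \<in> corners (cell d i q)" using M_iff[of c d] by auto
    obtain x y where xy: "x = lo d i q \<or> x = lo d i q + w (lv d i q)" "y = lo (\<not> d) q i \<or> y = lo (\<not> d) q i + w (lv d i q)"
       "p = pt d x y"
      using iq(3) unfolding cell_def corners_mk pt_def by blast
    have "vtx d x y" unfolding vtx_def
      using inc[OF iq(1,2) xy(1,2)] inc[of q "\<not> d" i y x] iq xy by (simp add: lv_swap)
    moreover have "x \<le> N d" "y \<le> N (\<not> d)"
      using lo_bounds[OF iq(1), of q] lo_bounds[OF iq(2), of i, unfolded lv_swap] xy by auto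
    ultimately show "\<exists>i q. i \<le> N d \<and> q \<le> N (\<not> d) \<and> vtx d i q \<and> p = pt d i q" using xy by blast
  next
    assume "\<exists>i q. i \<le> N d \<and> q \<le> N (\<not> d) \<and> vtx d i q \<and> p = pt d i q"
    then obtain i q where iq: "i \<le> N d" "q \<le> N (\<not> d)" "vtx d i q" "p = pt d i q" by blast
    \<comment> \<open>The square \<open>(i', q')\<close> lies in a quadrant between two incident
      unit edges of different directions. Both lines have at most its level, so the point is a
      corner of its cell.\<close>
    obtain i' where i': "U d i' q" "i' < N d" "i' = i \<or> i' = i - 1 \<and> 0 < i"
    proof -
      have "inc d i q" using iq(3) by (simp add: vtx_def)
      then show ?thesis using that[of i] that[of "i - 1"] iq(1) by (auto simp: inc_def)
    qed
    obtain q' where q': "U (\<not> d) q' i" "q' < N (\<not> d)" "q' = q \<or> q' = q - 1 \<and> 0 < q"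
    proof -
      have "inc (\<not> d) q i" using iq(3) by (simp add: vtx_def)
      then show ?thesis using that[of q] that[of "q - 1"] iq(2) by (auto simp: inc_def)
    qed
    let ?s = "w (lv d i' q')"
    have "llev q \<le> lv d i' q'" using i'(1) q'(3) U_pred[of d i' q] by (auto simp: U_def)
    then have sq: "?s dvd q" by (simp add: llev_le_iff)
    have "llev i \<le> lv (\<not> d) q' i'" using q'(1) i'(3) U_pred[of "\<not> d" q' i] by (auto simp: U_def)
    then have si: "?s dvd i" by (simp add: llev_le_iff lv_swap)
    have "i = lo d i' q' \<or> i = lo d i' q' + ?s" using multiple_of_pred[OF si _ i'(3)] by (simp add: lo_def)
    moreover have "q = lo (\<not> d) q' i' \<or> q = lo (\<not> d) q' i' + ?s" using multiple_of_pred[OF sq _ q'(3)] by (simp add: lo_def lv_swap)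
    ultimately have "p \<in> corners (cell d i' q')"
      unfolding iq(4) pt_def cell_def corners_mk by blast
    then show "p \<in> vertices M" using M_iff[of _ d] i'(2) q'(2) unfolding vertices_def by blast
  qed
qed

lemma pt_vertex: "i \<le> N d \<Longrightarrow> q \<le> N (\<not> d) \<Longrightarrow> pt d i q \<in> vertices M \<longleftrightarrow> vtx d i q"
  using vertices_iff[of "pt d i q" d] by (auto simp: pt_def C_eq_iff)

lemma domain_M: "domain M = region (mk d (C d 0) (C (\<not> d) 0), mk d (C d (N d)) (C (\<not> d) (N (\<not> d))))"
proof (intro equalityI subsetI)
  fix p assume "p \<in> domain M"
  then obtain c where "c \<in> M" "p \<in> region c" by (auto simp: domain_def)
  then obtain i q where iq: "i < N d" "q < N (\<not> d)" "p \<in> region (cell d i q)" using M_iff[of c d] by auto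
  obtain u v where p: "p = mk d u v" by (rule mk_cases)
  note b = lo_bounds[OF iq(1), of q] and b' = lo_bounds[OF iq(2), of i, unfolded lv_swap]
  have "C d (lo d i q) \<le> u" "u \<le> C d (lo d i q + w (lv d i q))"
    "C (\<not> d) (lo (\<not> d) q i) \<le> v" "v \<le> C (\<not> d) (lo (\<not> d) q i + w (lv d i q))"
    using iq(3) by (simp_all add: p cell_def mem_region)
  moreover have "C d 0 \<le> C d (lo d i q)" "C d (lo d i q + w (lv d i q)) \<le> C d (N d)"
    "C (\<not> d) 0 \<le> C (\<not> d) (lo (\<not> d) q i)" "C (\<not> d) (lo (\<not> d) q i + w (lv d i q)) \<le> C (\<not> d) (N (\<not> d))"
    using b b' by (auto intro: C_le)
  ultimately show "p \<in> region (mk d (C d 0) (C (\<not> d) 0), mk d (C d (N d)) (C (\<not> d) (N (\<not> d))))"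
    unfolding p mem_region by linarith
next
  fix p assume a: "p \<in> region (mk d (C d 0) (C (\<not> d) 0), mk d (C d (N d)) (C (\<not> d) (N (\<not> d))))"
  obtain u v where p: "p = mk d u v" by (rule mk_cases)
  obtain i where i: "i < N d" "C d i \<le> u" "u \<le> C d (Suc i)"
    using locate[of 0 "N d" d u] N_pos a by (auto simp: p mem_region)
  obtain q where q: "q < N (\<not> d)" "C (\<not> d) q \<le> v" "v \<le> C (\<not> d) (Suc q)"
    using locate[of 0 "N (\<not> d)" "\<not> d" v] N_pos a by (auto simp: p mem_region)
  note b = lo_bounds[OF i(1), of q] and b' = lo_bounds[OF q(1), of i, unfolded lv_swap]
  have "C d (lo d i q) \<le> C d i" "C d (Suc i) \<le> C d (lo d i q + w (lv d i q))"
    "C (\<not> d) (lo (\<not> d) q i) \<le> C (\<not> d) q" "C (\<not> d) (Suc q) \<le> C (\<not> d) (lo (\<not> d) q i + w (lv d i q))"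
    using b b' by (auto intro: C_le)
  then have "p \<in> region (cell d i q)" using i q unfolding p cell_def mem_region by linarith
  then show "p \<in> domain M" using M_iff[of _ d] i q unfolding domain_def by blast
qed

lemma frontier_domain_iff:
  "mk d u v \<in> frontier (domain M) \<longleftrightarrow> C d 0 \<le> u \<and> u \<le> C d (N d) \<and> C (\<not> d) 0 \<le> v \<and> v \<le> C (\<not> d) (N (\<not> d)) \<and>
     (u = C d 0 \<or> u = C d (N d) \<or> v = C (\<not> d) 0 \<or> v = C (\<not> d) (N (\<not> d)))"
  unfolding domain_M[of d] mem_frontier_region ..

lemma pt_frontier: "i \<le> N d \<Longrightarrow> q \<le> N (\<not> d) \<Longrightarrow>
  pt d i q \<in> frontier (domain M) \<longleftrightarrow> i = 0 \<or> i = N d \<or> q = 0 \<or> q = N (\<not> d)"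
  unfolding pt_def frontier_domain_iff by (auto simp: C_eq_iff C_le)


section \<open>Segments, edges and valence\<close>

lemma seg_subset:
  assumes "seg d q a b \<subseteq> seg d' q' a' b'" "a < b" "b \<le> N d" "q \<le> N (\<not> d)" "a' < b'" "b' \<le> N d'" "q' \<le> N (\<not> d')"
  shows "d' = d \<and> q' = q \<and> a' \<le> a \<and> b \<le> b'"
proof -
  have m: "pt d a q \<in> seg d' q' a' b'" "pt d b q \<in> seg d' q' a' b'"
    using assms(1) pt_in_seg[of a b d a q q] pt_in_seg[of a b d b q q] assms by auto
  show ?thesis
  proof (cases "d' = d")
    case True
    then show ?thesis using m assms pt_in_seg[of a' b' d a q q'] pt_in_seg[of a' b' d b q q'] by auto
  next
    case False
    then have d': "d' = (\<not> d)" by auto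
    have "pt d' q a \<in> seg d' q' a' b'" "pt d' q b \<in> seg d' q' a' b'" using m pt_swap[of d] unfolding d' by auto
    then show ?thesis using pt_in_seg[of a' b' d' q a q'] pt_in_seg[of a' b' d' q b q'] assms d' by auto
  qed
qed

lemma seg_eq:
  assumes "seg d q a b = seg d' q' a' b'" "a < b" "b \<le> N d" "q \<le> N (\<not> d)" "a' < b'" "b' \<le> N d'" "q' \<le> N (\<not> d')"
  shows "d' = d \<and> q' = q \<and> a' = a \<and> b' = b"
  using seg_subset[of d q a b d' q' a' b'] seg_subset[of d' q' a' b' d q a b] assms by auto

lemma closed_segment_pt: "a \<le> b \<Longrightarrow> b \<le> N d \<Longrightarrow> closed_segment (pt d a q) (pt d b q) = seg d q a b"
  unfolding pt_def seg_def by (rule closed_segment_mk) (rule C_le)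

lemma seg_unit_mid:
  assumes "a \<le> i" "i < b" "b \<le> N d"
  shows "mk d ((C d i + C d (Suc i)) / 2) (C (\<not> d) q) \<in> seg d q a b"
    "C d i < (C d i + C d (Suc i)) / 2" "(C d i + C d (Suc i)) / 2 < C d (Suc i)"
proof -
  show 1: "C d i < (C d i + C d (Suc i)) / 2" "(C d i + C d (Suc i)) / 2 < C d (Suc i)"
    using C_less[of i "Suc i" d] assms by auto
  show "mk d ((C d i + C d (Suc i)) / 2) (C (\<not> d) q) \<in> seg d q a b"
    using 1 C_le[of a i d] C_le[of "Suc i" b d] assms by (auto simp: seg_def)
qed

lemma seg_grid_iff:
  assumes "a < b" "b \<le> N d" "q \<le> N (\<not> d)"
  shows "seg d q a b \<subseteq> grid M \<longleftrightarrow> (\<forall>i. a \<le> i \<and> i < b \<longrightarrow> U d i q)"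
proof
  assume "seg d q a b \<subseteq> grid M"
  then show "\<forall>i. a \<le> i \<and> i < b \<longrightarrow> U d i q"
    using seg_unit_mid(1)[of a _ b d q] seg_unit_mid(2,3)[of a _ b d] assms
    by (intro allI impI grid_unit) auto
next
  assume *: "\<forall>i. a \<le> i \<and> i < b \<longrightarrow> U d i q"
  show "seg d q a b \<subseteq> grid M"
  proof
    fix p assume "p \<in> seg d q a b"
    then obtain u where u: "p = mk d u (C (\<not> d) q)" "C d a \<le> u" "u \<le> C d b" by (auto simp: seg_def)
    then obtain i where i: "a \<le> i" "i < b" "C d i \<le> u" "u \<le> C d (Suc i)" using locate[of a b d u] assms by auto
    then have "i < N d" "U d i q" "p \<in> seg d q i (Suc i)" using * u assms by (auto simp: seg_def)
    then show "p \<in> grid M" using grid_iff assms(3) by blast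
  qed
qed

definition edg :: "bool \<Rightarrow> nat \<Rightarrow> nat \<Rightarrow> nat \<Rightarrow> bool" where
  "edg d q a b \<longleftrightarrow> a < b \<and> b \<le> N d \<and> q \<le> N (\<not> d) \<and> vtx d a q \<and> vtx d b q \<and>
     (\<forall>i. a \<le> i \<and> i < b \<longrightarrow> U d i q) \<and> (\<forall>i. a < i \<and> i < b \<longrightarrow> \<not> vtx d i q)"

lemma edges_iff: "e \<in> edges M \<longleftrightarrow> (\<exists>d q a b. edg d q a b \<and> e = seg d q a b)"
proof
  assume "e \<in> edges M"
  then obtain p p' where pp: "e = closed_segment p p'" "p \<in> vertices M" "p' \<in> vertices M" "p \<noteq> p'"
    "fst p = fst p' \<or> snd p = snd p'" "closed_segment p p' \<subseteq> grid M" "open_segment p p' \<inter> vertices M = {}"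
    unfolding edges_def by blast
  have main: "\<exists>q a b. edg d q a b \<and> closed_segment r r' = seg d q a b"
    if rr: "r \<in> vertices M" "r' \<in> vertices M" "closed_segment r r' \<subseteq> grid M" "open_segment r r' \<inter> vertices M = {}"
      "r = mk d u v" "r' = mk d u' v" "u < u'" for d r r' u u' v
  proof -
    obtain a q where a: "a \<le> N d" "q \<le> N (\<not> d)" "vtx d a q" "r = pt d a q" using rr(1) vertices_iff[of r d] by auto
    obtain b q' where b: "b \<le> N d" "q' \<le> N (\<not> d)" "vtx d b q'" "r' = pt d b q'" using rr(2) vertices_iff[of r' d] by auto
    have q': "q' = q" using a b rr(5,6) by (simp add: pt_def C_eq_iff)
    have ab: "a < b" using a b rr(5-7) by (simp add: pt_def C_less_iff)
    have cs: "closed_segment r r' = seg d q a b" unfolding a(4) b(4) q' using ab b by (intro closed_segment_pt) auto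
    have "\<not> vtx d i q" if "a < i" "i < b" for i
    proof -
      have "pt d i q \<in> open_segment r r'"
        unfolding open_segment_def cs using that a b q' by (auto simp: pt_in_seg) (auto simp: pt_def C_eq_iff)
      then show ?thesis using rr(4) pt_vertex[of i d q] that a b by auto
    qed
    then have "edg d q a b" unfolding edg_def
      using ab a b q' seg_grid_iff[OF ab b(1) a(2)] cs rr(3) by auto
    then show ?thesis using cs by blast
  qed
  have *: "\<exists>d q a b. edg d q a b \<and> e = seg d q a b" if "p = mk d u v" "p' = mk d u' v" for d u u' v
  proof (cases "u < u'")
    case True
    then show ?thesis using main[OF pp(2,3,6,7) that] pp(1) by blast
  next
    case False
    then have "u' < u" using pp(4) that by auto
    then show ?thesis using main[OF pp(3,2) _ _ that(2,1)] pp(1,6,7)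
      by (metis closed_segment_commute open_segment_commute)
  qed
  show "\<exists>d q a b. edg d q a b \<and> e = seg d q a b"
    using pp(5)
  proof
    assume "fst p = fst p'"
    then show ?thesis by (intro *[of False "snd p" "fst p" "snd p'"]) (auto simp: mk_def prod_eq_iff)
  next
    assume "snd p = snd p'"
    then show ?thesis by (intro *[of True "fst p" "snd p" "fst p'"]) (auto simp: mk_def prod_eq_iff)
  qed
next
  assume "\<exists>d q a b. edg d q a b \<and> e = seg d q a b"
  then obtain d q a b where e: "edg d q a b" "e = seg d q a b" by blast
  note E = e(1)[unfolded edg_def]
  have cs: "closed_segment (pt d a q) (pt d b q) = seg d q a b" using E by (intro closed_segment_pt) auto
  have "open_segment (pt d a q) (pt d b q) \<inter> vertices M = {}"
  proof (rule ccontr)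
    assume "open_segment (pt d a q) (pt d b q) \<inter> vertices M \<noteq> {}"
    then obtain p where p: "p \<in> seg d q a b" "p \<noteq> pt d a q" "p \<noteq> pt d b q" "p \<in> vertices M"
      unfolding open_segment_def cs by auto
    obtain i r where ir: "i \<le> N d" "r \<le> N (\<not> d)" "vtx d i r" "p = pt d i r" using p(4) vertices_iff[of p d] by auto
    then have r: "r = q" "a \<le> i" "i \<le> b" using p(1) E pt_in_seg[of a b d i r q] by auto
    then have "i \<noteq> a" "i \<noteq> b" using p ir by auto
    then have "a < i" "i < b" using r by auto
    then show False using E ir r by blast
  qed
  moreover have "pt d a q \<noteq> pt d b q" using E by (simp add: pt_def C_eq_iff)
  moreover have "fst (pt d a q) = fst (pt d b q) \<or> snd (pt d a q) = snd (pt d b q)" by (simp add: pt_def mk_def)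
  moreover have "pt d a q \<in> vertices M" "pt d b q \<in> vertices M" using E by (auto simp: pt_vertex)
  moreover have "closed_segment (pt d a q) (pt d b q) \<subseteq> grid M" unfolding cs using E by (subst seg_grid_iff) auto
  ultimately show "e \<in> edges M" unfolding edges_def e(2) cs[symmetric] by blast
qed

lemma edg_between:
  assumes ab: "b \<le> N d" "q \<le> N (\<not> d)" "vtx d a q" "vtx d b q" "\<And>i. a \<le> i \<Longrightarrow> i < b \<Longrightarrow> U d i q" and i: "a \<le> i" "i < b"
  shows "\<exists>a' b'. edg d q a' b' \<and> a \<le> a' \<and> a' \<le> i \<and> i < b' \<and> b' \<le> b"
proof -
  define b' where "b' = (LEAST x. i < x \<and> vtx d x q)"
  have b': "i < b'" "vtx d b' q" unfolding b'_def using LeastI[of "\<lambda>x. i < x \<and> vtx d x q" b] i ab by auto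
  have "b' \<le> b" unfolding b'_def using i ab by (intro Least_le) auto
  have b'_min: "\<not> vtx d x q" if "i < x" "x < b'" for x using not_less_Least that unfolding b'_def by blast
  define a' where "a' = Max {x. x \<le> i \<and> vtx d x q}"
  have fin: "finite {x. x \<le> i \<and> vtx d x q}" by simp
  have "a' \<in> {x. x \<le> i \<and> vtx d x q}" unfolding a'_def using fin i ab by (intro Max_in) auto
  moreover have "a \<le> a'" unfolding a'_def using fin i ab by (intro Max_ge) auto
  moreover have "\<not> vtx d x q" if "a' < x" "x \<le> i" for x
  proof
    assume "vtx d x q"
    then have "x \<le> a'" unfolding a'_def using fin that by (intro Max_ge) auto
    then show False using that by simp
  qed
  ultimately show ?thesis using b' b'_min \<open>b' \<le> b\<close> ab i
    unfolding edg_def by (intro exI[of _ a'] exI[of _ b']) (auto, meson linorder_not_le)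
qed

lemma edg_right:
  assumes "U d i q" "i < N d" "0 < q" "q < N (\<not> d)" "vtx d i q"
  shows "\<exists>b. edg d q i b"
proof -
  obtain a b where ab: "(d, q, a, b) \<in> L" "a \<le> i" "i < b" using L_exists assms by blast
  note D = L_D[OF ab(1)] and V = L_end_vtx[OF ab(1)]
  obtain a' b' where "edg d q a' b'" "a' \<le> i" "i < b'" "b' \<le> b"
    using edg_between[of b d q i i] D V ab assms by auto
  moreover from this have "a' = i" using assms(5) by (auto simp: edg_def le_less)
  ultimately show ?thesis by blast
qed

lemma edg_left:
  assumes "U d (i - 1) q" "0 < i" "i \<le> N d" "0 < q" "q < N (\<not> d)" "vtx d i q"
  shows "\<exists>a. edg d q a i"
proof -
  have "i - 1 < N d" using assms by auto
  then obtain a b where ab: "(d, q, a, b) \<in> L" "a \<le> i - 1" "i - 1 < b" using L_exists assms by blast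
  note D = L_D[OF ab(1)] and V = L_end_vtx[OF ab(1)]
  obtain a' b' where "edg d q a' b'" "a \<le> a'" "a' \<le> i - 1" "i - 1 < b'" "b' \<le> i"
    using edg_between[of i d q a "i - 1"] D V ab assms by auto
  moreover from this have "b' = i" using assms(2) by auto
  ultimately show ?thesis by blast
qed

text \<open>Every unit edge at the vertex continues to exactly one edge ending there.
  \<open>S\<close> collects the pairs of a direction and a side (\<open>True\<close> for ahead) in
  which a unit edge is present, so the valence is \<open>card S\<close>.\<close>

lemma valence_4_iff:
  assumes ij: "0 < i" "i < N True" "0 < j" "j < N False" and v: "vtx True i j"
  shows "valence M (pt True i j) = 4 \<longleftrightarrow> U True (i - 1) j \<and> U True i j \<and> U False (j - 1) i \<and> U False j i"
proof -
  define x where "x d = (if d then i else j)" for d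
  have x: "0 < x d" "x d < N d" for d using ij by (auto simp: x_def)
  have vx: "vtx d (x d) (x (\<not> d))" for d using v vtx_swap[of True] by (cases d) (auto simp: x_def)
  have p: "pt True i j = pt d (x d) (x (\<not> d))" for d using pt_swap[of True] by (cases d) (auto simp: x_def)
  define S where "S = {(d, s). U d (if s then x d else x d - 1) (x (\<not> d))}"
  define rb where "rb d = (SOME b. edg d (x (\<not> d)) (x d) b)" for d
  define la where "la d = (SOME a. edg d (x (\<not> d)) a (x d))" for d
  define F where "F = (\<lambda>(d, s). seg d (x (\<not> d)) (if s then x d else la d) (if s then rb d else x d))"
  have R: "edg d (x (\<not> d)) (x d) (rb d)" if "(d, True) \<in> S" for d
  proof -
    have "\<exists>b. edg d (x (\<not> d)) (x d) b"
      by (rule edg_right) (use that x[of d] x[of "\<not> d"] vx[of d] in \<open>simp_all add: S_def\<close>)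
    then show ?thesis unfolding rb_def by (rule someI_ex)
  qed
  have Le: "edg d (x (\<not> d)) (la d) (x d)" if "(d, False) \<in> S" for d
  proof -
    have "\<exists>a. edg d (x (\<not> d)) a (x d)"
      by (rule edg_left) (use that x[of d] x[of "\<not> d"] vx[of d] in \<open>simp_all add: S_def\<close>)
    then show ?thesis unfolding la_def by (rule someI_ex)
  qed
  have F_in: "F (d, s) \<in> edges M \<and> pt True i j \<in> F (d, s)" if "(d, s) \<in> S" for d s
  proof (cases s)
    case True
    then have e: "edg d (x (\<not> d)) (x d) (rb d)" using R that by simp
    have Fe: "F (d, s) = seg d (x (\<not> d)) (x d) (rb d)" using True by (simp add: F_def)
    have "F (d, s) \<in> edges M" unfolding edges_iff Fe using e by blast
    moreover have "pt d (x d) (x (\<not> d)) \<in> F (d, s)"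
      unfolding Fe using e x[of "\<not> d"] x[of d] pt_in_seg[of "x d" "rb d" d "x d" "x (\<not> d)" "x (\<not> d)"]
      by (simp add: edg_def)
    ultimately show ?thesis using p[of d] by simp
  next
    case False
    then have e: "edg d (x (\<not> d)) (la d) (x d)" using Le that by simp
    have Fe: "F (d, s) = seg d (x (\<not> d)) (la d) (x d)" using False by (simp add: F_def)
    have "F (d, s) \<in> edges M" unfolding edges_iff Fe using e by blast
    moreover have "pt d (x d) (x (\<not> d)) \<in> F (d, s)"
      unfolding Fe using e x[of "\<not> d"] x[of d] pt_in_seg[of "la d" "x d" d "x d" "x (\<not> d)" "x (\<not> d)"]
      by (simp add: edg_def)
    ultimately show ?thesis using p[of d] by simp
  qed
  have inj: "inj_on F S"
  proof (rule inj_onI)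
    fix y y' assume y: "y \<in> S" "y' \<in> S" "F y = F y'"
    obtain d s d' s' where ds: "y = (d, s)" "y' = (d', s')" by (cases y, cases y')
    have E: "edg d (x (\<not> d)) (if s then x d else la d) (if s then rb d else x d)" if "(d, s) \<in> S" for d s
      using R[of d] Le[of d] that by (cases s) auto
    note E1 = E[OF y(1)[unfolded ds], unfolded edg_def] and E2 = E[OF y(2)[unfolded ds], unfolded edg_def]
    have "d' = d \<and> (if s' then x d' else la d') = (if s then x d else la d)"
      using seg_eq[OF y(3)[unfolded ds F_def split]] E1 E2 by blast
    moreover have "la d < x d" if "(d, False) \<in> S" using Le[OF that] by (simp add: edg_def)
    ultimately show "y = y'" using y ds by (cases s; cases s') auto
  qed
  have img: "F ` S = {e \<in> edges M. pt True i j \<in> e}"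
  proof (intro equalityI subsetI)
    fix e assume "e \<in> F ` S"
    then show "e \<in> {e \<in> edges M. pt True i j \<in> e}" using F_in by auto
  next
    fix e assume "e \<in> {e \<in> edges M. pt True i j \<in> e}"
    then obtain d q a b where e: "edg d q a b" "e = seg d q a b" "pt True i j \<in> e" unfolding edges_iff by auto
    note E = e(1)[unfolded edg_def]
    have m: "x (\<not> d) = q" "a \<le> x d" "x d \<le> b"
      using e(3) pt_in_seg[of a b d "x d" "x (\<not> d)" q] E x[of d] x[of "\<not> d"] unfolding e(2) p[of d] by auto
    have "x d = a \<or> x d = b" using E vx[of d] m by (metis le_neq_implies_less)
    then show "e \<in> F ` S"
    proof
      assume a: "x d = a"
      then have S: "(d, True) \<in> S" using E m by (auto simp: S_def)
      have "rb d = b"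
        using R[OF S] e(1) m a unfolding edg_def by (metis linorder_neqE_nat)
      then have "e = F (d, True)" using e a m by (simp add: F_def)
      then show ?thesis using S by blast
    next
      assume b: "x d = b"
      then have S: "(d, False) \<in> S" using E m by (auto simp: S_def)
      have "la d = a"
        using Le[OF S] e(1) m b unfolding edg_def by (metis linorder_neqE_nat)
      then have "e = F (d, False)" using e b m by (simp add: F_def)
      then show ?thesis using S by blast
    qed
  qed
  have "valence M (pt True i j) = card S" unfolding valence_def img[symmetric] using inj by (rule card_image)
  also have "card S = 4 \<longleftrightarrow> S = UNIV"
  proof -
    have "card (UNIV :: (bool \<times> bool) set) = 4" by simp
    then show ?thesis using card_subset_eq[of "UNIV :: (bool \<times> bool) set" S] by auto
  qed
  also have "S = UNIV \<longleftrightarrow> (\<forall>d s. U d (if s then x d else x d - 1) (x (\<not> d)))" by (auto simp: S_def)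
  also have "\<dots> \<longleftrightarrow> U True (i - 1) j \<and> U True i j \<and> U False (j - 1) i \<and> U False j i"
    by (simp add: all_bool_eq x_def) blast
  finally show ?thesis .
qed

lemma card_crossing_vertices: "card (crossing_vertices M) = card Vcross"
proof -
  have "crossing_vertices M = (\<lambda>(i, j). pt True i j) ` Vcross"
  proof (intro equalityI subsetI)
    fix p assume "p \<in> crossing_vertices M"
    then have p: "p \<in> vertices M" "p \<notin> frontier (domain M)" "valence M p = 4"
      by (auto simp: crossing_vertices_def interior_vertices_def)
    obtain i j where ij: "i \<le> N True" "j \<le> N False" "vtx True i j" "p = pt True i j" using p(1) vertices_iff[of p True] by auto
    then have "0 < i" "i < N True" "0 < j" "j < N False" using p(2) pt_frontier[of i True j] by auto
    then have "(i, j) \<in> Vcross" using valence_4_iff ij p(3) by (auto simp: Vcross_def)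
    then show "p \<in> (\<lambda>(i, j). pt True i j) ` Vcross" using ij by auto
  next
    fix p assume "p \<in> (\<lambda>(i, j). pt True i j) ` Vcross"
    then obtain i j where ij: "(i, j) \<in> Vcross" "p = pt True i j" by auto
    then have v: "vtx True i j" by (auto simp: Vcross_def vtx_def inc_def)
    then show "p \<in> crossing_vertices M"
      using ij valence_4_iff[of i j] pt_frontier[of i True j] pt_vertex[of i True j]
      by (auto simp: Vcross_def crossing_vertices_def interior_vertices_def)
  qed
  moreover have "inj_on (\<lambda>(i, j). pt True i j) Vcross"
    by (auto simp: inj_on_def Vcross_def pt_def C_eq_iff)
  ultimately show ?thesis by (simp add: card_image)
qed

lemma card_boundary_vertices: "card (boundary_vertices M) = card Vbd"
proof -
  have "boundary_vertices M = (\<lambda>(i, j). pt True i j) ` Vbd"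
  proof (intro equalityI subsetI)
    fix p assume "p \<in> boundary_vertices M"
    then have p: "p \<in> vertices M" "p \<in> frontier (domain M)" by (auto simp: boundary_vertices_def)
    obtain i j where ij: "i \<le> N True" "j \<le> N False" "vtx True i j" "p = pt True i j" using p(1) vertices_iff[of p True] by auto
    then have "(i, j) \<in> Vbd" using p(2) pt_frontier[of i True j] by (auto simp: Vbd_def)
    then show "p \<in> (\<lambda>(i, j). pt True i j) ` Vbd" using ij by auto
  next
    fix p assume "p \<in> (\<lambda>(i, j). pt True i j) ` Vbd"
    then show "p \<in> boundary_vertices M"
      using pt_frontier[of _ True] pt_vertex[of _ True]
      by (auto simp: Vbd_def boundary_vertices_def)
  qed
  moreover have "inj_on (\<lambda>(i, j). pt True i j) Vbd"
    by (auto simp: inj_on_def Vbd_def pt_def C_eq_iff)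
  ultimately show ?thesis by (simp add: card_image)
qed

lemma edg_interior_iff: "edg d q a b \<Longrightarrow> seg d q a b \<in> interior_edges M \<longleftrightarrow> 0 < q \<and> q < N (\<not> d)"
proof -
  assume e: "edg d q a b"
  note E = e[unfolded edg_def]
  have "seg d q a b \<subseteq> frontier (domain M) \<longleftrightarrow> q = 0 \<or> q = N (\<not> d)"
  proof
    assume f: "seg d q a b \<subseteq> frontier (domain M)"
    show "q = 0 \<or> q = N (\<not> d)"
    proof (rule ccontr)
      assume h: "\<not> ?thesis"
      then have "C (\<not> d) q \<noteq> C (\<not> d) 0" "C (\<not> d) q \<noteq> C (\<not> d) (N (\<not> d))" using E by (auto simp: C_eq_iff)
      \<comment> \<open>The midpoint of a unit edge serves as witness, because both ends of an
        interior edge may lie on the boundary.\<close>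
      moreover note seg_unit_mid(1)[of a a b d q] seg_unit_mid(2,3)[of a a b d]
      moreover have "C d 0 \<le> C d a" "C d (Suc a) \<le> C d (N d)" using E by (auto intro: C_le)
      ultimately show False using f E frontier_domain_iff[of d "(C d a + C d (Suc a)) / 2" "C (\<not> d) q"] by fastforce
    qed
  next
    assume q: "q = 0 \<or> q = N (\<not> d)"
    have "C d 0 \<le> C d a" "C d b \<le> C d (N d)" "C (\<not> d) 0 \<le> C (\<not> d) (N (\<not> d))" using E by (auto intro: C_le)
    then show "seg d q a b \<subseteq> frontier (domain M)" using q by (auto simp: seg_def frontier_domain_iff)
  qed
  moreover have "seg d q a b \<in> edges M" using e edges_iff by blast
  moreover have "q \<le> N (\<not> d)" using E by simp
  ultimately show ?thesis by (auto simp: interior_edges_def)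
qed

section \<open>Interior l-edges as maximal runs of unit edges\<close>

definition sgm :: "bool \<Rightarrow> nat \<Rightarrow> nat \<Rightarrow> nat \<Rightarrow> bool" where
  "sgm d q a b \<longleftrightarrow> a < b \<and> b \<le> N d \<and> 0 < q \<and> q < N (\<not> d) \<and> vtx d a q \<and> vtx d b q \<and> (\<forall>i. a \<le> i \<and> i < b \<longrightarrow> U d i q)"

lemma L_sgm: "(d, q, a, b) \<in> L \<Longrightarrow> sgm d q a b"
  using L_D[of d q a b] L_end_vtx[of d q a b] by (auto simp: sgm_def)

end

text \<open>Two points on an axis-parallel line force the whole segment onto it. Thus one edge
  contained in a segment, which a priori may have any slope, fixes its line.\<close>

lemma closed_segment_two_points_mk:
  assumes "mk d x1 v \<in> closed_segment p p'" "mk d x2 v \<in> closed_segment p p'" "x1 \<noteq> x2"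
  shows "\<exists>u1 u2. u1 < u2 \<and> closed_segment p p' = (\<lambda>x. mk d x v) ` {u1..u2}"
proof -
  obtain u v1 where p: "p = mk d u v1" by (rule mk_cases)
  obtain u' v2 where p': "p' = mk d u' v2" by (rule mk_cases)
  obtain s where s: "mk d x1 v = mk d ((1 - s) * u + s * u') ((1 - s) * v1 + s * v2)"
    using assms(1) unfolding p p' closed_segment_def mk_affine by auto
  obtain t where t: "mk d x2 v = mk d ((1 - t) * u + t * u') ((1 - t) * v1 + t * v2)"
    using assms(2) unfolding p p' closed_segment_def mk_affine by auto
  have "s \<noteq> t" using s t assms(3) by auto
  moreover have "(s - t) * (v2 - v1) = 0" using s t by (simp add: algebra_simps)
  ultimately have v: "v2 = v1" by simp
  then have v1: "v1 = v" using s by (simp add: algebra_simps)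
  have ne: "u \<noteq> u'" using s t assms(3) by (auto simp: algebra_simps)
  show ?thesis
  proof (cases "u < u'")
    case True
    then show ?thesis unfolding p p' v v1 using closed_segment_mk[of u u' d v] by (intro exI[of _ u] exI[of _ u']) auto
  next
    case False
    then show ?thesis unfolding p p' v v1 using closed_segment_mk[of u' u d v] ne
      by (intro exI[of _ u'] exI[of _ u]) (auto simp: closed_segment_commute)
  qed
qed

context hmesh
begin

lemma segment_iff: "segment_of_interior_edges M s \<longleftrightarrow> (\<exists>d q a b. sgm d q a b \<and> s = seg d q a b)"
proof
  assume "segment_of_interior_edges M s"
  then obtain p p' F where s: "p \<noteq> p'" "s = closed_segment p p'" "F \<subseteq> interior_edges M" "s = \<Union>F"
    unfolding segment_of_interior_edges_def by blast
  have Fe: "\<exists>d q a b. edg d q a b \<and> 0 < q \<and> q < N (\<not> d) \<and> e = seg d q a b" if "e \<in> F" for e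
  proof -
    have ei: "e \<in> interior_edges M" using that s by blast
    then obtain d q a b where e: "edg d q a b" "e = seg d q a b" using edges_iff by (auto simp: interior_edges_def)
    then show ?thesis using ei edg_interior_iff[OF e(1)] by blast
  qed
  have "p \<in> \<Union>F" using s by auto
  then obtain e where e: "e \<in> F" "p \<in> e" by blast
  obtain d q a0 b0 where e0: "edg d q a0 b0" "0 < q" "q < N (\<not> d)" "e = seg d q a0 b0" using Fe[OF e(1)] by blast
  let ?v = "C (\<not> d) q"
  have sub: "e' \<subseteq> s" if "e' \<in> F" for e' using that s(4) by blast
  have ends: "pt d a q \<in> seg d q a b" "pt d b q \<in> seg d q a b" if "edg d q a b" for d q a b
    using that pt_in_seg[of a b d a q q] pt_in_seg[of a b d b q q] by (auto simp: edg_def)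
  have lt: "C d a < C d b" if "edg d q a b" for d q a b using that C_less by (auto simp: edg_def)
  have "\<exists>u1 u2. u1 < u2 \<and> closed_segment p p' = (\<lambda>x. mk d x ?v) ` {u1..u2}"
    using ends[OF e0(1)] sub[OF e(1)] lt[OF e0(1)] unfolding e0(4) s(2) pt_def
    by (intro closed_segment_two_points_mk[of d "C d a0" ?v p p' "C d b0"]) auto
  then obtain u1 u2 where u: "u1 < u2" "s = (\<lambda>x. mk d x ?v) ` {u1..u2}" using s(2) by blast
  have F_form: "\<exists>a b. edg d q a b \<and> e' = seg d q a b \<and> u1 \<le> C d a \<and> C d b \<le> u2" if e': "e' \<in> F" for e'
  proof -
    obtain d' q' a b where E: "edg d' q' a b" "e' = seg d' q' a b" using Fe[OF e'] by blast
    have m: "pt d' a q' \<in> s" "pt d' b q' \<in> s" using ends[OF E(1)] sub[OF e'] E(2) by auto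
    show ?thesis
    proof (cases "d' = d")
      case True
      then have "q' = q" "u1 \<le> C d a" "C d b \<le> u2"
        using m E(1) e0 unfolding u(2) pt_def by (auto simp: edg_def C_eq_iff)
      then show ?thesis using E True by blast
    next
      case False
      then have d': "d' = (\<not> d)" by auto
      have "C (\<not> d) a = ?v" "C (\<not> d) b = ?v" using m unfolding u(2) pt_def d' by (auto simp: mk_swap)
      then show ?thesis using lt[OF E(1)] d' by simp
    qed
  qed
  \<comment> \<open>An end of the segment lies in an edge of \<open>F\<close> that does not reach
    beyond it; it is an end of that edge and therefore a vertex.\<close>
  have "mk d u1 ?v \<in> \<Union>F" using u s(4) by auto
  then obtain e1 where e1: "e1 \<in> F" "mk d u1 ?v \<in> e1" by blast
  obtain a b1 where a: "edg d q a b1" "e1 = seg d q a b1" "u1 \<le> C d a" using F_form[OF e1(1)] by blast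
  then have u1: "u1 = C d a" using e1(2) by (auto simp: seg_def)
  have "mk d u2 ?v \<in> \<Union>F" using u s(4) by auto
  then obtain e2 where e2: "e2 \<in> F" "mk d u2 ?v \<in> e2" by blast
  obtain a2 b where b: "edg d q a2 b" "e2 = seg d q a2 b" "C d b \<le> u2" using F_form[OF e2(1)] by blast
  then have u2: "u2 = C d b" using e2(2) by (auto simp: seg_def)
  have seq: "s = seg d q a b" unfolding u(2) u1 u2 seg_def ..
  have ab: "a < b" using u(1) a b C_less_iff[of a d b] unfolding u1 u2 edg_def by auto
  have "s \<subseteq> grid M"
  proof
    fix x assume "x \<in> s"
    then obtain e' where "e' \<in> F" "x \<in> e'" using s(4) by blast
    then show "x \<in> grid M" using s(3) by (auto simp: interior_edges_def edges_def)
  qed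
  then have "\<forall>i. a \<le> i \<and> i < b \<longrightarrow> U d i q" using seg_grid_iff[of a b d q] seq ab b(1) by (auto simp: edg_def)
  then have "sgm d q a b" using ab a b e0 by (auto simp: sgm_def edg_def)
  then show "\<exists>d q a b. sgm d q a b \<and> s = seg d q a b" using seq by blast
next
  assume "\<exists>d q a b. sgm d q a b \<and> s = seg d q a b"
  then obtain d q a b where sg: "sgm d q a b" "s = seg d q a b" by blast
  note S = sg(1)[unfolded sgm_def]
  define F where "F = {e \<in> interior_edges M. e \<subseteq> s}"
  have "s \<subseteq> \<Union>F"
  proof
    fix x assume "x \<in> s"
    then obtain u where u: "x = mk d u (C (\<not> d) q)" "C d a \<le> u" "u \<le> C d b" by (auto simp: sg seg_def)
    obtain i where i: "a \<le> i" "i < b" "C d i \<le> u" "u \<le> C d (Suc i)" using locate[of a b d u] S u by auto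
    obtain a' b' where e: "edg d q a' b'" "a \<le> a'" "a' \<le> i" "i < b'" "b' \<le> b"
      using edg_between[of b d q a i] S i by auto
    have "C d a \<le> C d a'" "C d a' \<le> C d i" "C d (Suc i) \<le> C d b'" "C d b' \<le> C d b" using e S by (auto intro!: C_le)
    then have "x \<in> seg d q a' b'" "seg d q a' b' \<subseteq> s" using u i by (auto simp: seg_def sg)
    moreover have "seg d q a' b' \<in> interior_edges M" using edg_interior_iff[OF e(1)] S by simp
    ultimately show "x \<in> \<Union>F" unfolding F_def by blast
  qed
  moreover have "\<Union>F \<subseteq> s" by (auto simp: F_def)
  ultimately have "s = \<Union>F" by (rule equalityI)
  moreover have "F \<subseteq> interior_edges M" by (auto simp: F_def)
  moreover have "s = closed_segment (pt d a q) (pt d b q)" unfolding sg using S by (intro closed_segment_pt[symmetric]) auto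
  moreover have "pt d a q \<noteq> pt d b q" using S by (simp add: pt_def C_eq_iff)
  ultimately show "segment_of_interior_edges M s" unfolding segment_of_interior_edges_def by metis
qed

definition sg :: "bool \<times> nat \<times> nat \<times> nat \<Rightarrow> (real \<times> real) set" where "sg = (\<lambda>(d, q, a, b). seg d q a b)"

lemma sg_inj: "t \<in> L \<Longrightarrow> t' \<in> L \<Longrightarrow> sg t = sg t' \<longleftrightarrow> t = t'"
proof -
  assume t: "t \<in> L" "t' \<in> L"
  obtain d q a b where 1: "t = (d, q, a, b)" by (cases t)
  obtain d' q' a' b' where 2: "t' = (d', q', a', b')" by (cases t')
  show ?thesis using seg_eq[of d q a b d' q' a' b'] t L_D[of d q a b] L_D[of d' q' a' b'] unfolding 1 2 sg_def by auto
qed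

lemma interior_l_edges_eq: "interior_l_edges M = sg ` L"
proof (intro equalityI subsetI)
  fix s assume "s \<in> interior_l_edges M"
  then have s: "segment_of_interior_edges M s" "\<forall>s'. segment_of_interior_edges M s' \<and> s \<subseteq> s' \<longrightarrow> s' = s"
    by (simp_all add: interior_l_edges_def)
  obtain d q a b where g: "sgm d q a b" "s = seg d q a b" using s(1) unfolding segment_iff by blast
  note G = g(1)[unfolded sgm_def]
  have "U d a q" "a < N d" "0 < q" "q < N (\<not> d)" using G by auto
  then obtain a' b' where L: "(d, q, a', b') \<in> L" "a' \<le> a" "a < b'" using L_exists[of d a q] by blast
  note D = L_D[OF L(1)]
  have "b \<le> b'"
  proof (rule ccontr)
    assume "\<not> b \<le> b'"
    then have "U d b' q" "b' < N d" using G L(3) by auto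
    then show False using D(7) by blast
  qed
  then have "C d b \<le> C d b'" "C d a' \<le> C d a" using G D L by (auto intro!: C_le)
  then have "s \<subseteq> seg d q a' b'" unfolding g(2) seg_def by (intro image_mono) auto
  moreover have "segment_of_interior_edges M (seg d q a' b')" unfolding segment_iff using L_sgm[OF L(1)] by blast
  ultimately have "seg d q a' b' = s" using s(2) by simp
  then show "s \<in> sg ` L" using L(1) by (force simp: sg_def)
next
  fix s assume "s \<in> sg ` L"
  then obtain d q a b where L: "(d, q, a, b) \<in> L" "s = seg d q a b" by (auto simp: sg_def)
  note D = L_D[OF L(1)]
  have "s' = s" if s': "segment_of_interior_edges M s'" "s \<subseteq> s'" for s'
  proof -
    obtain d' q' a' b' where g: "sgm d' q' a' b'" "s' = seg d' q' a' b'" using s'(1) unfolding segment_iff by blast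
    note G = g(1)[unfolded sgm_def]
    have sub: "d' = d" "q' = q" "a' \<le> a" "b \<le> b'"
      using seg_subset[of d q a b d' q' a' b'] s'(2) G D unfolding L(2) g(2) by auto
    have "U d (a - 1) q" if "a' < a"
    proof -
      have "a' \<le> a - 1" "a - 1 < b'" using that sub D(3) by auto
      then show ?thesis using G sub by blast
    qed
    then have "a' = a" using D(6) sub by (cases "a' < a") auto
    moreover have "U d b q" "b < N d" if "b < b'" using that G sub D(3) by auto
    then have "b' = b" using D(7) sub by (cases "b < b'") auto
    ultimately show ?thesis using sub g L by simp
  qed
  moreover have "segment_of_interior_edges M s" unfolding segment_iff using L_sgm[OF L(1)] L(2) by blast
  ultimately show "s \<in> interior_l_edges M" unfolding interior_l_edges_def by simp
qed

lemma card_interior_l_edges: "card (interior_l_edges M) = card L"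
  unfolding interior_l_edges_eq using sg_inj by (intro card_image) (auto simp: inj_on_def)

lemma sg_meet:
  assumes t: "(d, q, a, b) \<in> L" and t': "(d', q', a', b') \<in> L"
  shows "sg (d, q, a, b) \<inter> sg (d', q', a', b') \<noteq> {} \<longleftrightarrow>
    (d, q, a, b) = (d', q', a', b') \<or> d' = (\<not> d) \<and> a \<le> q' \<and> q' \<le> b \<and> a' \<le> q \<and> q \<le> b'"
proof -
  note D = L_D[OF t] and D' = L_D[OF t']
  have self: "sg (d, q, a, b) \<noteq> {}" if "(d, q, a, b) \<in> L" for d q a b
    using C_le[of a b d] L_D(3,4)[OF that] by (auto simp: sg_def seg_def)
  show ?thesis
  proof (cases "d' = d")
    case True
    have "(d, q, a, b) = (d', q', a', b')" if ne: "sg (d, q, a, b) \<inter> sg (d', q', a', b') \<noteq> {}"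
    proof -
      obtain u where u: "C (\<not> d) q = C (\<not> d) q'" "C d a \<le> u" "u \<le> C d b" "C d a' \<le> u" "u \<le> C d b'"
        using ne by (auto simp: sg_def seg_def True)
      have q: "q' = q" using u(1) D(2) D'(2) True by (simp add: C_eq_iff)
      have le: "a \<le> b'" "a' \<le> b" using u C_le_iff[of a d b'] C_le_iff[of a' d b] D(3,4) D'(3,4) True by auto
      have t2: "(d, q, a', b') \<in> L" using t' q True by simp
      have "a' = a \<and> b' = b" using L_unique[OF t t2, of "max a a'"] le D(3) D'(3) by auto
      then show ?thesis using q True by simp
    qed
    then show ?thesis using self[OF t] True by auto
  next
    case False
    then have d': "d' = (\<not> d)" by auto
    have "sg (d, q, a, b) \<inter> sg (d', q', a', b') \<noteq> {} \<longleftrightarrow> C d a \<le> C d q' \<and> C d q' \<le> C d b \<and> C d' a' \<le> C d' q \<and> C d' q \<le> C d' b'"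
    proof
      assume "sg (d, q, a, b) \<inter> sg (d', q', a', b') \<noteq> {}"
      then show "C d a \<le> C d q' \<and> C d q' \<le> C d b \<and> C d' a' \<le> C d' q \<and> C d' q \<le> C d' b'"
        by (auto simp: sg_def seg_def d' mk_swap)
    next
      assume "C d a \<le> C d q' \<and> C d q' \<le> C d b \<and> C d' a' \<le> C d' q \<and> C d' q \<le> C d' b'"
      then have "pt d q' q \<in> sg (d, q, a, b) \<inter> sg (d', q', a', b')"
        by (auto simp: sg_def seg_def d' mk_swap pt_def)
      then show "sg (d, q, a, b) \<inter> sg (d', q', a', b') \<noteq> {}" by blast
    qed
    also have "\<dots> \<longleftrightarrow> a \<le> q' \<and> q' \<le> b \<and> a' \<le> q \<and> q \<le> b'"
      using D(2-4) D'(2-4) d' by (simp add: C_le_iff)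
    finally show ?thesis using d' by auto
  qed
qed

end

section \<open>Splines in terms of the tensor product truncated power basis\<close>

lemma max_power_deriv:
  "((\<lambda>x :: real. max 0 (x - t) ^ Suc (Suc m)) has_real_derivative real (Suc (Suc m)) * max 0 (x - t) ^ Suc m) (at x within S)"
proof -
  have "((\<lambda>x :: real. max 0 (x - t) ^ Suc (Suc m)) has_real_derivative real (Suc (Suc m)) * max 0 (x - t) ^ Suc m) (at x)"
  proof (cases x t rule: linorder_cases)
    case less
    have "((\<lambda>x :: real. 0) has_real_derivative 0) (at x)" by simp
    then have "((\<lambda>x :: real. max 0 (x - t) ^ Suc (Suc m)) has_real_derivative 0) (at x)"
      by (rule has_field_derivative_transform_within_open[where S = "{..<t}"]) (use less in auto)
    then show ?thesis using less by simp
  next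
    case greater
    have "((\<lambda>x. x - t) has_real_derivative 1) (at x)" by (auto intro!: derivative_eq_intros)
    from DERIV_power[OF this, of "Suc (Suc m)"]
    have "((\<lambda>x :: real. (x - t) ^ Suc (Suc m)) has_real_derivative real (Suc (Suc m)) * (x - t) ^ Suc m) (at x)"
      by simp
    then have "((\<lambda>x :: real. max 0 (x - t) ^ Suc (Suc m)) has_real_derivative real (Suc (Suc m)) * (x - t) ^ Suc m) (at x)"
      by (rule has_field_derivative_transform_within_open[where S = "{t<..}"]) (use greater in auto)
    then show ?thesis using greater by simp
  next
    case equal
    have "((\<lambda>y. max 0 (y - t) ^ Suc m) \<longlongrightarrow> max 0 (t - t) ^ Suc m) (at t)"
      by (intro tendsto_intros)
    then have "((\<lambda>y. max 0 (y - t) ^ Suc m) \<longlongrightarrow> 0) (at t)" by simp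
    moreover have "\<forall>\<^sub>F y in at t. (max 0 (y - t) ^ Suc (Suc m) - max 0 (t - t) ^ Suc (Suc m)) / (y - t) = max 0 (y - t) ^ Suc m"
      unfolding eventually_at_filter by (rule always_eventually) (auto simp: max_def)
    ultimately have "((\<lambda>y. (max 0 (y - t) ^ Suc (Suc m) - max 0 (t - t) ^ Suc (Suc m)) / (y - t)) \<longlongrightarrow> 0) (at t)"
      by (simp only: tendsto_cong)
    then show ?thesis using equal by (simp add: has_field_derivative_iff)
  qed
  then show ?thesis by (rule has_field_derivative_at_within)
qed

text \<open>Meant for \<open>r \<le> 2\<close>, where it is the \<open>r\<close>-th derivative of
  \<open>tpow c k\<close>.\<close>

definition dtpow :: "nat \<Rightarrow> (nat \<Rightarrow> real) \<Rightarrow> nat \<Rightarrow> real \<Rightarrow> real" where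
  "dtpow r c k x = (if k \<le> 3 then (if r = 0 then x ^ k else if r = 1 then real k * x ^ (k - 1) else real k * real (k - 1) * x ^ (k - 2))
     else (if r = 0 then max 0 (x - c (k - 3)) ^ 3 else if r = 1 then 3 * max 0 (x - c (k - 3)) ^ 2 else 6 * max 0 (x - c (k - 3))))"

lemma dtpow_0: "dtpow 0 c k x = tpow c k x" by (simp add: dtpow_def tpow_def)

lemma dtpow_deriv:
  assumes "r < 2" shows "(dtpow r c k has_real_derivative dtpow (Suc r) c k x) (at x within S)"
proof (cases "k \<le> 3")
  case True
  have "r = 0 \<or> r = 1" using assms by auto
  then show ?thesis
  proof
    assume r: "r = 0"
    show ?thesis using True unfolding dtpow_def r by (auto intro!: derivative_eq_intros)
  next
    assume r: "r = 1"
    have "((\<lambda>x. real k * x ^ (k - 1)) has_real_derivative real k * (real (k - 1) * x ^ (k - 1 - 1))) (at x within S)"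
      by (auto intro!: derivative_eq_intros)
    then show ?thesis using True unfolding dtpow_def r by (simp add: numeral_2_eq_2 mult.assoc)
  qed
next
  case False
  let ?t = "c (k - 3)"
  have "r = 0 \<or> r = 1" using assms by auto
  then show ?thesis
  proof
    assume r: "r = 0"
    show ?thesis using False max_power_deriv[of ?t 1 x S] unfolding dtpow_def r by (simp add: numeral_3_eq_3 numeral_2_eq_2)
  next
    assume r: "r = 1"
    have "((\<lambda>x. 3 * max 0 (x - ?t) ^ Suc (Suc 0)) has_real_derivative 3 * (real (Suc (Suc 0)) * max 0 (x - ?t) ^ Suc 0)) (at x within S)"
      by (rule DERIV_cmult, rule max_power_deriv)
    then show ?thesis using False unfolding dtpow_def r by (simp add: numeral_2_eq_2)
  qed
qed

lemma dtpow_continuous: "continuous_on S (dtpow r c k)"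
  unfolding dtpow_def by (cases "k \<le> 3"; cases "r = 0"; cases "r = 1") (auto intro!: continuous_intros)

text \<open>The variant of \<open>sum_tpow\<close> for a whole cell: knots of the finest grid
  strictly inside it contribute nothing, as their coefficients are zero.\<close>

lemma sum_tpow_cell:
  assumes c: "\<And>i j. i < j \<Longrightarrow> j \<le> m \<Longrightarrow> c i < c j" and ab: "a < b" "b \<le> m"
    and z: "\<And>j. a < j \<Longrightarrow> j < b \<Longrightarrow> g (3 + j) = 0" and x: "c a \<le> x" "x \<le> c b"
  shows "(\<Sum>k<m + 3. g k * tpow c k x) = (\<Sum>k\<le>3. g k * x ^ k) + (\<Sum>j\<in>{1..a}. g (3 + j) * (x - c j) ^ 3)"
proof -
  have "(\<Sum>k<m + 3. g k * tpow c k x) = (\<Sum>k\<le>3. g k * x ^ k) + (\<Sum>j\<in>{1..<m}. g (3 + j) * tpow c (3 + j) x)"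
    using ab by (subst sum_tpow_index) (auto simp: tpow_def)
  also have "(\<Sum>j\<in>{1..<m}. g (3 + j) * tpow c (3 + j) x) = (\<Sum>j\<in>{1..a}. g (3 + j) * (x - c j) ^ 3)"
  proof (rule sum.mono_neutral_cong_right)
    show "\<forall>j\<in>{1..<m} - {1..a}. g (3 + j) * tpow c (3 + j) x = 0"
    proof
      fix j assume j: "j \<in> {1..<m} - {1..a}"
      show "g (3 + j) * tpow c (3 + j) x = 0"
      proof (cases "j < b")
        case True
        then show ?thesis using z[of j] j by auto
      next
        case False
        then have "c b \<le> c j" using c[of b j] j by (cases "j = b") auto
        then show ?thesis using x j by (auto simp: tpow_def)
      qed
    qed
    fix j assume j: "j \<in> {1..a}"
    then have "c j \<le> c a" using c[of j a] ab by (cases "j = a") auto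
    then show "g (3 + j) * tpow c (3 + j) x = g (3 + j) * (x - c j) ^ 3" using x j by (simp add: tpow_def)
  qed (use ab in auto)
  finally show ?thesis .
qed

section \<open>Coefficients in the tensor product basis and the jumps they produce\<close>

context hmesh
begin

definition gam :: "(nat \<times> nat \<Rightarrow> real) \<Rightarrow> bool \<Rightarrow> nat \<Rightarrow> nat \<Rightarrow> real" where
  "gam \<gamma> d k l = (if d then \<gamma> (k, l) else \<gamma> (l, k))"

definition spl :: "(nat \<times> nat \<Rightarrow> real) \<Rightarrow> real \<times> real \<Rightarrow> real" where
  "spl \<gamma> p = (if p \<in> domain M then
     \<Sum>k<N True + 3. \<Sum>l<N False + 3. \<gamma> (k, l) * (tpow (C True) k (fst p) * tpow (C False) l (snd p)) else 0)"

text \<open>The coefficient of the \<open>l\<close>-th basis function across \<open>d\<close>, as a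
  function of the position \<open>u\<close> along \<open>d\<close>. For \<open>l = 3 + j\<close> it
  is one sixth of the jump of the third transversal derivative at line \<open>j\<close>.\<close>

definition Qc :: "(nat \<times> nat \<Rightarrow> real) \<Rightarrow> bool \<Rightarrow> nat \<Rightarrow> real \<Rightarrow> real" where
  "Qc \<gamma> d l u = (\<Sum>k<N d + 3. gam \<gamma> d k l * tpow (C d) k u)"

text \<open>No jump at the places where the mesh has no edge: the condition that makes the function
  a single polynomial on each cell.\<close>

definition Zc :: "(nat \<times> nat \<Rightarrow> real) \<Rightarrow> bool" where
  "Zc \<gamma> \<longleftrightarrow> (\<forall>d i j u. 0 < j \<longrightarrow> j < N (\<not> d) \<longrightarrow> i < N d \<longrightarrow> \<not> U d i j \<longrightarrow> C d i \<le> u \<longrightarrow> u \<le> C d (Suc i) \<longrightarrow> Qc \<gamma> d (3 + j) u = 0)"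

definition rng :: "(nat \<times> nat) set" where "rng = {..<N True + 3} \<times> {..<N False + 3}"

lemma spl_mk:
  assumes "mk d u v \<in> domain M"
  shows "spl \<gamma> (mk d u v) = (\<Sum>l<N (\<not> d) + 3. Qc \<gamma> d l u * tpow (C (\<not> d)) l v)"
proof (cases d)
  case True
  then show ?thesis using assms unfolding spl_def Qc_def gam_def mk_def
    by (simp add: sum_distrib_right mult.assoc) (rule sum.swap)
next
  case False
  then show ?thesis using assms unfolding spl_def Qc_def gam_def mk_def
    by (simp add: sum_distrib_right mult.assoc) (simp add: mult_ac)
qed

lemma mk_domain_iff:
  "mk d u v \<in> domain M \<longleftrightarrow> C d 0 \<le> u \<and> u \<le> C d (N d) \<and> C (\<not> d) 0 \<le> v \<and> v \<le> C (\<not> d) (N (\<not> d))"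
  unfolding domain_M[of d] mem_region by blast

lemma C_mixed_spl: "C_mixed 2 (domain M) (spl \<gamma>)"
proof -
  define D where "D r s p = (if p \<in> domain M then
     \<Sum>k<N True + 3. \<Sum>l<N False + 3. \<gamma> (k, l) * (dtpow r (C True) k (fst p) * dtpow s (C False) l (snd p)) else 0)" for r s p
  have D0: "D 0 0 = spl \<gamma>" by (simp add: D_def spl_def fun_eq_iff dtpow_0)
  have cont: "continuous_on (domain M) (D r s)" for r s
  proof -
    have "continuous_on (domain M) (\<lambda>p. \<Sum>k<N True + 3. \<Sum>l<N False + 3. \<gamma> (k, l) * (dtpow r (C True) k (fst p) * dtpow s (C False) l (snd p)))"
      by (intro continuous_intros continuous_on_compose2[OF dtpow_continuous[of UNIV]]) auto
    then show ?thesis by (rule continuous_on_eq) (simp add: D_def)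
  qed
  have dy: "((\<lambda>t. D 0 s (x, t)) has_real_derivative D 0 (Suc s) (x, y)) (at y within {t. (x, t) \<in> domain M})"
    if "s < 2" "(x, y) \<in> domain M" for s x y
  proof -
    have "((\<lambda>t. \<Sum>k<N True + 3. \<Sum>l<N False + 3. \<gamma> (k, l) * (dtpow 0 (C True) k x * dtpow s (C False) l t)) has_real_derivative
       (\<Sum>k<N True + 3. \<Sum>l<N False + 3. \<gamma> (k, l) * (dtpow 0 (C True) k x * dtpow (Suc s) (C False) l y))) (at y within {t. (x, t) \<in> domain M})"
      by (intro DERIV_sum DERIV_cmult dtpow_deriv that)
    then have "((\<lambda>t. D 0 s (x, t)) has_real_derivative
       (\<Sum>k<N True + 3. \<Sum>l<N False + 3. \<gamma> (k, l) * (dtpow 0 (C True) k x * dtpow (Suc s) (C False) l y))) (at y within {t. (x, t) \<in> domain M})"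
      by (rule has_field_derivative_transform_within[OF _ zero_less_one]) (use that in \<open>auto simp: D_def\<close>)
    then show ?thesis using that by (simp add: D_def)
  qed
  have dx: "((\<lambda>t. D r s (t, y)) has_real_derivative D (Suc r) s (x, y)) (at x within {t. (t, y) \<in> domain M})"
    if "r < 2" "(x, y) \<in> domain M" for r s x y
  proof -
    have "((\<lambda>t. \<Sum>k<N True + 3. \<Sum>l<N False + 3. \<gamma> (k, l) * (dtpow r (C True) k t * dtpow s (C False) l y)) has_real_derivative
       (\<Sum>k<N True + 3. \<Sum>l<N False + 3. \<gamma> (k, l) * (dtpow (Suc r) (C True) k x * dtpow s (C False) l y))) (at x within {t. (t, y) \<in> domain M})"
      by (intro DERIV_sum DERIV_cmult DERIV_cmult_right dtpow_deriv that)
    then have "((\<lambda>t. D r s (t, y)) has_real_derivative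
       (\<Sum>k<N True + 3. \<Sum>l<N False + 3. \<gamma> (k, l) * (dtpow (Suc r) (C True) k x * dtpow s (C False) l y))) (at x within {t. (t, y) \<in> domain M})"
      by (rule has_field_derivative_transform_within[OF _ zero_less_one]) (use that in \<open>auto simp: D_def\<close>)
    then show ?thesis using that by (simp add: D_def)
  qed
  show ?thesis unfolding C_mixed_def using D0 cont dx dy by (intro exI[of _ D]) blast
qed

lemma not_U_inside:
  assumes "i < N d" "q < N (\<not> d)" "lo d i q \<le> i'" "i' < lo d i q + w (lv d i q)"
    "lo (\<not> d) q i < p" "p < lo (\<not> d) q i + w (lv d i q)"
  shows "\<not> U d i' p"
proof -
  have "lv d i' p = lv d i q" by (rule lv_in_cell) (use assms in auto)
  moreover have "\<not> w (lv d i q) dvd p"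
  proof
    assume "w (lv d i q) dvd p"
    moreover have "w (lv d i q) dvd lo (\<not> d) q i" by (simp add: lo_def lv_swap)
    ultimately have "lo (\<not> d) q i + w (lv d i q) \<le> p" using assms(5) by (intro dvd_less_add)
    then show False using assms(6) by simp
  qed
  ultimately show ?thesis by (simp add: U_def llev_le_iff)
qed

text \<open>Finest grid lines of both directions inside the cell must drop out. \<open>Zc\<close> in
  direction \<open>True\<close> removes the horizontal ones and leaves a cubic in \<open>v\<close>;
  \<open>Zc\<close> in direction \<open>False\<close> removes the vertical ones from its
  coefficients.\<close>

lemma spl_bidegree:
  assumes Z: "Zc \<gamma>" and c: "c \<in> M"
  shows "bidegree_poly_on 3 (region c) (spl \<gamma>)"
proof -
  obtain i j where ij: "i < N True" "j < N False" "c = cell True i j" using c by (auto simp: M_def)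
  define s where "s = w (lv True i j)"
  define a where "a = lo True i j"
  define b where "b = lo False j i"
  have s0: "0 < s" by (simp add: s_def)
  have lvF: "lv False j i = lv True i j" using lv_swap[of True j i] by simp
  have bd: "a \<le> i" "i < a + s" "a + s \<le> N True" "b \<le> j" "j < b + s" "b + s \<le> N False"
    using lo_bounds[OF ij(1), of j] lo_bounds[OF ij(2), of i] lvF by (auto simp: a_def b_def s_def)
  have nU: "\<not> U True i' p" if "a \<le> i'" "i' < a + s" "b < p" "p < b + s" for i' p
    using not_U_inside[of i True j i' p] that ij by (simp add: a_def b_def s_def)
  have nV: "\<not> U False j' p" if "b \<le> j'" "j' < b + s" "a < p" "p < a + s" for j' p
    using not_U_inside[of j False i j' p] that ij lvF by (simp add: a_def b_def s_def)
  define cf where "cf d t e = of_nat (3 choose e) * (- C d t) ^ (3 - e)" for d t e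
  \<comment> \<open>The coefficient of \<open>v ^ e\<close> in the factor of
    \<open>tpow (C True) k u\<close>, once the truncated powers of the lines up to the lower side
    \<open>b\<close> are expanded.\<close>
  define h where "h e k = \<gamma> (k, e) + (\<Sum>t\<in>{1..b}. \<gamma> (k, 3 + t) * cf False t e)" for e k
  \<comment> \<open>One unit row of the cell suffices: there the factor is a cubic in
    \<open>v\<close> that \<open>Zc\<close> makes zero on an interval.\<close>
  have h0: "h e (3 + p) = 0" if p: "a < p" "p < a + s" and e: "e \<le> 3" for e p
  proof (rule cubic_zero_on_interval[OF _ _ e])
    show "C False b < C False (Suc b)" using bd s0 by (intro C_less) auto
    fix v assume v: "C False b \<le> v" "v \<le> C False (Suc b)"
    have "(\<Sum>e\<le>3. h e (3 + p) * v ^ e) = (\<Sum>e\<le>3. \<gamma> (3 + p, e) * v ^ e) + (\<Sum>t\<in>{1..b}. \<gamma> (3 + p, 3 + t) * (v - C False t) ^ 3)"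
      unfolding h_def cf_def by (rule cubic_plus_cubes[symmetric])
    also have "\<dots> = Qc \<gamma> False (3 + p) v"
      unfolding Qc_def gam_def using bd s0 v by (subst sum_tpow[OF C_less]) auto
    also have "\<dots> = 0"
    proof -
      have "0 < p" "p < N (\<not> False)" "b < N False" using p bd s0 by auto
      then show ?thesis using Z nV[of b p] p s0 v unfolding Zc_def by auto
    qed
    finally show "(\<Sum>e\<le>3. h e (3 + p) * v ^ e) = 0" .
  qed
  have rep: "spl \<gamma> (u, v) = (\<Sum>e\<le>3. (\<Sum>k<N True + 3. h e k * tpow (C True) k u) * v ^ e)"
    if uv: "C True a \<le> u" "u \<le> C True (a + s)" "C False b \<le> v" "v \<le> C False (b + s)" for u v
  proof -
    have "C True 0 \<le> C True a" "C True (a + s) \<le> C True (N True)" "C False 0 \<le> C False b" "C False (b + s) \<le> C False (N False)"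
      using bd by (auto intro!: C_le)
    then have dom: "mk True u v \<in> domain M" unfolding mk_domain_iff using uv by auto
    obtain i' where i': "a \<le> i'" "i' < a + s" "C True i' \<le> u" "u \<le> C True (Suc i')"
      using locate[of a "a + s" True u] uv bd s0 by auto
    have z: "Qc \<gamma> True (3 + p) u = 0" if "b < p" "p < b + s" for p
    proof -
      have "0 < p" "p < N (\<not> True)" "i' < N True" using that bd i' by auto
      then show ?thesis using Z nU[OF i'(1,2) that] i' unfolding Zc_def by blast
    qed
    have "spl \<gamma> (u, v) = (\<Sum>l<N False + 3. Qc \<gamma> True l u * tpow (C False) l v)"
      using spl_mk[OF dom] by (simp add: mk_def)
    also have "\<dots> = (\<Sum>l\<le>3. Qc \<gamma> True l u * v ^ l) + (\<Sum>t\<in>{1..b}. Qc \<gamma> True (3 + t) u * (v - C False t) ^ 3)"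
      by (rule sum_tpow_cell[OF C_less, where b = "b + s"]) (use bd s0 uv z in auto)
    also have "\<dots> = (\<Sum>e\<le>3. (Qc \<gamma> True e u + (\<Sum>t\<in>{1..b}. Qc \<gamma> True (3 + t) u * cf False t e)) * v ^ e)"
      unfolding cf_def by (rule cubic_plus_cubes)
    also have "\<dots> = (\<Sum>e\<le>3. (\<Sum>k<N True + 3. h e k * tpow (C True) k u) * v ^ e)"
    proof (rule sum.cong[OF refl])
      fix e
      have "(\<Sum>t\<in>{1..b}. Qc \<gamma> True (3 + t) u * cf False t e) = (\<Sum>k<N True + 3. (\<Sum>t\<in>{1..b}. \<gamma> (k, 3 + t) * cf False t e) * tpow (C True) k u)"
        unfolding Qc_def gam_def sum_distrib_right by (subst sum.swap) (simp add: mult_ac)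
      then show "(Qc \<gamma> True e u + (\<Sum>t\<in>{1..b}. Qc \<gamma> True (3 + t) u * cf False t e)) * v ^ e = (\<Sum>k<N True + 3. h e k * tpow (C True) k u) * v ^ e"
        by (simp add: h_def distrib_right sum.distrib Qc_def[of \<gamma> True e] gam_def)
    qed
    finally show ?thesis .
  qed
  define co where "co e f = h e f + (\<Sum>t\<in>{1..a}. h e (3 + t) * cf True t f)" for e f
  have "spl \<gamma> (u, v) = (\<Sum>f\<le>3. \<Sum>e\<le>3. co e f * u ^ f * v ^ e)" if uv: "(u, v) \<in> region c" for u v
  proof -
    have uv: "C True a \<le> u" "u \<le> C True (a + s)" "C False b \<le> v" "v \<le> C False (b + s)"
      using that mem_region[of True u v] unfolding ij(3) cell_def by (auto simp: mk_def a_def b_def s_def)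
    have "(\<Sum>k<N True + 3. h e k * tpow (C True) k u) = (\<Sum>f\<le>3. co e f * u ^ f)" if e: "e \<le> 3" for e
    proof -
      have "(\<Sum>k<N True + 3. h e k * tpow (C True) k u) = (\<Sum>k\<le>3. h e k * u ^ k) + (\<Sum>t\<in>{1..a}. h e (3 + t) * (u - C True t) ^ 3)"
        by (rule sum_tpow_cell[OF C_less, where b = "a + s"]) (use bd s0 uv h0 e in auto)
      also have "\<dots> = (\<Sum>f\<le>3. co e f * u ^ f)" unfolding co_def cf_def by (rule cubic_plus_cubes)
      finally show ?thesis .
    qed
    then have "spl \<gamma> (u, v) = (\<Sum>e\<le>3. (\<Sum>f\<le>3. co e f * u ^ f) * v ^ e)" unfolding rep[OF uv] by simp
    also have "\<dots> = (\<Sum>f\<le>3. \<Sum>e\<le>3. co e f * u ^ f * v ^ e)" unfolding sum_distrib_right by (rule sum.swap)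
    finally show ?thesis .
  qed
  then show ?thesis unfolding bidegree_poly_on_def by (intro exI[of _ "\<lambda>f e. co e f"]) auto
qed

section \<open>Every spline has such coefficients\<close>

lemma cell_contains_unit:
  assumes "i < N d" "q < N (\<not> d)" "C d i \<le> u" "u \<le> C d (Suc i)" "C (\<not> d) q \<le> v" "v \<le> C (\<not> d) (Suc q)"
  shows "mk d u v \<in> region (cell d i q)" "cell d i q \<in> M"
proof -
  note b = lo_bounds[OF assms(1), of q] and b' = lo_bounds[OF assms(2), of i, unfolded lv_swap]
  have "C d (lo d i q) \<le> C d i" "C d (Suc i) \<le> C d (lo d i q + w (lv d i q))"
    "C (\<not> d) (lo (\<not> d) q i) \<le> C (\<not> d) q" "C (\<not> d) (Suc q) \<le> C (\<not> d) (lo (\<not> d) q i + w (lv d i q))"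
    using b b' by (auto intro: C_le)
  then show "mk d u v \<in> region (cell d i q)" using assms unfolding cell_def mem_region by linarith
  show "cell d i q \<in> M" using M_iff[of _ d] assms by blast
qed

lemma bidegree_line:
  assumes "bidegree_poly_on 3 S f" shows "\<exists>a. \<forall>u. mk d u v \<in> S \<longrightarrow> f (mk d u v) = (\<Sum>e\<le>3. a e * u ^ e)"
proof -
  obtain c where c: "\<forall>x y. (x, y) \<in> S \<longrightarrow> f (x, y) = (\<Sum>i\<le>3. \<Sum>j\<le>3. c i j * x ^ i * y ^ j)"
    using assms unfolding bidegree_poly_on_def by blast
  show ?thesis
  proof (cases d)
    case True
    have "(\<Sum>i\<le>3. \<Sum>j\<le>3. c i j * u ^ i * v ^ j) = (\<Sum>i\<le>3. (\<Sum>j\<le>3. c i j * v ^ j) * u ^ i)" for u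
      unfolding sum_distrib_right by (simp add: mult_ac)
    then show ?thesis
      by (intro exI[of _ "\<lambda>i. \<Sum>j\<le>3. c i j * v ^ j"]) (use c True in \<open>auto simp: mk_def\<close>)
  next
    case False
    have "(\<Sum>i\<le>3. \<Sum>j\<le>3. c i j * v ^ i * u ^ j) = (\<Sum>j\<le>3. (\<Sum>i\<le>3. c i j * v ^ i) * u ^ j)" for u
      unfolding sum_distrib_right by (rule sum.swap)
    then show ?thesis
      by (intro exI[of _ "\<lambda>j. \<Sum>i\<le>3. c i j * v ^ i"]) (use c False in \<open>auto simp: mk_def\<close>)
  qed
qed

text \<open>An absent unit edge has the same cell on both sides. Across it the function is one cubic
  on two adjacent unit intervals, so the truncated power that starts between them has coefficient
  zero.\<close>

lemma Zc_of_bidegree: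
  assumes bi: "\<And>c. c \<in> M \<Longrightarrow> bidegree_poly_on 3 (region c) (spl \<gamma>)"
  shows "Zc \<gamma>"
  unfolding Zc_def
proof (intro allI impI)
  fix d i j u
  assume j: "0 < j" "j < N (\<not> d)" and i: "i < N d" and nU: "\<not> U d i j" and u: "C d i \<le> u" "u \<le> C d (Suc i)"
  define t where "t = w (lv d i j)"
  note b' = lo_bounds[OF j(2), of i, unfolded lv_swap, folded t_def]
  have "w (lv d i j) dvd lo (\<not> d) j i" by (simp add: lo_def lv_swap)
  then have "lo (\<not> d) j i \<noteq> j" using nU by (auto simp: U_def llev_le_iff)
  then have lt: "lo (\<not> d) j i < j" using b' by simp
  then have tl: "lv d i (j - 1) = lv d i j" using b' i j lo_bounds[OF i, of j] by (intro lv_in_cell) (auto simp: t_def)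
  have dv: "(j - 1) div t = j div t" using lt b' by (intro lo_div[of "\<not> d" j i, unfolded lv_swap, folded t_def]) auto
  have same: "cell d i (j - 1) = cell d i j"
    unfolding cell_def lo_def lv_swap tl using dv by (simp add: t_def)
  obtain p where p: "\<And>v. mk (\<not> d) v u \<in> region (cell d i j) \<Longrightarrow> spl \<gamma> (mk (\<not> d) v u) = (\<Sum>e\<le>3. p e * v ^ e)"
    using bidegree_line[OF bi[OF cell_contains_unit(2)[OF i j(2) u]], of "C (\<not> d) j" "\<not> d" u] C_le[of j "Suc j" "\<not> d"] j by auto
  define g where "g l = Qc \<gamma> d l u" for l
  have val: "(\<Sum>l<N (\<not> d) + 3. g l * tpow (C (\<not> d)) l v) = (\<Sum>e\<le>3. p e * v ^ e)"
    if v: "C (\<not> d) (j - 1) \<le> v" "v \<le> C (\<not> d) (Suc j)" for v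
  proof -
    have reg: "mk d u v \<in> region (cell d i j)"
    proof (cases "v \<le> C (\<not> d) j")
      case True
      then show ?thesis using cell_contains_unit(1)[of i d "j - 1" u v] i j u v same by simp
    next
      case False
      then show ?thesis using cell_contains_unit(1)[of i d j u v] i j u v by simp
    qed
    then have "mk d u v \<in> domain M" using M_iff[of "cell d i j" d] i j unfolding domain_def by blast
    then show ?thesis using spl_mk[of d u v \<gamma>] p[of v] reg by (simp add: mk_swap g_def)
  qed
  define P where "P e = g e + (\<Sum>t\<in>{1..j - 1}. g (3 + t) * (of_nat (3 choose e) * (- C (\<not> d) t) ^ (3 - e)))" for e
  have P: "(\<Sum>k\<le>3. g k * v ^ k) + (\<Sum>t\<in>{1..j - 1}. g (3 + t) * (v - C (\<not> d) t) ^ 3) = (\<Sum>e\<le>3. P e * v ^ e)" for v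
    unfolding P_def by (rule cubic_plus_cubes)
  have Pp: "P e - p e = 0" if "e \<le> 3" for e
  proof (rule cubic_zero_on_interval[OF _ _ that])
    show "C (\<not> d) (j - 1) < C (\<not> d) j" using j by (intro C_less) auto
    fix v assume v: "C (\<not> d) (j - 1) \<le> v" "v \<le> C (\<not> d) j"
    have "C (\<not> d) j \<le> C (\<not> d) (Suc j)" using j by (intro C_le) auto
    then have "(\<Sum>e\<le>3. p e * v ^ e) = (\<Sum>l<N (\<not> d) + 3. g l * tpow (C (\<not> d)) l v)" using v by (intro val[symmetric]) auto
    also have "\<dots> = (\<Sum>e\<le>3. P e * v ^ e)" unfolding P[symmetric] using j v by (intro sum_tpow[OF C_less]) auto
    finally show "(\<Sum>e\<le>3. (P e - p e) * v ^ e) = 0" by (simp add: left_diff_distrib sum_subtractf)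
  qed
  \<comment> \<open>At the far end of the second interval the expansion has exactly one term more
    than on the first.\<close>
  let ?v = "C (\<not> d) (Suc j)"
  have lt2: "C (\<not> d) j < ?v" "C (\<not> d) (j - 1) \<le> ?v" using j by (auto intro!: C_less C_le)
  have "(\<Sum>e\<le>3. p e * ?v ^ e) = (\<Sum>l<N (\<not> d) + 3. g l * tpow (C (\<not> d)) l ?v)" using lt2 by (intro val[symmetric]) auto
  also have "\<dots> = (\<Sum>k\<le>3. g k * ?v ^ k) + (\<Sum>t\<in>{1..j}. g (3 + t) * (?v - C (\<not> d) t) ^ 3)"
    using j lt2 by (intro sum_tpow[OF C_less]) auto
  also have "{1..j} = insert j {1..j - 1}" using j by auto
  also have "(\<Sum>k\<le>3. g k * ?v ^ k) + (\<Sum>t\<in>insert j {1..j - 1}. g (3 + t) * (?v - C (\<not> d) t) ^ 3)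
     = (\<Sum>e\<le>3. P e * ?v ^ e) + g (3 + j) * (?v - C (\<not> d) j) ^ 3"
    using j by (subst sum.insert) (auto simp flip: P)
  also have "(\<Sum>e\<le>3. P e * ?v ^ e) = (\<Sum>e\<le>3. p e * ?v ^ e)" using Pp by (intro sum.cong) auto
  finally have "g (3 + j) * (?v - C (\<not> d) j) ^ 3 = 0" by simp
  then show "Qc \<gamma> d (3 + j) u = 0" using lt2 by (simp add: g_def)
qed

lemma spl_eq_0:
  assumes "spl \<gamma> = (\<lambda>_. 0)" "\<And>\<alpha>. \<alpha> \<notin> rng \<Longrightarrow> \<gamma> \<alpha> = 0"
  shows "\<gamma> = (\<lambda>_. 0)"
proof -
  have "Qc \<gamma> True l u = 0" if "l < N False + 3" "u \<in> {C True 0..C True (N True)}" for l u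
  proof (rule tpow_independent[OF C_less _ _ that(1)])
    fix v assume v: "v \<in> {C False 0..C False (N False)}"
    then have dom: "mk True u v \<in> domain M" unfolding mk_domain_iff using that by simp
    show "(\<Sum>k<N False + 3. Qc \<gamma> True k u * tpow (C False) k v) = 0"
      using spl_mk[OF dom, of \<gamma>] assms(1) by simp
  qed (use N_pos in auto)
  then have z: "(\<Sum>k<N True + 3. \<gamma> (k, l) * tpow (C True) k u) = 0" if "l < N False + 3" "u \<in> {C True 0..C True (N True)}" for l u
    using that by (simp add: Qc_def gam_def)
  have "\<gamma> (k, l) = 0" if "k < N True + 3" "l < N False + 3" for k l
    by (rule tpow_independent[where c = "C True" and m = "N True" and g = "\<lambda>k. \<gamma> (k, l)"])
      (use C_less N_pos that z in auto)
  then have "\<gamma> \<alpha> = 0" if "\<alpha> \<in> rng" for \<alpha> using that by (auto simp: rng_def)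
  then show ?thesis using assms(2) by (intro ext) blast
qed

lemma spline1_section:
  assumes f: "f \<in> spline_space 3 M" and v: "C (\<not> d) 0 \<le> v" "v \<le> C (\<not> d) (N (\<not> d))"
  shows "spline1 (C d) (N d) (\<lambda>u. f (mk d u v))"
proof -
  have "C_mixed 2 (domain M) f" using f by (simp add: spline_space_def)
  then obtain D where D: "D 0 0 = f"
    "\<forall>b<2. \<forall>x y. (x, y) \<in> domain M \<longrightarrow>
        ((\<lambda>t. D 0 b (x, t)) has_real_derivative D 0 (Suc b) (x, y)) (at y within {t. (x, t) \<in> domain M})"
    "\<forall>a<2. \<forall>b\<le>2. \<forall>x y. (x, y) \<in> domain M \<longrightarrow>
        ((\<lambda>s. D a b (s, y)) has_real_derivative D (Suc a) b (x, y)) (at x within {s. (s, y) \<in> domain M})"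
    unfolding C_mixed_def by blast
  define g where "g r u = (if d then D r 0 (u, v) else D 0 r (v, u))" for r u
  have set: "{u. mk d u v \<in> domain M} = {C d 0..C d (N d)}" using v by (auto simp: mk_domain_iff)
  have der: "(g r has_real_derivative g (Suc r) u) (at u within {C d 0..C d (N d)})" if "r < 2" "u \<in> {C d 0..C d (N d)}" for r u
  proof -
    have dom: "mk d u v \<in> domain M" using that v by (auto simp: mk_domain_iff)
    have "(g r has_real_derivative g (Suc r) u) (at u within {u. mk d u v \<in> domain M})"
      using D(2,3) that(1) dom by (cases d) (auto simp: g_def[abs_def] mk_def)
    then show ?thesis unfolding set .
  qed
  have g0: "g 0 = (\<lambda>u. f (mk d u v))" by (auto simp: g_def D(1) mk_def)
  have "\<exists>a. \<forall>u\<in>{C d i..C d (Suc i)}. f (mk d u v) = (\<Sum>e\<le>3. a e * u ^ e)" if i: "i < N d" for i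
  proof -
    obtain q where q: "q < N (\<not> d)" "C (\<not> d) q \<le> v" "v \<le> C (\<not> d) (Suc q)"
      using locate[of 0 "N (\<not> d)" "\<not> d" v] v N_pos by auto
    have "cell d i q \<in> M" using M_iff[of _ d] i q by blast
    then have bi: "bidegree_poly_on 3 (region (cell d i q)) f" using f by (simp add: spline_space_def)
    then obtain a where "\<forall>u. mk d u v \<in> region (cell d i q) \<longrightarrow> f (mk d u v) = (\<Sum>e\<le>3. a e * u ^ e)"
      using bidegree_line by blast
    then show ?thesis using cell_contains_unit(1)[OF i q(1) _ _ q(2,3)] by auto
  qed
  moreover have "\<forall>u\<in>{C d 0..C d (N d)}. (g 0 has_real_derivative g 1 u) (at u within {C d 0..C d (N d)}) \<and>
      (g 1 has_real_derivative g 2 u) (at u within {C d 0..C d (N d)})"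
    using der[of 0] der[of 1] by (simp add: numeral_2_eq_2)
  ultimately show ?thesis unfolding spline1_def g0 by blast
qed

lemma spline1_representation_C:
  "\<exists>W t. (\<forall>j<N d + 3. t j \<in> {C d 0..C d (N d)}) \<and>
    (\<forall>g. spline1 (C d) (N d) g \<longrightarrow> (\<forall>x\<in>{C d 0..C d (N d)}.
       g x = (\<Sum>k<N d + 3. (\<Sum>j<N d + 3. W k j * g (t j)) * tpow (C d) k x)))"
  by (rule spline1_representation[OF C_less N_pos])

text \<open>For fixed \<open>y\<close> the coefficients of the section in \<open>x\<close> are fixed
  combinations of finitely many values \<open>f (t j, y)\<close>. These are splines in
  \<open>y\<close>, to which the univariate representation applies again.\<close>

lemma spl_surj:
  assumes f: "f \<in> spline_space 3 M"
  shows "\<exists>\<gamma>. (\<forall>\<alpha>. \<alpha> \<notin> rng \<longrightarrow> \<gamma> \<alpha> = 0) \<and> f = spl \<gamma>"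
proof -
  obtain W t where Wt: "(\<forall>j<N True + 3. t j \<in> {C True 0..C True (N True)}) \<and>
    (\<forall>g. spline1 (C True) (N True) g \<longrightarrow> (\<forall>x\<in>{C True 0..C True (N True)}.
       g x = (\<Sum>k<N True + 3. (\<Sum>j<N True + 3. W k j * g (t j)) * tpow (C True) k x)))"
    using spline1_representation_C[of True] by (elim exE)
  obtain W' t' where Wt': "(\<forall>j<N False + 3. t' j \<in> {C False 0..C False (N False)}) \<and>
    (\<forall>g. spline1 (C False) (N False) g \<longrightarrow> (\<forall>x\<in>{C False 0..C False (N False)}.
       g x = (\<Sum>k<N False + 3. (\<Sum>j<N False + 3. W' k j * g (t' j)) * tpow (C False) k x)))"
    using spline1_representation_C[of False] by (elim exE)
  note t = conjunct1[OF Wt] and W = conjunct2[OF Wt, rule_format] and W' = conjunct2[OF Wt', rule_format]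
  define \<gamma> where "\<gamma> = (\<lambda>(k, l). if (k, l) \<in> rng then \<Sum>j<N True + 3. W k j * (\<Sum>j'<N False + 3. W' l j' * f (t j, t' j')) else 0)"
  have "f (x, y) = spl \<gamma> (x, y)" for x y
  proof (cases "(x, y) \<in> domain M")
    case True
    then have xy: "C True 0 \<le> x" "x \<le> C True (N True)" "C False 0 \<le> y" "y \<le> C False (N False)"
      using mk_domain_iff[of True x y] by (auto simp: mk_def)
    have sx: "spline1 (C True) (N True) (\<lambda>u. f (u, y))" using spline1_section[OF f, of True y] xy by (simp add: mk_def)
    have sy: "spline1 (C False) (N False) (\<lambda>v. f (t j, v))" if "j < N True + 3" for j
    proof -
      have "t j \<in> {C True 0..C True (N True)}" using t that by blast
      then show ?thesis using spline1_section[OF f, of False "t j"] by (simp add: mk_def)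
    qed
    have "f (x, y) = (\<Sum>k<N True + 3. (\<Sum>j<N True + 3. W k j * f (t j, y)) * tpow (C True) k x)"
      by (rule W[OF sx]) (use xy in simp)
    also have "\<dots> = (\<Sum>k<N True + 3. (\<Sum>j<N True + 3. W k j *
        (\<Sum>l<N False + 3. (\<Sum>j'<N False + 3. W' l j' * f (t j, t' j')) * tpow (C False) l y)) * tpow (C True) k x)"
    proof (intro sum.cong refl arg_cong2[where f = "(*)"])
      fix j assume "j \<in> {..<N True + 3}"
      then show "f (t j, y) = (\<Sum>l<N False + 3. (\<Sum>j'<N False + 3. W' l j' * f (t j, t' j')) * tpow (C False) l y)"
        by (intro W'[OF sy]) (use xy in auto)
    qed
    also have "\<dots> = (\<Sum>k<N True + 3. \<Sum>l<N False + 3. \<gamma> (k, l) * (tpow (C True) k x * tpow (C False) l y))"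
    proof (rule sum.cong[OF refl])
      fix k assume k: "k \<in> {..<N True + 3}"
      define G where "G j l = (\<Sum>j'<N False + 3. W' l j' * f (t j, t' j'))" for j l
      have "(\<Sum>j<N True + 3. W k j * (\<Sum>l<N False + 3. G j l * tpow (C False) l y)) * tpow (C True) k x
        = (\<Sum>l<N False + 3. (\<Sum>j<N True + 3. W k j * G j l) * (tpow (C True) k x * tpow (C False) l y))"
        unfolding sum_distrib_left sum_distrib_right by (subst sum.swap) (simp add: mult_ac)
      also have "\<dots> = (\<Sum>l<N False + 3. \<gamma> (k, l) * (tpow (C True) k x * tpow (C False) l y))"
        using k by (intro sum.cong) (auto simp: \<gamma>_def G_def rng_def)
      finally show "(\<Sum>j<N True + 3. W k j * (\<Sum>l<N False + 3. (\<Sum>j'<N False + 3. W' l j' * f (t j, t' j')) * tpow (C False) l y)) * tpow (C True) k x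
        = (\<Sum>l<N False + 3. \<gamma> (k, l) * (tpow (C True) k x * tpow (C False) l y))" unfolding G_def .
    qed
    also have "\<dots> = spl \<gamma> (x, y)" using True by (simp add: spl_def)
    finally show ?thesis .
  next
    case False
    then show ?thesis using f by (simp add: spl_def spline_space_def)
  qed
  moreover have "\<forall>\<alpha>. \<alpha> \<notin> rng \<longrightarrow> \<gamma> \<alpha> = 0" by (auto simp: \<gamma>_def)
  ultimately show ?thesis by (intro exI[of _ \<gamma>]) auto
qed

lemma spline_space_eq: "spline_space 3 M = spl ` {\<gamma>. (\<forall>\<alpha>. \<alpha> \<notin> rng \<longrightarrow> \<gamma> \<alpha> = 0) \<and> Zc \<gamma>}"
proof (intro equalityI subsetI)
  fix f assume f: "f \<in> spline_space 3 M"
  then obtain \<gamma> where g: "\<forall>\<alpha>. \<alpha> \<notin> rng \<longrightarrow> \<gamma> \<alpha> = 0" "f = spl \<gamma>" using spl_surj by blast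
  have "Zc \<gamma>" by (rule Zc_of_bidegree) (use f g in \<open>simp add: spline_space_def\<close>)
  then show "f \<in> spl ` {\<gamma>. (\<forall>\<alpha>. \<alpha> \<notin> rng \<longrightarrow> \<gamma> \<alpha> = 0) \<and> Zc \<gamma>}" using g by blast
next
  fix f assume "f \<in> spl ` {\<gamma>. (\<forall>\<alpha>. \<alpha> \<notin> rng \<longrightarrow> \<gamma> \<alpha> = 0) \<and> Zc \<gamma>}"
  then obtain \<gamma> where "Zc \<gamma>" "f = spl \<gamma>" by blast
  then show "f \<in> spline_space 3 M"
    using spl_bidegree C_mixed_spl by (auto simp: spline_space_def spl_def)
qed

end

section \<open>The dimension of the spline space in terms of dependencies\<close>

context hmesh
begin

text \<open>Normalizes the coefficient of \<open>x\<^bsup>3 - e\<^esup>\<close> in \<open>(x - t) ^ 3\<close> to \<open>t ^ e\<close>.\<close>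

definition wt :: "nat \<Rightarrow> real" where "wt e = 1 / (of_nat (3 choose e) * (- 1) ^ e)"

definition ori :: "bool \<Rightarrow> nat \<Rightarrow> nat \<Rightarrow> nat \<times> nat" where "ori d k l = (if d then (k, l) else (l, k))"

text \<open>The \<open>e\<close>-th condition of an l-edge: the \<open>e\<close>-th power sum over
  its inner grid lines, with the initial cubic added if it starts on the boundary. In this
  normalization the transposed matrix evaluates the polynomials \<open>pp\<close>, see
  \<open>sum_mat1\<close>.\<close>

definition mat1 :: "bool \<Rightarrow> nat \<Rightarrow> nat \<Rightarrow> nat \<Rightarrow> nat \<Rightarrow> real" where
  "mat1 d a b e k = (if k \<le> 3 then (if a = 0 \<and> k + e = 3 then wt e else 0)
     else if a \<le> k - 3 \<and> k - 3 \<le> b then C d (k - 3) ^ e else 0)"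

definition cmat :: "(bool \<times> nat \<times> nat \<times> nat) \<times> nat \<Rightarrow> nat \<times> nat \<Rightarrow> real" where
  "cmat = (\<lambda>((d, q, a, b), e) (k, l).
     if d then (if l = 3 + q then mat1 d a b e k else 0) else (if k = 3 + q then mat1 d a b e l else 0))"

text \<open>The coefficients that \<open>Zc\<close> does not force to be zero one by one, see
  \<open>Zc_adm\<close>.\<close>

definition adm :: "(nat \<times> nat) set" where
  "adm = {(k, l) \<in> rng. (k \<le> 3 \<and> 3 < l \<longrightarrow> U True 0 (l - 3)) \<and> (l \<le> 3 \<and> 3 < k \<longrightarrow> U False 0 (k - 3)) \<and>
     (3 < k \<and> 3 < l \<longrightarrow> vtx True (k - 3) (l - 3))}"

definition eqs :: "((bool \<times> nat \<times> nat \<times> nat) \<times> nat) set" where "eqs = (L - LN) \<times> {..3}"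

lemma mat_ori: "cmat ((d, q, a, b), e) (ori d k l) = (if l = 3 + q then mat1 d a b e k else 0)"
  by (auto simp: cmat_def ori_def)

lemma ori_swap: "ori (\<not> d) k l = ori d l k" by (simp add: ori_def)

lemma ori_adm: "ori d k l \<in> adm \<longleftrightarrow> k < N d + 3 \<and> l < N (\<not> d) + 3 \<and> (k \<le> 3 \<and> 3 < l \<longrightarrow> U d 0 (l - 3)) \<and>
    (l \<le> 3 \<and> 3 < k \<longrightarrow> U (\<not> d) 0 (k - 3)) \<and> (3 < k \<and> 3 < l \<longrightarrow> vtx d (k - 3) (l - 3))"
  using vtx_swap[of True] by (cases d) (auto simp: adm_def ori_def rng_def)

lemma gam_ori: "gam \<gamma> d k l = \<gamma> (ori d k l)" by (simp add: gam_def ori_def)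

lemma finite_adm: "finite adm" by (rule finite_subset[of _ rng]) (auto simp: adm_def rng_def)

lemma finite_eqs: "finite eqs" using finite_L by (simp add: eqs_def)

lemma wt_nz: "e \<le> 3 \<Longrightarrow> wt e \<noteq> 0" by (simp add: wt_def)

lemma coef_eq: "e \<le> 3 \<Longrightarrow> wt e * (of_nat (3 choose (3 - e)) * (- t) ^ e) = t ^ e"
  by (simp add: wt_def power_minus[of t] flip: binomial_symmetric)

text \<open>Up to the factor \<open>wt e\<close>, the coefficient of \<open>u ^ (3 - e)\<close> in
  the cubic that \<open>Qc\<close> is between the lines \<open>i\<close> and
  \<open>i + 1\<close>.\<close>

definition K :: "(nat \<Rightarrow> real) \<Rightarrow> bool \<Rightarrow> nat \<Rightarrow> nat \<Rightarrow> real" where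
  "K g d i e = wt e * g (3 - e) + (\<Sum>t\<in>{1..i}. g (3 + t) * C d t ^ e)"

lemma Qc_zero_iff:
  assumes i: "i < N d"
  shows "(\<forall>u. C d i \<le> u \<longrightarrow> u \<le> C d (Suc i) \<longrightarrow> Qc \<gamma> d l u = 0) \<longleftrightarrow> (\<forall>e\<le>3. K (\<lambda>k. gam \<gamma> d k l) d i e = 0)"
proof -
  let ?g = "\<lambda>k. gam \<gamma> d k l"
  define co where "co e = ?g e + (\<Sum>t\<in>{1..i}. ?g (3 + t) * (of_nat (3 choose e) * (- C d t) ^ (3 - e)))" for e
  have Q: "Qc \<gamma> d l u = (\<Sum>e\<le>3. co e * u ^ e)" if "C d i \<le> u" "u \<le> C d (Suc i)" for u
    unfolding Qc_def co_def cubic_plus_cubes[symmetric] using that i by (intro sum_tpow[OF C_less]) auto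
  have Kc: "K ?g d i e = wt e * co (3 - e)" if "e \<le> 3" for e
  proof -
    have eqn: "wt e * (?g (3 + t) * (of_nat (3 choose (3 - e)) * (- C d t) ^ (3 - (3 - e)))) = ?g (3 + t) * C d t ^ e" for t
      using coef_eq[OF that, of "C d t"] that by (simp add: mult.left_commute)
    show ?thesis unfolding K_def co_def distrib_left sum_distrib_left by (simp only: eqn)
  qed
  show ?thesis
  proof
    assume z: "\<forall>u. C d i \<le> u \<longrightarrow> u \<le> C d (Suc i) \<longrightarrow> Qc \<gamma> d l u = 0"
    have "co e = 0" if "e \<le> 3" for e
      by (rule cubic_zero_on_interval[OF _ _ that, of "C d i" "C d (Suc i)"]) (use z Q C_less[of i "Suc i" d] i in auto)
    then show "\<forall>e\<le>3. K ?g d i e = 0" using Kc by simp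
  next
    assume z: "\<forall>e\<le>3. K ?g d i e = 0"
    have "co e = 0" if "e \<le> 3" for e
      using z Kc[of "3 - e"] wt_nz[of "3 - e"] that by simp
    then show "\<forall>u. C d i \<le> u \<longrightarrow> u \<le> C d (Suc i) \<longrightarrow> Qc \<gamma> d l u = 0" using Q by simp
  qed
qed

lemma Zc_iff: "Zc \<gamma> \<longleftrightarrow> (\<forall>d i j. 0 < j \<longrightarrow> j < N (\<not> d) \<longrightarrow> i < N d \<longrightarrow> \<not> U d i j \<longrightarrow> (\<forall>e\<le>3. K (\<lambda>k. gam \<gamma> d k (3 + j)) d i e = 0))"
  unfolding Zc_def using Qc_zero_iff by blast

lemma K_pred: "0 < i \<Longrightarrow> K g d i e = K g d (i - 1) e + g (3 + i) * C d i ^ e"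
  unfolding K_def by (cases i) auto

lemma K_diff: "0 < a \<Longrightarrow> a \<le> b \<Longrightarrow> K g d b e - K g d (a - 1) e = (\<Sum>t\<in>{a..b}. g (3 + t) * C d t ^ e)"
proof -
  assume "0 < a" "a \<le> b"
  then have "{1..b} = {1..a - 1} \<union> {a..b}" "{1..a - 1} \<inter> {a..b} = {}" by auto
  then show ?thesis unfolding K_def by (simp add: sum.union_disjoint)
qed

text \<open>The row of an l-edge measures the change of \<open>K\<close> along it. An l-edge from
  the boundary has nothing before it, so there the row is \<open>K\<close> itself.\<close>

lemma mat_sum:
  assumes supp: "\<And>\<alpha>. \<alpha> \<notin> adm \<Longrightarrow> \<gamma> \<alpha> = 0" and t: "(d, q, a, b) \<in> L - LN" and e: "e \<le> 3"
  shows "(\<Sum>\<alpha>\<in>adm. cmat ((d, q, a, b), e) \<alpha> * \<gamma> \<alpha>) =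
    (if a = 0 then K (\<lambda>k. gam \<gamma> d k (3 + q)) d b e
     else K (\<lambda>k. gam \<gamma> d k (3 + q)) d b e - K (\<lambda>k. gam \<gamma> d k (3 + q)) d (a - 1) e)"
proof -
  define g where "g = (\<lambda>k. gam \<gamma> d k (3 + q))"
  have D: "0 < q" "q < N (\<not> d)" "a < b" "b < N d" using t L_D[of d q a b] by (auto simp: LN_def)
  have "(\<Sum>\<alpha>\<in>adm. cmat ((d, q, a, b), e) \<alpha> * \<gamma> \<alpha>) = (\<Sum>\<alpha>\<in>rng. cmat ((d, q, a, b), e) \<alpha> * \<gamma> \<alpha>)"
    by (rule sum.mono_neutral_left) (use supp in \<open>auto simp: adm_def rng_def\<close>)
  also have "\<dots> = (\<Sum>k<N d + 3. \<Sum>l<N (\<not> d) + 3. cmat ((d, q, a, b), e) (ori d k l) * gam \<gamma> d k l)"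
  proof (cases d)
    case True
    then show ?thesis unfolding rng_def by (simp add: sum.cartesian_product ori_def gam_def)
  next
    case False
    have "(\<Sum>\<alpha>\<in>rng. cmat ((d, q, a, b), e) \<alpha> * \<gamma> \<alpha>) = (\<Sum>l<N True + 3. \<Sum>k<N False + 3. cmat ((d, q, a, b), e) (l, k) * \<gamma> (l, k))"
      unfolding rng_def by (simp add: sum.cartesian_product)
    also have "\<dots> = (\<Sum>k<N False + 3. \<Sum>l<N True + 3. cmat ((d, q, a, b), e) (l, k) * \<gamma> (l, k))"
      by (rule sum.swap)
    finally show ?thesis using False by (simp add: ori_def gam_def)
  qed
  also have "\<dots> = (\<Sum>k<N d + 3. mat1 d a b e k * g k)"
  proof (rule sum.cong[OF refl])
    fix k
    have "(\<Sum>l<N (\<not> d) + 3. cmat ((d, q, a, b), e) (ori d k l) * gam \<gamma> d k l) =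
       (\<Sum>l<N (\<not> d) + 3. if l = 3 + q then mat1 d a b e k * g k else 0)"
      by (rule sum.cong) (auto simp: mat_ori g_def)
    then show "(\<Sum>l<N (\<not> d) + 3. cmat ((d, q, a, b), e) (ori d k l) * gam \<gamma> d k l) = mat1 d a b e k * g k"
      using D(2) by (simp add: sum.delta)
  qed
  also have "\<dots> = (\<Sum>k\<le>3. mat1 d a b e k * g k) + (\<Sum>j\<in>{1..<N d}. mat1 d a b e (3 + j) * g (3 + j))"
    using D by (intro sum_tpow_index) auto
  also have "(\<Sum>k\<le>3. mat1 d a b e k * g k) = (\<Sum>k\<le>3. if k = 3 - e then (if a = 0 then wt e * g (3 - e) else 0) else 0)"
    by (rule sum.cong) (use e in \<open>auto simp: mat1_def\<close>)
  also have "\<dots> = (if a = 0 then wt e * g (3 - e) else 0)" by (simp add: sum.delta)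
  also have "(\<Sum>j\<in>{1..<N d}. mat1 d a b e (3 + j) * g (3 + j)) = (\<Sum>j\<in>{max 1 a..b}. g (3 + j) * C d j ^ e)"
    by (rule sum.mono_neutral_cong_right) (use D in \<open>auto simp: mat1_def\<close>)
  also have "(if a = 0 then wt e * g (3 - e) else 0) + (\<Sum>j\<in>{max 1 a..b}. g (3 + j) * C d j ^ e) =
     (if a = 0 then K g d b e else K g d b e - K g d (a - 1) e)"
    using K_diff[of a b g d e] D by (auto simp: K_def)
  finally show ?thesis unfolding g_def .
qed

text \<open>With no unit edge before or after a grid point, \<open>K\<close> vanishes on both sides,
  and for \<open>e = 0\<close> the difference is the coefficient there. A line absent at the
  boundary has initial cubic zero.\<close>

lemma Zc_adm:
  assumes Z: "Zc \<gamma>" and supp: "\<And>\<alpha>. \<alpha> \<notin> rng \<Longrightarrow> \<gamma> \<alpha> = 0" and \<alpha>: "\<alpha> \<notin> adm"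
  shows "\<gamma> \<alpha> = 0"
proof -
  note Z' = Z[unfolded Zc_iff, rule_format]
  have poly: "\<gamma> (ori d k (3 + j)) = 0" if "k \<le> 3" "0 < j" "j < N (\<not> d)" "\<not> U d 0 j" for d k j
  proof -
    have "K (\<lambda>k. gam \<gamma> d k (3 + j)) d 0 (3 - k) = 0" using Z'[of j d 0 "3 - k"] that N_pos by simp
    then show ?thesis using that wt_nz[of "3 - k"] by (simp add: K_def gam_ori)
  qed
  have point: "\<gamma> (ori d (3 + i) (3 + j)) = 0" if "0 < i" "i < N d" "0 < j" "j < N (\<not> d)" "\<not> inc d i j" for d i j
  proof -
    have nU: "\<not> U d i j" "\<not> U d (i - 1) j" using that by (auto simp: inc_def)
    have "K (\<lambda>k. gam \<gamma> d k (3 + j)) d i 0 = 0" "K (\<lambda>k. gam \<gamma> d k (3 + j)) d (i - 1) 0 = 0"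
      using Z'[of j d i 0] Z'[of j d "i - 1" 0] nU that by auto
    then show ?thesis using K_pred[OF that(1), of "\<lambda>k. gam \<gamma> d k (3 + j)" d 0] by (simp add: gam_ori)
  qed
  show ?thesis
  proof (cases "\<alpha> \<in> rng")
    case True
    obtain k l where kl: "\<alpha> = (k, l)" by (cases \<alpha>)
    have r: "k < N True + 3" "l < N False + 3" using True by (auto simp: kl rng_def)
    consider "k \<le> 3" "3 < l" "\<not> U True 0 (l - 3)" | "l \<le> 3" "3 < k" "\<not> U False 0 (k - 3)"
      | "3 < k" "3 < l" "\<not> inc True (k - 3) (l - 3)" | "3 < k" "3 < l" "\<not> inc False (l - 3) (k - 3)"
      using \<alpha> True by (auto simp: adm_def kl vtx_def)
    then show ?thesis
    proof cases
      case 1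
      then show ?thesis using poly[of k "l - 3" True] r by (simp add: kl ori_def)
    next
      case 2
      then show ?thesis using poly[of l "k - 3" False] r by (simp add: kl ori_def)
    next
      case 3
      then show ?thesis using point[of "k - 3" True "l - 3"] r by (simp add: kl ori_def)
    next
      case 4
      then show ?thesis using point[of "l - 3" False "k - 3"] r by (simp add: kl ori_def)
    qed
  qed (use supp in simp)
qed

text \<open>For the converse one walks along a line: where edges are absent, \<open>K\<close> stays
  zero because the coefficients there are outside \<open>adm\<close>, and across an l-edge its
  condition restores the zero.\<close>

lemma Zc_eqs:
  "{\<gamma>. (\<forall>\<alpha>. \<alpha> \<notin> rng \<longrightarrow> \<gamma> \<alpha> = 0) \<and> Zc \<gamma>} =
   {\<gamma>. (\<forall>\<alpha>. \<alpha> \<notin> adm \<longrightarrow> \<gamma> \<alpha> = 0) \<and> (\<forall>\<beta>\<in>eqs. (\<Sum>\<alpha>\<in>adm. cmat \<beta> \<alpha> * \<gamma> \<alpha>) = 0)}"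
proof (intro equalityI subsetI)
  fix \<gamma> assume "\<gamma> \<in> {\<gamma>. (\<forall>\<alpha>. \<alpha> \<notin> rng \<longrightarrow> \<gamma> \<alpha> = 0) \<and> Zc \<gamma>}"
  then have s: "\<And>\<alpha>. \<alpha> \<notin> rng \<Longrightarrow> \<gamma> \<alpha> = 0" and Z: "Zc \<gamma>" by auto
  note Z' = Z[unfolded Zc_iff, rule_format]
  have sa: "\<gamma> \<alpha> = 0" if "\<alpha> \<notin> adm" for \<alpha> by (rule Zc_adm[OF Z s that])
  have "(\<Sum>\<alpha>\<in>adm. cmat \<beta> \<alpha> * \<gamma> \<alpha>) = 0" if \<beta>: "\<beta> \<in> eqs" for \<beta>
  proof -
    obtain d q a b e where b: "\<beta> = ((d, q, a, b), e)" "(d, q, a, b) \<in> L - LN" "e \<le> 3"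
      using \<beta> by (cases \<beta>) (auto simp: eqs_def)
    have D: "(d, q, a, b) \<in> L" "b < N d" using b(2) L_D(4)[of d q a b] by (auto simp: LN_def)
    note LD = L_D[OF D(1)]
    have 1: "K (\<lambda>k. gam \<gamma> d k (3 + q)) d b e = 0" using Z'[of q d b e] LD D(2) b(3) by simp
    have 2: "K (\<lambda>k. gam \<gamma> d k (3 + q)) d (a - 1) e = 0" if "a \<noteq> 0" using Z'[of q d "a - 1" e] LD b(3) that by simp
    show ?thesis using mat_sum[OF sa b(2,3)] 1 2 unfolding b(1) by simp
  qed
  then show "\<gamma> \<in> {\<gamma>. (\<forall>\<alpha>. \<alpha> \<notin> adm \<longrightarrow> \<gamma> \<alpha> = 0) \<and> (\<forall>\<beta>\<in>eqs. (\<Sum>\<alpha>\<in>adm. cmat \<beta> \<alpha> * \<gamma> \<alpha>) = 0)}" using sa by simp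
next
  fix \<gamma> assume "\<gamma> \<in> {\<gamma>. (\<forall>\<alpha>. \<alpha> \<notin> adm \<longrightarrow> \<gamma> \<alpha> = 0) \<and> (\<forall>\<beta>\<in>eqs. (\<Sum>\<alpha>\<in>adm. cmat \<beta> \<alpha> * \<gamma> \<alpha>) = 0)}"
  then have s: "\<And>\<alpha>. \<alpha> \<notin> adm \<Longrightarrow> \<gamma> \<alpha> = 0" and E: "\<And>\<beta>. \<beta> \<in> eqs \<Longrightarrow> (\<Sum>\<alpha>\<in>adm. cmat \<beta> \<alpha> * \<gamma> \<alpha>) = 0" by auto
  have main: "\<forall>e\<le>3. K (\<lambda>k. gam \<gamma> d k (3 + j)) d i e = 0"
    if j: "0 < j" "j < N (\<not> d)" and i: "i < N d" "\<not> U d i j" for d i j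
    using i
  proof (induction i rule: less_induct)
    case (less i)
    let ?g = "\<lambda>k. gam \<gamma> d k (3 + j)"
    show ?case
    proof (cases "i = 0")
      case True
      have "?g (3 - e) = 0" if "e \<le> 3" for e
        unfolding gam_ori by (rule s) (use less.prems True j in \<open>auto simp: ori_adm\<close>)
      then show ?thesis using True by (simp add: K_def)
    next
      case False
      show ?thesis
      proof (cases "U d (i - 1) j")
        case F: False
        have "?g (3 + i) = 0"
          unfolding gam_ori by (rule s) (use less.prems False F j in \<open>auto simp: ori_adm vtx_def inc_def\<close>)
        moreover have "\<forall>e\<le>3. K ?g d (i - 1) e = 0" using less.IH[of "i - 1"] less.prems False F by simp
        ultimately show ?thesis using K_pred[of i ?g d] False by simp
      next
        case T: True
        have "i - 1 < N d" using less.prems by simp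
        then obtain a b where ab: "(d, j, a, b) \<in> L" "a \<le> i - 1" "i - 1 < b" using L_exists[OF T _ j] by blast
        have bi: "b = i"
        proof (rule ccontr)
          assume "b \<noteq> i"
          then have "i < b" "a \<le> i" using ab False by auto
          then show False using L_D(5)[OF ab(1), of i] less.prems by simp
        qed
        have t: "(d, j, a, b) \<in> L - LN" using ab less.prems bi by (auto simp: LN_def)
        show ?thesis
        proof (intro allI impI)
          fix e :: nat assume e: "e \<le> 3"
          then have "((d, j, a, b), e) \<in> eqs" using t by (simp add: eqs_def)
          then have eq: "(if a = 0 then K ?g d b e else K ?g d b e - K ?g d (a - 1) e) = 0"
            using E[of "((d, j, a, b), e)"] mat_sum[OF s t e] by simp
          show "K ?g d i e = 0"
          proof (cases "a = 0")
            case True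
            then show ?thesis using eq bi by simp
          next
            case a0: False
            then have "K ?g d (a - 1) e = 0" using less.IH[of "a - 1"] L_D(6)[OF ab(1)] ab less.prems e by simp
            then show ?thesis using eq bi a0 by simp
          qed
        qed
      qed
    qed
  qed
  have "\<gamma> \<alpha> = 0" if "\<alpha> \<notin> rng" for \<alpha> using that by (intro s) (auto simp: adm_def)
  then show "\<gamma> \<in> {\<gamma>. (\<forall>\<alpha>. \<alpha> \<notin> rng \<longrightarrow> \<gamma> \<alpha> = 0) \<and> Zc \<gamma>}" unfolding Zc_iff using main by blast
qed

section \<open>The transposed system\<close>

lemma sum_mat1:
  "(\<Sum>e\<le>3. \<kappa> (t, e) * mat1 d a b e k) =
    (if k \<le> 3 then (if a = 0 then \<kappa> (t, 3 - k) * wt (3 - k) else 0) else if a \<le> k - 3 \<and> k - 3 \<le> b then pp \<kappa> t (C d (k - 3)) else 0)"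
proof (cases "k \<le> 3")
  case True
  have "(\<Sum>e\<le>3. \<kappa> (t, e) * mat1 d a b e k) = (\<Sum>e\<le>3. if e = 3 - k then (if a = 0 then \<kappa> (t, 3 - k) * wt (3 - k) else 0) else 0)"
    by (rule sum.cong) (use True in \<open>auto simp: mat1_def\<close>)
  then show ?thesis using True by (simp add: sum.delta)
next
  case False
  then show ?thesis by (auto simp: mat1_def pp_def)
qed

lemma sum_eqs:
  assumes "\<And>t e. t \<in> LN \<Longrightarrow> \<kappa> (t, e) = 0"
  shows "(\<Sum>\<beta>\<in>eqs. \<kappa> \<beta> * cmat \<beta> (ori d k l)) =
    (\<Sum>(q, a, b)\<in>{(q, a, b). (d, q, a, b) \<in> L \<and> l = 3 + q}. \<Sum>e\<le>3. \<kappa> ((d, q, a, b), e) * mat1 d a b e k) +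
    (\<Sum>(q, a, b)\<in>{(q, a, b). (\<not> d, q, a, b) \<in> L \<and> k = 3 + q}. \<Sum>e\<le>3. \<kappa> ((\<not> d, q, a, b), e) * mat1 (\<not> d) a b e l)"
proof -
  define S where "S t = (\<Sum>e\<le>3. \<kappa> (t, e) * cmat (t, e) (ori d k l))" for t
  have "(\<Sum>\<beta>\<in>eqs. \<kappa> \<beta> * cmat \<beta> (ori d k l)) = (\<Sum>t\<in>L - LN. S t)"
    unfolding eqs_def S_def by (simp add: sum.cartesian_product)
  also have "\<dots> = (\<Sum>t\<in>L. S t)"
    by (rule sum.mono_neutral_left) (use finite_L assms in \<open>auto simp: S_def\<close>)
  also have "L = {t \<in> L. fst t = d} \<union> {t \<in> L. fst t = (\<not> d)}" by auto
  also have "(\<Sum>t\<in>{t \<in> L. fst t = d} \<union> {t \<in> L. fst t = (\<not> d)}. S t) = (\<Sum>t\<in>{t \<in> L. fst t = d}. S t) + (\<Sum>t\<in>{t \<in> L. fst t = (\<not> d)}. S t)"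
    using finite_L by (intro sum.union_disjoint) auto
  also have "(\<Sum>t\<in>{t \<in> L. fst t = d}. S t) = (\<Sum>t\<in>Pair d ` {(q, a, b). (d, q, a, b) \<in> L \<and> l = 3 + q}. S t)"
    by (rule sum.mono_neutral_right) (use finite_L in \<open>auto simp: S_def mat_ori image_iff\<close>)
  also have "\<dots> = (\<Sum>(q, a, b)\<in>{(q, a, b). (d, q, a, b) \<in> L \<and> l = 3 + q}. \<Sum>e\<le>3. \<kappa> ((d, q, a, b), e) * mat1 d a b e k)"
    by (subst sum.reindex) (auto simp: S_def mat_ori inj_on_def intro!: sum.cong)
  also have "(\<Sum>t\<in>{t \<in> L. fst t = (\<not> d)}. S t) = (\<Sum>t\<in>Pair (\<not> d) ` {(q, a, b). (\<not> d, q, a, b) \<in> L \<and> k = 3 + q}. S t)"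
    by (rule sum.mono_neutral_right) (use finite_L mat_ori[of "\<not> d" _ _ _ _ l k] in \<open>auto simp: S_def ori_swap image_iff\<close>)
  also have "\<dots> = (\<Sum>(q, a, b)\<in>{(q, a, b). (\<not> d, q, a, b) \<in> L \<and> k = 3 + q}. \<Sum>e\<le>3. \<kappa> ((\<not> d, q, a, b), e) * mat1 (\<not> d) a b e l)"
    using mat_ori[of "\<not> d" _ _ _ _ l k] by (subst sum.reindex) (auto simp: S_def ori_swap inj_on_def intro!: sum.cong)
  finally show ?thesis .
qed

text \<open>By \<open>L_unique\<close> a single l-edge of each direction contains the vertex, so
  only two summands remain.\<close>

lemma vertex_sum:
  assumes h: "(d, q, a, b) \<in> L" "(\<not> d, q', a', b') \<in> L" "a \<le> q'" "q' \<le> b" "a' \<le> q" "q \<le> b'"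
  shows "(\<Sum>(r, a, b)\<in>{(r, a, b). (d, r, a, b) \<in> L \<and> 3 + q = 3 + r}. \<Sum>e\<le>3. \<kappa> ((d, r, a, b), e) * mat1 d a b e (3 + q')) +
    (\<Sum>(r, a, b)\<in>{(r, a, b). (\<not> d, r, a, b) \<in> L \<and> 3 + q' = 3 + r}. \<Sum>e\<le>3. \<kappa> ((\<not> d, r, a, b), e) * mat1 (\<not> d) a b e (3 + q)) =
    pp \<kappa> (d, q, a, b) (C d q') + pp \<kappa> (\<not> d, q', a', b') (C (\<not> d) q)"
proof -
  have one: "(\<Sum>(r, a, b)\<in>{(r, a, b). (d, r, a, b) \<in> L \<and> 3 + q = 3 + r}. \<Sum>e\<le>3. \<kappa> ((d, r, a, b), e) * mat1 d a b e (3 + i)) =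
     pp \<kappa> (d, q, a, b) (C d i)" if t: "(d, q, a, b) \<in> L" "a \<le> i" "i \<le> b" "0 < i" for d q a b i
  proof -
    have "(\<Sum>(r, a, b)\<in>{(r, a, b). (d, r, a, b) \<in> L \<and> 3 + q = 3 + r}. \<Sum>e\<le>3. \<kappa> ((d, r, a, b), e) * mat1 d a b e (3 + i)) =
      (\<Sum>(r, a, b)\<in>{(q, a, b)}. \<Sum>e\<le>3. \<kappa> ((d, r, a, b), e) * mat1 d a b e (3 + i))"
    proof (rule sum.mono_neutral_right)
      show "finite {(r, a, b). (d, r, a, b) \<in> L \<and> 3 + q = 3 + r}"
        by (rule finite_subset[OF _ finite_imageI[OF finite_L, of snd]]) (auto intro: rev_image_eqI)
      show "\<forall>x\<in>{(r, a, b). (d, r, a, b) \<in> L \<and> 3 + q = 3 + r} - {(q, a, b)}.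
         (case x of (r, a, b) \<Rightarrow> \<Sum>e\<le>3. \<kappa> ((d, r, a, b), e) * mat1 d a b e (3 + i)) = 0"
      proof
        fix z assume z: "z \<in> {(r, a, b). (d, r, a, b) \<in> L \<and> 3 + q = 3 + r} - {(q, a, b)}"
        then obtain x y where xy: "z = (q, x, y)" "(d, q, x, y) \<in> L" "(x, y) \<noteq> (a, b)" by auto
        have "\<not> (x \<le> i \<and> i \<le> y)" using L_unique[OF t(1) xy(2), of i] t(2,3) xy(3) by auto
        then show "(case z of (r, a, b) \<Rightarrow> \<Sum>e\<le>3. \<kappa> ((d, r, a, b), e) * mat1 d a b e (3 + i)) = 0"
          using sum_mat1[of \<kappa> "(d, q, x, y)" d x y "3 + i"] t(4) xy(1) by auto
      qed
    qed (use t in auto)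
    also have "\<dots> = pp \<kappa> (d, q, a, b) (C d i)" using sum_mat1[of \<kappa> "(d, q, a, b)" d a b "3 + i"] t by simp
    finally show ?thesis .
  qed
  show ?thesis using one[OF h(1,3,4)] one[OF h(2,5,6)] L_D(1)[OF h(1)] L_D(1)[OF h(2)] by simp
qed

text \<open>The columns of the matrix are read one by one. The column of a coefficient of an initial
  cubic involves only the l-edge that starts with it and forces its \<open>\<kappa>\<close> to be
  zero; the column of an interior vertex gives the vertex condition; the columns of bicubic
  monomials are zero.\<close>

lemma dependencies_eq_Wd:
  "{\<kappa>. (\<forall>\<beta>. \<beta> \<notin> eqs \<longrightarrow> \<kappa> \<beta> = 0) \<and> (\<forall>\<alpha>\<in>adm. (\<Sum>\<beta>\<in>eqs. \<kappa> \<beta> * cmat \<beta> \<alpha>) = 0)} = Wd"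
proof (intro equalityI subsetI)
  fix \<kappa> assume "\<kappa> \<in> {\<kappa>. (\<forall>\<beta>. \<beta> \<notin> eqs \<longrightarrow> \<kappa> \<beta> = 0) \<and> (\<forall>\<alpha>\<in>adm. (\<Sum>\<beta>\<in>eqs. \<kappa> \<beta> * cmat \<beta> \<alpha>) = 0)}"
  then have s: "\<And>t e. t \<notin> L - LN \<or> 3 < e \<Longrightarrow> \<kappa> (t, e) = 0"
    and E: "\<And>\<alpha>. \<alpha> \<in> adm \<Longrightarrow> (\<Sum>\<beta>\<in>eqs. \<kappa> \<beta> * cmat \<beta> \<alpha>) = 0" by (auto simp: eqs_def)
  have sN: "\<kappa> (t, e) = 0" if "t \<in> LN" for t e using s that by blast
  have s0: "\<kappa> (t, e) = 0" if t0: "t \<in> L0" for t e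
  proof (cases "3 < e")
    case False
    obtain d q b where t: "t = (d, q, 0, b)" "(d, q, 0, b) \<in> L" using t0 by (auto simp: L0_def)
    note D = L_D[OF t(2)]
    have "ori d (3 - e) (3 + q) \<in> adm" using D(1,2) D(5)[of 0] D(3) N_pos[of d] by (auto simp: ori_adm)
    note adm = this
    have "0 = (\<Sum>(q', a, b)\<in>{(q', a, b). (d, q', a, b) \<in> L \<and> 3 + q = 3 + q'}. \<Sum>e'\<le>3. \<kappa> ((d, q', a, b), e') * mat1 d a b e' (3 - e)) +
       (\<Sum>(q', a, b)\<in>{(q', a, b). (\<not> d, q', a, b) \<in> L \<and> 3 - e = 3 + q'}. \<Sum>e'\<le>3. \<kappa> ((\<not> d, q', a, b), e') * mat1 (\<not> d) a b e' (3 + q))"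
      by (rule trans[OF E[OF adm, symmetric] sum_eqs[where \<kappa> = \<kappa>, OF sN]])
    also have "{(q', a, b). (\<not> d, q', a, b) \<in> L \<and> 3 - e = 3 + q'} = {}" using L_D(1)[of "\<not> d"] by fastforce
    also have "(\<Sum>(q', a, b)\<in>{(q', a, b). (d, q', a, b) \<in> L \<and> 3 + q = 3 + q'}. \<Sum>e'\<le>3. \<kappa> ((d, q', a, b), e') * mat1 d a b e' (3 - e))
        = (\<Sum>(q', a, b)\<in>{(q, 0, b)}. \<Sum>e'\<le>3. \<kappa> ((d, q', a, b), e') * mat1 d a b e' (3 - e))"
    proof (rule sum.mono_neutral_right)
      show "finite {(q', a, b). (d, q', a, b) \<in> L \<and> 3 + q = 3 + q'}"
        by (rule finite_subset[OF _ finite_imageI[OF finite_L, of snd]]) (auto intro: rev_image_eqI)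
      show "\<forall>i\<in>{(q', a, b). (d, q', a, b) \<in> L \<and> 3 + q = 3 + q'} - {(q, 0, b)}.
         (case i of (q', a, b) \<Rightarrow> \<Sum>e'\<le>3. \<kappa> ((d, q', a, b), e') * mat1 d a b e' (3 - e)) = 0"
      proof
        fix z assume z: "z \<in> {(q', a, b). (d, q', a, b) \<in> L \<and> 3 + q = 3 + q'} - {(q, 0, b)}"
        obtain r x y where "z = (r, x, y)" by (cases z)
        then have xy: "z = (q, x, y)" "(d, q, x, y) \<in> L" "(x, y) \<noteq> (0, b)" using z by auto
        have "x \<noteq> 0"
        proof
          assume "x = 0"
          then show False using L_unique(2)[OF t(2) xy(2), of 0] xy(3) by auto
        qed
        then show "(case z of (q', a, b) \<Rightarrow> \<Sum>e'\<le>3. \<kappa> ((d, q', a, b), e') * mat1 d a b e' (3 - e)) = 0"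
          using sum_mat1[of \<kappa> "(d, q, x, y)" d x y "3 - e"] xy(1) by simp
      qed
    qed (use t in auto)
    also have "\<dots> + sum (\<lambda>(q', a, b). \<Sum>e'\<le>3. \<kappa> ((\<not> d, q', a, b), e') * mat1 (\<not> d) a b e' (3 + q)) {} = \<kappa> (t, e) * wt e"
      using False sum_mat1[of \<kappa> t d 0 b "3 - e"] by (simp add: t)
    finally show ?thesis using False wt_nz[of e] by simp
  qed (use s in simp)
  have sL: "\<kappa> (t, e) = 0" if "t \<notin> L" for t e using s that by blast
  have "pp \<kappa> (d, q, a, b) (C d q') + pp \<kappa> (\<not> d, q', a', b') (C (\<not> d) q) = 0"
    if h: "(d, q, a, b) \<in> L" "(\<not> d, q', a', b') \<in> L" "a \<le> q'" "q' \<le> b" "a' \<le> q" "q \<le> b'" for d q a b q' a' b'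
  proof -
    have "vtx d q' q" using L_inc[OF h(1,3,4)] L_inc[OF h(2,5,6)] by (simp add: vtx_def)
    then have "ori d (3 + q') (3 + q) \<in> adm" using L_D(1,2)[OF h(1)] L_D(1,2)[OF h(2)] by (simp add: ori_adm)
    from E[OF this] show ?thesis
      using sum_eqs[where \<kappa> = \<kappa> and d = d and k = "3 + q'" and l = "3 + q", OF sN] vertex_sum[OF h, of \<kappa>] by linarith
  qed
  then show "\<kappa> \<in> Wd" unfolding Wd_def using s s0 sN by blast
next
  fix \<kappa> assume W: "\<kappa> \<in> Wd"
  have s: "\<kappa> (t, e) = 0" if "t \<notin> L - L0 - LN \<or> 3 < e" for t e using W that unfolding Wd_def by blast
  have sN: "\<kappa> (t, e) = 0" if "t \<in> LN" for t e using s that by blast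
  have s0: "\<kappa> (t, e) = 0" if "t \<in> L0" for t e using s that by blast
  have low: "(\<Sum>e\<le>3. \<kappa> ((d, q, a, b), e) * mat1 d a b e k) = 0" if "k \<le> 3" "(d, q, a, b) \<in> L" for d q a b k
    using that s0[of "(d, q, a, b)"] unfolding sum_mat1 by (auto simp: L0_def)
  have "(\<Sum>\<beta>\<in>eqs. \<kappa> \<beta> * cmat \<beta> \<alpha>) = 0" if \<alpha>: "\<alpha> \<in> adm" for \<alpha>
  proof -
    obtain k l where kl: "\<alpha> = ori True k l" by (cases \<alpha>) (auto simp: ori_def)
    have A: "k < N True + 3" "l < N False + 3" "3 < k \<and> 3 < l \<longrightarrow> vtx True (k - 3) (l - 3)"
      using \<alpha> unfolding kl ori_adm by auto
    show ?thesis
    proof (cases "3 < k \<and> 3 < l")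
      case True
      define i where "i = k - 3"
      define j where "j = l - 3"
      have ij: "k = 3 + i" "l = 3 + j" "0 < i" "i < N True" "0 < j" "j < N False" "vtx True i j"
        using True A by (auto simp: i_def j_def)
      obtain a b where h: "(True, j, a, b) \<in> L" "a \<le> i" "i \<le> b"
        using L_exists_inc[of True i j] ij by (auto simp: vtx_def)
      obtain a' b' where v: "(False, i, a', b') \<in> L" "a' \<le> j" "j \<le> b'"
        using L_exists_inc[of False j i] ij by (auto simp: vtx_def)
      have v': "(\<not> True, i, a', b') \<in> L" using v by simp
      show ?thesis
        using sum_eqs[where \<kappa> = \<kappa> and d = True and k = k and l = l, OF sN]
          vertex_sum[OF h(1) v' h(2,3) v(2,3), of \<kappa>] WdD(3)[OF W h(1) v' h(2,3) v(2,3)]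
        unfolding kl ij(1,2) by linarith
    next
      case False
      have z1: "(case x of (q, a, b) \<Rightarrow> \<Sum>e\<le>3. \<kappa> ((True, q, a, b), e) * mat1 True a b e k) = 0"
        if x: "x \<in> {(q, a, b). (True, q, a, b) \<in> L \<and> l = 3 + q}" for x
      proof -
        obtain q a b where x': "x = (q, a, b)" "(True, q, a, b) \<in> L" "l = 3 + q" using x by auto
        then have "k \<le> 3" using False L_D(1)[OF x'(2)] by auto
        then show ?thesis using low x' by simp
      qed
      have z2: "(case x of (q, a, b) \<Rightarrow> \<Sum>e\<le>3. \<kappa> ((\<not> True, q, a, b), e) * mat1 (\<not> True) a b e l) = 0"
        if x: "x \<in> {(q, a, b). (\<not> True, q, a, b) \<in> L \<and> k = 3 + q}" for x
      proof -
        obtain q a b where x': "x = (q, a, b)" "(False, q, a, b) \<in> L" "k = 3 + q" using x by auto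
        then have "l \<le> 3" using False L_D(1)[OF x'(2)] by auto
        then show ?thesis using low x' by simp
      qed
      have "(\<Sum>(q, a, b)\<in>{(q, a, b). (True, q, a, b) \<in> L \<and> l = 3 + q}.
          \<Sum>e\<le>3. \<kappa> ((True, q, a, b), e) * mat1 True a b e k) = 0"
        by (rule sum.neutral, rule ballI, rule z1)
      moreover have "(\<Sum>(q, a, b)\<in>{(q, a, b). (\<not> True, q, a, b) \<in> L \<and> k = 3 + q}.
          \<Sum>e\<le>3. \<kappa> ((\<not> True, q, a, b), e) * mat1 (\<not> True) a b e l) = 0"
        by (rule sum.neutral, rule ballI, rule z2)
      ultimately show ?thesis
        using sum_eqs[where \<kappa> = \<kappa> and d = True and k = k and l = l, OF sN]
        unfolding kl by linarith
    qed
  qed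
  then show "\<kappa> \<in> {\<kappa>. (\<forall>\<beta>. \<beta> \<notin> eqs \<longrightarrow> \<kappa> \<beta> = 0) \<and> (\<forall>\<alpha>\<in>adm. (\<Sum>\<beta>\<in>eqs. \<kappa> \<beta> * cmat \<beta> \<alpha>) = 0)}"
    using s by (auto simp: eqs_def)
qed

section \<open>Counting conditions and unknowns\<close>

lemma card_eqs: "card eqs = 4 * (card L - card LN)"
  using finite_L L0_sub by (simp add: eqs_def card_cartesian_product card_Diff_subset finite_subset)

lemma card_adm: "card adm = 16 + 4 * card L0 + card Vint"
proof -
  let ?T = "{(d, q). 0 < q \<and> q < N (\<not> d) \<and> U d 0 q}"
  let ?f = "\<lambda>((d, q), e). ori d e (3 + q)"
  let ?g = "\<lambda>(i, j). (3 + i, 3 + j)"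
  have fT: "finite ?T"
  proof (rule finite_subset)
    show "?T \<subseteq> UNIV \<times> {..max (N True) (N False)}"
    proof (clarify, goal_cases)
      case (1 d q)
      then show ?case by (cases d) auto
    qed
  qed auto
  have "adm = {..3} \<times> {..3} \<union> ?f ` (?T \<times> {..3}) \<union> ?g ` Vint"
  proof (intro equalityI subsetI)
    fix \<alpha> assume a: "\<alpha> \<in> adm"
    obtain k l where kl: "\<alpha> = (k, l)" by (cases \<alpha>)
    have A: "k < N True + 3" "l < N False + 3" "k \<le> 3 \<and> 3 < l \<longrightarrow> U True 0 (l - 3)" "l \<le> 3 \<and> 3 < k \<longrightarrow> U False 0 (k - 3)"
      "3 < k \<and> 3 < l \<longrightarrow> vtx True (k - 3) (l - 3)"
      using a by (auto simp: kl adm_def rng_def)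
    consider "k \<le> 3" "l \<le> 3" | "k \<le> 3" "3 < l" | "3 < k" "l \<le> 3" | "3 < k" "3 < l" by linarith
    then show "\<alpha> \<in> {..3} \<times> {..3} \<union> ?f ` (?T \<times> {..3}) \<union> ?g ` Vint"
    proof cases
      case 1
      then show ?thesis by (simp add: kl)
    next
      case 2
      then have "((True, l - 3), k) \<in> ?T \<times> {..3}" "\<alpha> = ?f ((True, l - 3), k)" using A by (auto simp: kl ori_def)
      then show ?thesis by blast
    next
      case 3
      then have "((False, k - 3), l) \<in> ?T \<times> {..3}" "\<alpha> = ?f ((False, k - 3), l)" using A by (auto simp: kl ori_def)
      then show ?thesis by blast
    next
      case 4
      then have "(k - 3, l - 3) \<in> Vint" "\<alpha> = ?g (k - 3, l - 3)" using A by (auto simp: kl Vint_def)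
      then show ?thesis by blast
    qed
  next
    fix \<alpha> assume "\<alpha> \<in> {..3} \<times> {..3} \<union> ?f ` (?T \<times> {..3}) \<union> ?g ` Vint"
    then consider "\<alpha> \<in> {..3} \<times> {..3}" | "\<alpha> \<in> ?f ` (?T \<times> {..3})" | "\<alpha> \<in> ?g ` Vint" by blast
    then show "\<alpha> \<in> adm"
    proof cases
      case 1
      then show ?thesis using N_pos[of True] N_pos[of False] by (auto simp: adm_def rng_def)
    next
      case 2
      then obtain d q e where "\<alpha> = ori d e (3 + q)" "0 < q" "q < N (\<not> d)" "U d 0 q" "e \<le> 3" by auto
      then show ?thesis using N_pos[of d] by (simp add: ori_adm)
    next
      case 3
      then show ?thesis by (auto simp: adm_def rng_def Vint_def)
    qed
  qed
  moreover have "card ({..3 :: nat} \<times> {..3 :: nat}) = 16" by (simp add: card_cartesian_product)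
  moreover have "inj_on ?f (?T \<times> {..3})" by (auto simp: inj_on_def ori_def split: if_splits)
  then have "card (?f ` (?T \<times> {..3})) = 4 * card L0"
    by (subst card_image) (simp_all add: card_cartesian_product card_L0)
  moreover have "inj_on ?g Vint" by (auto simp: inj_on_def)
  then have "card (?g ` Vint) = card Vint" by (rule card_image)
  moreover have "({..3} \<times> {..3}) \<inter> ?f ` (?T \<times> {..3}) = {}" by (auto simp: ori_def split: if_splits)
  moreover have "({..3} \<times> {..3} \<union> ?f ` (?T \<times> {..3})) \<inter> ?g ` Vint = {}"
    by (auto simp: ori_def Vint_def split: if_splits)
  ultimately show ?thesis using fT finite_V(1) by (simp add: card_Un_disjoint)
qed

lemma dim_spline_space:
  assumes "has_dim Wd \<delta>"
  shows "fv.dim (spline_space 3 M) + 4 * card L = 16 + 4 * card L0 + 4 * card LN + card Vint + \<delta>"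
proof -
  obtain k where k: "has_dim {\<gamma>. (\<forall>\<alpha>. \<alpha> \<notin> adm \<longrightarrow> \<gamma> \<alpha> = 0) \<and> (\<forall>\<beta>\<in>eqs. (\<Sum>\<alpha>\<in>adm. cmat \<beta> \<alpha> * \<gamma> \<alpha>) = 0)} k"
    "k + card eqs = card adm + \<delta>"
    using has_dim_solutions[of adm eqs cmat \<delta>] assms finite_adm finite_eqs unfolding dependencies_eq_Wd by blast
  have "has_dim (spline_space 3 M) k"
    unfolding spline_space_eq
  proof (rule has_dim_image)
    show "has_dim {\<gamma>. (\<forall>\<alpha>. \<alpha> \<notin> rng \<longrightarrow> \<gamma> \<alpha> = 0) \<and> Zc \<gamma>} k" unfolding Zc_eqs by (rule k)
    show "spl (\<lambda>x. g x + h x) = (\<lambda>x. spl g x + spl h x)" for g h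
      by (auto simp: spl_def fun_eq_iff distrib_right sum.distrib)
    show "spl (\<lambda>x. c * g x) = (\<lambda>x. c * spl g x)" for c g
      by (auto simp: spl_def fun_eq_iff sum_distrib_left mult.assoc)
    fix g assume "g \<in> {\<gamma>. (\<forall>\<alpha>. \<alpha> \<notin> rng \<longrightarrow> \<gamma> \<alpha> = 0) \<and> Zc \<gamma>}" "spl g = (\<lambda>_. 0)"
    then show "g = (\<lambda>_. 0)" using spl_eq_0 by blast
  qed
  then have "fv.dim (spline_space 3 M) = k" by (rule has_dim_imp_dim)
  moreover have "card LN \<le> card L" using L0_sub finite_L by (simp add: card_mono)
  ultimately show ?thesis using k(2) unfolding card_eqs card_adm by simp
qed

end

section \<open>Hierarchical T-meshes as meshes on an integer grid\<close>

text \<open>Each knot interval is cut into \<open>2 ^ n\<close> equal parts, as fine as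
  \<open>n\<close> bisections can get. The last knot has no successor and falls under
  \<open>else\<close>.\<close>

definition refined :: "nat \<Rightarrow> real list \<Rightarrow> nat \<Rightarrow> real" where
  "refined n zs i = (let q = i div 2 ^ n in
     if Suc q < length zs then zs ! q + real (i mod 2 ^ n) / 2 ^ n * (zs ! Suc q - zs ! q) else zs ! q)"

lemma refined_affine:
  assumes "q * 2 ^ n \<le> i" "i \<le> Suc q * 2 ^ n" "Suc q < length zs"
  shows "refined n zs i = zs ! q + (real i - real q * 2 ^ n) / 2 ^ n * (zs ! Suc q - zs ! q)"
proof (cases "i = Suc q * 2 ^ n")
  case True
  then have "i div 2 ^ n = Suc q" "i mod 2 ^ n = 0" by simp_all
  then show ?thesis unfolding refined_def Let_def by (simp add: True algebra_simps)
next
  case False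
  then have "i < Suc q * 2 ^ n" using assms(2) by simp
  then have "i div 2 ^ n = q" using assms(1) by (intro div_nat_eqI) (simp_all add: mult.commute)
  moreover from this have "i = q * 2 ^ n + i mod 2 ^ n" by (metis div_mult_mod_eq)
  then have "real i = real q * 2 ^ n + real (i mod 2 ^ n)" by (metis of_nat_add of_nat_mult of_nat_numeral of_nat_power)
  ultimately show ?thesis unfolding refined_def Let_def using assms(3) by simp
qed

lemma refined_knot: "q < length zs \<Longrightarrow> refined n zs (2 ^ n * q) = zs ! q"
  unfolding refined_def Let_def by simp

lemma refined_less:
  assumes zs: "sorted_wrt (<) zs" and "i < j" "j \<le> (length zs - 1) * 2 ^ n"
  shows "refined n zs i < refined n zs j"
proof -
  have step: "refined n zs i < refined n zs (Suc i)" if i: "Suc i \<le> (length zs - 1) * 2 ^ n" for i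
  proof -
    define q where "q = i div 2 ^ n"
    have "i < (length zs - 1) * 2 ^ n" using i by simp
    then have "q < length zs - 1" unfolding q_def by (simp add: less_mult_imp_div_less)
    then have q: "Suc q < length zs" by simp
    have "q * 2 ^ n \<le> i" unfolding q_def by simp
    moreover have "i < Suc q * 2 ^ n" unfolding q_def using dividend_less_times_div[of "2 ^ n" i] by (simp add: algebra_simps)
    ultimately have "refined n zs i = zs ! q + (real i - real q * 2 ^ n) / 2 ^ n * (zs ! Suc q - zs ! q)"
      "refined n zs (Suc i) = zs ! q + (real (Suc i) - real q * 2 ^ n) / 2 ^ n * (zs ! Suc q - zs ! q)"
      using q by (intro refined_affine; simp)+
    moreover have "zs ! q < zs ! Suc q" using zs q by (simp add: sorted_wrt_nth_less)
    then have "(real i - real q * 2 ^ n) / 2 ^ n * (zs ! Suc q - zs ! q) < (real (Suc i) - real q * 2 ^ n) / 2 ^ n * (zs ! Suc q - zs ! q)"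
      by (intro mult_strict_right_mono divide_strict_right_mono) auto
    ultimately show ?thesis by simp
  qed
  show ?thesis using assms(2,3)
  proof (induction j)
    case (Suc j)
    show ?case
    proof (cases "i = j")
      case True
      then show ?thesis using step Suc.prems by simp
    next
      case False
      then have "refined n zs i < refined n zs j" using Suc by simp
      also have "\<dots> < refined n zs (Suc j)" using step Suc.prems by simp
      finally show ?thesis .
    qed
  qed simp
qed

text \<open>A dyadic box never straddles a knot, and between knots \<open>refined\<close> is affine,
  so index midpoints are geometric midpoints.\<close>

lemma refined_mid:
  assumes s: "2 * s dvd 2 ^ n" "2 * s dvd a" "a + 2 * s \<le> (length zs - 1) * 2 ^ n" "0 < s"
  shows "refined n zs (a + s) = (refined n zs a + refined n zs (a + 2 * s)) / 2"
proof -
  define q where "q = a div 2 ^ n"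
  have "a < (length zs - 1) * 2 ^ n" using assms by simp
  then have "q < length zs - 1" unfolding q_def by (simp add: less_mult_imp_div_less)
  then have q: "Suc q < length zs" by simp
  have lo: "q * 2 ^ n \<le> a" unfolding q_def by simp
  have "a < Suc q * 2 ^ n" unfolding q_def using dividend_less_times_div[of "2 ^ n" a] by (simp add: algebra_simps)
  moreover have "2 * s dvd Suc q * 2 ^ n" using s(1) by (rule dvd_mult)
  ultimately have hi: "a + 2 * s \<le> Suc q * 2 ^ n" using s(2) by (intro dvd_less_add)
  define \<delta> where "\<delta> = (zs ! Suc q - zs ! q) / 2 ^ n"
  have R: "refined n zs i = zs ! q + (real i - real q * 2 ^ n) * \<delta>" if "a \<le> i" "i \<le> a + 2 * s" for i
    using that lo hi q refined_affine[of q n i zs] by (simp add: \<delta>_def)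
  show ?thesis using R[of a] R[of "a + s"] R[of "a + 2 * s"] by (simp add: algebra_simps)
qed

section \<open>The stages of a hierarchy as one level function\<close>

definition boxc :: "(bool \<Rightarrow> nat \<Rightarrow> real) \<Rightarrow> nat \<Rightarrow> nat \<Rightarrow> nat \<Rightarrow> cell" where
  "boxc C s i j = ((C True (s * (i div s)), C False (s * (j div s))),
     (C True (s * (i div s) + s), C False (s * (j div s) + s)))"

lemma (in hmesh) M_boxc: "M = {boxc C (w (lev i j)) i j | i j. i < N True \<and> j < N False}"
  unfolding M_def cell_def boxc_def lo_def lv_def mk_def by simp

lemma (in hmesh) box_le_N:
  assumes "i < N d" shows "w l * (i div w l) + w l \<le> N d"
proof -
  have "w l * (i div w l) < N d" using assms by (meson le_less_trans times_div_less_eq_dividend)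
  then show ?thesis using w_dvd_N by (intro dvd_less_add) auto
qed

lemma (in hmesh) boxc_eq:
  assumes "i < N True" "j < N False" "i' < N True" "j' < N False" "l \<le> n" "l' \<le> n"
    "boxc C (w l) i j = boxc C (w l') i' j'"
  shows "l = l'" "i div w l = i' div w l" "j div w l = j' div w l"
proof -
  have a: "w l * (i div w l) = w l' * (i' div w l')" "w l * (i div w l) + w l = w l' * (i' div w l') + w l'"
    "w l * (j div w l) = w l' * (j' div w l')"
    using assms(7) box_le_N[OF assms(1), of l] box_le_N[OF assms(2), of l] box_le_N[OF assms(3), of l'] box_le_N[OF assms(4), of l']
    by (auto simp: boxc_def C_eq_iff)
  then have "w l = w l'" by simp
  then have "n - l = n - l'" unfolding w_def by (simp add: power_inject_exp)
  then show l: "l = l'" using assms(5,6) by simp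
  show "i div w l = i' div w l" "j div w l = j' div w l" using a l by auto
qed

text \<open>The box of width \<open>h\<close> around \<open>i\<close> is the left or the right half
  of the box of width \<open>2 * h\<close>; this finds the subcell that contains a unit
  square.\<close>

lemma div_cases_half:
  fixes h i :: nat
  assumes "0 < h"
  shows "h * (i div h) = 2 * h * (i div (2 * h)) \<or> h * (i div h) = 2 * h * (i div (2 * h)) + h"
proof -
  have "i div h = 2 * (i div (2 * h)) + (i div h) mod 2" by (simp add: div_mult2_eq mult.commute)
  moreover have "(i div h) mod 2 = 0 \<or> (i div h) mod 2 = 1" by auto
  ultimately have "i div h = 2 * (i div (2 * h)) \<or> i div h = 2 * (i div (2 * h)) + 1" by linarith
  then show ?thesis
  proof
    assume e: "i div h = 2 * (i div (2 * h))"
    show ?thesis unfolding e by simp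
  next
    assume e: "i div h = 2 * (i div (2 * h)) + 1"
    show ?thesis unfolding e by (simp add: algebra_simps)
  qed
qed

text \<open>Each stage raises the level function by one on the subdivided cells. Truncating it with
  \<open>min k\<close> gives back the earlier stages, so a single function encodes the whole
  sequence.\<close>

lemma hierarchical_stages:
  fixes C :: "bool \<Rightarrow> nat \<Rightarrow> real" and N :: "bool \<Rightarrow> nat" and T :: "nat \<Rightarrow> cell set"
  assumes base: "hmesh C N n (\<lambda>_ _. 0)" "T 0 = hmesh.M C N n (\<lambda>_ _. 0)"
    and mid: "\<And>d s a. 2 * s dvd 2 ^ n \<Longrightarrow> 2 * s dvd a \<Longrightarrow> 0 < s \<Longrightarrow> a + 2 * s \<le> N d \<Longrightarrow> C d (a + s) = (C d a + C d (a + 2 * s)) / 2"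
    and stages: "\<And>k. k < n \<Longrightarrow> \<exists>D. D \<subseteq> level_cells T k \<and> T (Suc k) = (T k - D) \<union> (\<Union>c\<in>D. subdivide c)"
    and "m \<le> n"
  shows "\<exists>lev. (\<forall>i j. lev i j \<le> m) \<and> hmesh C N n lev \<and> (\<forall>k\<le>m. T k = hmesh.M C N n (\<lambda>i j. min k (lev i j)))"
  using \<open>m \<le> n\<close>
proof (induction m)
  case 0
  show ?case using base by (intro exI[of _ "\<lambda>_ _. 0"]) simp
next
  case (Suc m)
  then obtain lev where lev: "\<And>i j. lev i j \<le> m" "hmesh C N n lev" "\<And>k. k \<le> m \<Longrightarrow> T k = hmesh.M C N n (\<lambda>i j. min k (lev i j))"
    by auto
  interpret H: hmesh C N n lev by (rule lev(2))
  obtain D where D: "D \<subseteq> level_cells T m" "T (Suc m) = (T m - D) \<union> (\<Union>c\<in>D. subdivide c)" using stages[of m] Suc.prems by auto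
  define h :: nat where "h = 2 ^ (n - Suc m)"
  have wm: "H.w m = 2 * h" "H.w (Suc m) = h" "0 < h"
    using Suc.prems H.w_Suc[of m] by (auto simp: h_def H.w_def)
  have Tk: "T k = {boxc C (H.w (min k (lev i j))) i j | i j. i < N True \<and> j < N False}" if "k \<le> m" for k
    unfolding lev(3)[OF that] hmesh.M_boxc[OF H.hmesh_min] ..
  have Tm: "T m = {boxc C (H.w (lev i j)) i j | i j. i < N True \<and> j < N False}"
    unfolding Tk[OF le_refl] using lev(1) by (simp add: min_absorb2)
  \<comment> \<open>A cell of stage \<open>m\<close> with a smaller level would already belong to
    the previous stage, so it would not be in \<open>level_cells T m\<close>.\<close>
  have Dlev: "\<exists>i j. i < N True \<and> j < N False \<and> lev i j = m \<and> c = boxc C (H.w m) i j" if "c \<in> D" for c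
  proof (cases m)
    case 0
    then have "c \<in> T m" using that D(1) by auto
    then show ?thesis using Tm lev(1) 0 by auto
  next
    case (Suc m')
    then have c: "c \<in> T m" "c \<notin> T m'" using that D(1) by auto
    obtain i j where ij: "i < N True" "j < N False" "c = boxc C (H.w (lev i j)) i j" using c(1) Tm by auto
    have "lev i j = m"
    proof (rule ccontr)
      assume "lev i j \<noteq> m"
      then have "min m' (lev i j) = lev i j" using lev(1)[of i j] Suc by auto
      moreover have "m' \<le> m" using Suc by simp
      moreover from calculation have "c = boxc C (H.w (min m' (lev i j))) i j" using ij by simp
      ultimately have "c \<in> T m'" unfolding Tk[OF \<open>m' \<le> m\<close>] using ij(1,2) by blast
      then show False using c(2) by simp
    qed
    then show ?thesis using ij by auto
  qed
  define lev' where "lev' i j = (if lev i j = m \<and> boxc C (H.w m) i j \<in> D then Suc m else lev i j)" for i j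
  have same: "lev i' j' = m" if "lev i j = m" "i' div H.w m = i div H.w m" "j' div H.w m = j div H.w m" for i j i' j'
    using H.lv_same_cell[of i' True i j j'] that by (simp add: H.lv_def)
  have boxc_same: "boxc C s i j = boxc C s i' j'" if "i div s = i' div s" "j div s = j' div s" for s i j i' j'
    using that by (simp add: boxc_def)
  have H': "hmesh C N n lev'"
  proof
    fix i j show "lev' i j \<le> n" using lev(1)[of i j] Suc.prems by (simp add: lev'_def)
  next
    fix i i' j j' k assume *: "i div 2 ^ (n - k) = i' div 2 ^ (n - k)" "j div 2 ^ (n - k) = j' div 2 ^ (n - k)" "k < lev' i j"
    show "k < lev' i' j'"
    proof (cases "k = m")
      case True
      then have ij: "lev i j = m" "boxc C (H.w m) i j \<in> D" using * lev(1)[of i j] by (auto simp: lev'_def split: if_splits)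
      have dv: "i div H.w m = i' div H.w m" "j div H.w m = j' div H.w m" using * True by (simp_all add: H.w_def)
      have "lev i' j' = m" using same[OF ij(1)] dv by simp
      moreover have "boxc C (H.w m) i' j' \<in> D" using ij(2) boxc_same[OF dv] by simp
      ultimately show ?thesis using True by (simp add: lev'_def)
    next
      case False
      then have "k < lev i j" "k < m" using * lev(1)[of i j] by (auto simp: lev'_def split: if_splits)
      then have "k < lev i' j'" using H.lev_box[OF *(1,2)] by simp
      then show ?thesis using \<open>k < m\<close> by (simp add: lev'_def)
    qed
  qed (use H.C_less H.N_pos H.N_dvd in auto)
  have midC: "(C d (2 * h * q) + C d (2 * h * q + 2 * h)) / 2 = C d (2 * h * q + h)" if "2 * h * q + 2 * h \<le> N d" for d q
  proof (rule mid[symmetric, OF _ _ wm(3) that])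
    show "2 * h dvd 2 ^ n" using wm(1) by (metis H.w_def diff_le_self le_imp_power_dvd)
  qed simp
  have sub: "subdivide (boxc C (H.w m) i j) = {((C True x, C False y), (C True (x + h), C False (y + h))) | x y.
      (x = 2 * h * (i div (2 * h)) \<or> x = 2 * h * (i div (2 * h)) + h) \<and> (y = 2 * h * (j div (2 * h)) \<or> y = 2 * h * (j div (2 * h)) + h)}"
    if ij: "i < N True" "j < N False" for i j
  proof -
    have m1: "(C True (2 * h * (i div (2 * h))) + C True (2 * h * (i div (2 * h)) + 2 * h)) / 2 = C True (2 * h * (i div (2 * h)) + h)"
      using H.box_le_N[OF ij(1), of m] by (intro midC) (simp add: wm)
    have m2: "(C False (2 * h * (j div (2 * h))) + C False (2 * h * (j div (2 * h)) + 2 * h)) / 2 = C False (2 * h * (j div (2 * h)) + h)"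
      using H.box_le_N[OF ij(2), of m] by (intro midC) (simp add: wm)
    have hh: "x + 2 * h = x + h + h" for x by simp
    show ?thesis
      unfolding boxc_def wm subdivide.simps Let_def m1 m2 unfolding hh by blast
  qed
  have boxh: "boxc C h x' y' = ((C True x, C False y), (C True (x + h), C False (y + h)))"
    if "h * (x' div h) = x" "h * (y' div h) = y" for x y x' y' using that by (simp add: boxc_def)
  have M': "hmesh.M C N n lev' = {boxc C (H.w (lev' i j)) i j | i j. i < N True \<and> j < N False}"
    unfolding hmesh.M_boxc[OF H'] ..
  have "T (Suc m) = hmesh.M C N n lev'"
  proof (intro equalityI subsetI)
    fix c assume "c \<in> T (Suc m)"
    then consider "c \<in> T m" "c \<notin> D" | c0 where "c0 \<in> D" "c \<in> subdivide c0" using D(2) by auto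
    then show "c \<in> hmesh.M C N n lev'"
    proof cases
      case 1
      then obtain i j where ij: "i < N True" "j < N False" "c = boxc C (H.w (lev i j)) i j" using Tm by auto
      then have "lev' i j = lev i j" using 1(2) by (auto simp: lev'_def)
      then have "c = boxc C (H.w (lev' i j)) i j" using ij by simp
      then show ?thesis unfolding M' using ij(1,2) by blast
    next
      case 2
      obtain i j where ij: "i < N True" "j < N False" "lev i j = m" "c0 = boxc C (H.w m) i j" using Dlev[OF 2(1)] by blast
      obtain x y where xy: "x = 2 * h * (i div (2 * h)) \<or> x = 2 * h * (i div (2 * h)) + h" "y = 2 * h * (j div (2 * h)) \<or> y = 2 * h * (j div (2 * h)) + h"
        "c = ((C True x, C False y), (C True (x + h), C False (y + h)))"
        using 2(2) unfolding ij(4) sub[OF ij(1,2)] by blast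
      have dx: "x div (2 * h) = i div (2 * h)" "h * (x div h) = x" using xy(1) wm(3) by (auto simp: mult.assoc[symmetric])
      have dy: "y div (2 * h) = j div (2 * h)" "h * (y div h) = y" using xy(2) wm(3) by (auto simp: mult.assoc[symmetric])
      have "x \<le> 2 * h * (i div (2 * h)) + h" "y \<le> 2 * h * (j div (2 * h)) + h" using xy(1,2) by auto
      then have rg: "x < N True" "y < N False"
        using H.box_le_N[OF ij(1), of m] H.box_le_N[OF ij(2), of m] wm(3) unfolding wm(1) by linarith+
      have "lev x y = m" using same[OF ij(3)] dx dy by (simp add: wm)
      moreover have "boxc C (H.w m) x y = c0" unfolding ij(4) by (rule boxc_same) (use dx dy wm in auto)
      ultimately have "lev' x y = Suc m" using 2(1) by (simp add: lev'_def)
      moreover have "c = boxc C (H.w (Suc m)) x y" unfolding wm xy(3) by (rule boxh[symmetric]) (use dx dy in auto)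
      ultimately have "c = boxc C (H.w (lev' x y)) x y" by simp
      then show ?thesis unfolding M' using rg by blast
    qed
  next
    fix c assume "c \<in> hmesh.M C N n lev'"
    then obtain i j where ij: "i < N True" "j < N False" "c = boxc C (H.w (lev' i j)) i j" unfolding M' by blast
    show "c \<in> T (Suc m)"
    proof (cases "lev i j = m \<and> boxc C (H.w m) i j \<in> D")
      case True
      then have c: "c = boxc C h i j" using ij wm by (simp add: lev'_def)
      have cc: "c = ((C True (h * (i div h)), C False (h * (j div h))), (C True (h * (i div h) + h), C False (h * (j div h) + h)))"
        by (simp add: c boxc_def)
      have "c \<in> subdivide (boxc C (H.w m) i j)"
        unfolding sub[OF ij(1,2)] cc using div_cases_half[OF wm(3), of i] div_cases_half[OF wm(3), of j] by blast
      then show ?thesis using True D(2) by blast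
    next
      case False
      then have c: "c = boxc C (H.w (lev i j)) i j" using ij by (auto simp: lev'_def)
      have "c \<notin> D"
      proof
        assume "c \<in> D"
        then obtain i' j' where ij': "i' < N True" "j' < N False" "lev i' j' = m" "c = boxc C (H.w m) i' j'" using Dlev by blast
        have "lev i j = m" using H.boxc_eq(1)[OF ij(1,2) ij'(1,2), of "lev i j" m] c ij'(4) H.lev_le[of i j] Suc.prems by simp
        then show False using False \<open>c \<in> D\<close> c by simp
      qed
      moreover have "c \<in> T m" unfolding Tm using ij(1,2) c by blast
      ultimately show ?thesis using D(2) by blast
    qed
  qed
  moreover have "(\<lambda>i j. min (Suc m) (lev' i j)) = lev'"
  proof (intro ext)
    fix i j show "min (Suc m) (lev' i j) = lev' i j" using lev(1)[of i j] by (auto simp: lev'_def)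
  qed
  moreover have "(\<lambda>i j. min k (lev' i j)) = (\<lambda>i j. min k (lev i j))" if "k \<le> m" for k
    using that by (auto simp: fun_eq_iff lev'_def)
  ultimately have "T k = hmesh.M C N n (\<lambda>i j. min k (lev' i j))" if "k \<le> Suc m" for k
    using that lev(3) by (cases "k = Suc m") (auto simp: le_Suc_eq)
  moreover have "lev' i j \<le> Suc m" for i j using lev(1)[of i j] by (simp add: lev'_def)
  ultimately show ?case using H' by blast
qed

locale hier = hmesh +
  fixes T :: "nat \<Rightarrow> cell set"
  assumes T: "k \<le> n \<Longrightarrow> T k = hmesh.M C N n (\<lambda>i j. min k (lev i j))"

lemma hierarchical_T_mesh_hier:
  assumes "hierarchical_T_mesh T n"
  shows "\<exists>C N lev. hier C N n lev T"
proof -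
  obtain xs ys where L: "sorted_wrt (<) xs" "sorted_wrt (<) ys" "2 \<le> length xs" "2 \<le> length ys"
    and T0: "T 0 = {((xs ! i, ys ! j), (xs ! Suc i, ys ! Suc j)) | i j. Suc i < length xs \<and> Suc j < length ys}"
    using assms unfolding hierarchical_T_mesh_def tensor_product_mesh_def by blast
  define zs where "zs d = (if d then xs else ys)" for d
  define C where "C d = refined n (zs d)" for d
  define N where "N d = (length (zs d) - 1) * 2 ^ n" for d
  have zs: "sorted_wrt (<) (zs d)" "2 \<le> length (zs d)" for d using L by (auto simp: zs_def)
  have H0: "hmesh C N n (\<lambda>_ _. 0)"
  proof
    fix d show "0 < N d" using zs(2)[of d] by (simp add: N_def)
    show "2 ^ n dvd N d" by (simp add: N_def)
    fix i j show "i < j \<Longrightarrow> j \<le> N d \<Longrightarrow> C d i < C d j" unfolding C_def N_def by (rule refined_less[OF zs(1)])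
  qed auto
  interpret H: hmesh C N n "\<lambda>_ _. 0" by (rule H0)
  have knot: "C d (2 ^ n * q) = zs d ! q" if "q < length (zs d)" for d q using that by (simp add: C_def refined_knot)
  have box0: "boxc C (2 ^ n) i j = ((xs ! (i div 2 ^ n), ys ! (j div 2 ^ n)), (xs ! Suc (i div 2 ^ n), ys ! Suc (j div 2 ^ n)))"
    if "i div 2 ^ n < length xs - 1" "j div 2 ^ n < length ys - 1" for i j
    using that knot[of "i div 2 ^ n" True] knot[of "Suc (i div 2 ^ n)" True] knot[of "j div 2 ^ n" False] knot[of "Suc (j div 2 ^ n)" False]
    by (simp add: boxc_def zs_def add.commute)
  have "T 0 = H.M"
    unfolding H.M_boxc T0
  proof (intro equalityI subsetI)
    fix c assume "c \<in> {((xs ! i, ys ! j), (xs ! Suc i, ys ! Suc j)) | i j. Suc i < length xs \<and> Suc j < length ys}"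
    then obtain i j where ij: "c = ((xs ! i, ys ! j), (xs ! Suc i, ys ! Suc j))" "Suc i < length xs" "Suc j < length ys" by blast
    have "c = boxc C (H.w 0) (i * 2 ^ n) (j * 2 ^ n)" using box0[of "i * 2 ^ n" "j * 2 ^ n"] ij by (simp add: H.w_def)
    moreover have "i * 2 ^ n < N True" "j * 2 ^ n < N False" using ij by (auto simp: N_def zs_def)
    ultimately show "c \<in> {boxc C (H.w 0) i j | i j. i < N True \<and> j < N False}" by blast
  next
    fix c assume "c \<in> {boxc C (H.w 0) i j | i j. i < N True \<and> j < N False}"
    then obtain i j where ij: "c = boxc C (2 ^ n) i j" "i < N True" "j < N False" by (auto simp: H.w_def)
    have "i div 2 ^ n < length xs - 1" "j div 2 ^ n < length ys - 1"
      using ij(2,3) by (auto simp: N_def zs_def less_mult_imp_div_less)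
    then show "c \<in> {((xs ! i, ys ! j), (xs ! Suc i, ys ! Suc j)) | i j. Suc i < length xs \<and> Suc j < length ys}"
      unfolding ij(1) using box0[of i j] by (intro CollectI exI[of _ "i div 2 ^ n"] exI[of _ "j div 2 ^ n"]) auto
  qed
  moreover have "C d (a + s) = (C d a + C d (a + 2 * s)) / 2" if "2 * s dvd 2 ^ n" "2 * s dvd a" "0 < s" "a + 2 * s \<le> N d" for d s a
    unfolding C_def by (rule refined_mid) (use that in \<open>auto simp: N_def\<close>)
  moreover have "\<exists>D. D \<subseteq> level_cells T k \<and> T (Suc k) = (T k - D) \<union> (\<Union>c\<in>D. subdivide c)" if "k < n" for k
    using assms that unfolding hierarchical_T_mesh_def by blast
  ultimately obtain lev where "hmesh C N n lev" "\<And>k. k \<le> n \<Longrightarrow> T k = hmesh.M C N n (\<lambda>i j. min k (lev i j))"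
    using hierarchical_stages[OF H0, of T n] by blast
  then have "hier C N n lev T" by (simp add: hier_def hier_axioms_def)
  then show ?thesis by blast
qed

section \<open>Components and blocks\<close>

context hier
begin

lemma T_n: "T n = M"
proof -
  have "(\<lambda>i j. min n (lev i j)) = lev" using lev_le by (auto simp: fun_eq_iff)
  then show ?thesis using T[of n] by simp
qed

text \<open>At stage \<open>k\<close> the levels are capped by \<open>k\<close>, so exactly the
  edges on lines of level at most \<open>k\<close> are present there.\<close>

lemma edge_level_seg:
  assumes e: "edg d q a b" shows "edge_level T (seg d q a b) = llev q"
proof -
  note E = e[unfolded edg_def]
  have sub: "seg d q a b \<subseteq> grid (T k) \<longleftrightarrow> llev q \<le> k" if k: "k \<le> n" for k
  proof -
    interpret H: hmesh C N n "\<lambda>i j. min k (lev i j)" by (rule hmesh_min)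
    have "H.U d i q \<longleftrightarrow> llev q \<le> k \<and> U d i q" for i by (auto simp: H.U_def U_def H.lv_def lv_def)
    then have "seg d q a b \<subseteq> grid (T k) \<longleftrightarrow> (\<forall>i. a \<le> i \<and> i < b \<longrightarrow> llev q \<le> k \<and> U d i q)"
      using H.seg_grid_iff[of a b d q] E T[OF k] by simp
    then show ?thesis using E by auto
  qed
  show ?thesis unfolding edge_level_def
  proof (rule Least_equality)
    show "seg d q a b \<subseteq> grid (T (llev q))" using sub[OF llev_le_n] by simp
    fix k assume "seg d q a b \<subseteq> grid (T k)"
    \<comment> \<open>Beyond stage \<open>n\<close> the mesh is arbitrary, but
      \<open>llev q \<le> n\<close> settles that case.\<close>
    then show "llev q \<le> k" using sub[of k] llev_le_n[of q] by (cases "k \<le> n") auto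
  qed
qed

lemma edg_subset_L:
  assumes t: "(d, q, a, b) \<in> L"
  shows "edg d' q' a' b' \<Longrightarrow> seg d' q' a' b' \<subseteq> seg d q a b \<Longrightarrow> q' = q"
    "\<exists>a' b'. edg d q a' b' \<and> seg d q a' b' \<subseteq> seg d q a b"
proof -
  note D = L_D[OF t]
  show "edg d' q' a' b' \<Longrightarrow> seg d' q' a' b' \<subseteq> seg d q a b \<Longrightarrow> q' = q"
    using seg_subset[of d' q' a' b' d q a b] D by (auto simp: edg_def)
  obtain a' b' where e: "edg d q a' b'" "a \<le> a'" "b' \<le> b"
    using edg_between[of b d q a a] D L_end_vtx[OF t] by auto
  have "C d a \<le> C d a'" "C d b' \<le> C d b" using e D by (auto intro!: C_le simp: edg_def)
  then have "seg d q a' b' \<subseteq> seg d q a b" by (auto simp: seg_def)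
  then show "\<exists>a' b'. edg d q a' b' \<and> seg d q a' b' \<subseteq> seg d q a b" using e by blast
qed

definition Lk :: "nat \<Rightarrow> (bool \<times> nat \<times> nat \<times> nat) set" where
  "Lk j = {(d, q, a, b). (d, q, a, b) \<in> L \<and> llev q = j}"

text \<open>All edges in an l-edge lie on its line, and there is at least one of them, so its level
  is that of the line.\<close>

lemma level_l_edges_eq: "level_l_edges T n j = sg ` Lk j"
proof -
  have "(\<forall>e\<in>edges M. e \<subseteq> sg t \<longrightarrow> edge_level T e = j) \<longleftrightarrow> t \<in> Lk j" if t: "t \<in> L" for t
  proof -
    obtain d q a b where t': "t = (d, q, a, b)" by (cases t)
    note tL = t[unfolded t']
    show ?thesis
    proof
      assume h: "\<forall>e\<in>edges M. e \<subseteq> sg t \<longrightarrow> edge_level T e = j"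
      obtain a' b' where e: "edg d q a' b'" "seg d q a' b' \<subseteq> seg d q a b" using edg_subset_L(2)[OF tL] by blast
      moreover have "seg d q a' b' \<in> edges M" using e(1) edges_iff by blast
      ultimately have "edge_level T (seg d q a' b') = j" using h unfolding t' sg_def by simp
      then show "t \<in> Lk j" using edge_level_seg[OF e(1)] t by (simp add: Lk_def t')
    next
      assume "t \<in> Lk j"
      then have l: "llev q = j" by (simp add: Lk_def t')
      show "\<forall>e\<in>edges M. e \<subseteq> sg t \<longrightarrow> edge_level T e = j"
      proof (intro ballI impI)
        fix e assume "e \<in> edges M" "e \<subseteq> sg t"
        then obtain d' q' a' b' where e: "edg d' q' a' b'" "e = seg d' q' a' b'" "e \<subseteq> seg d q a b"
          unfolding edges_iff t' sg_def by auto
        then have "q' = q" using edg_subset_L(1)[OF tL] by blast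
        then show "edge_level T e = j" using edge_level_seg[OF e(1)] e(2) l by simp
      qed
    qed
  qed
  moreover have "Lk j \<subseteq> L" by (auto simp: Lk_def)
  ultimately show ?thesis unfolding level_l_edges_def T_n interior_l_edges_eq by blast
qed

definition cb :: "bool \<Rightarrow> nat \<Rightarrow> nat \<Rightarrow> nat \<Rightarrow> cell" where
  "cb d x y s = (mk d (C d x) (C (\<not> d) y), mk d (C d (x + s)) (C (\<not> d) (y + s)))"

lemma cb_swap: "cb (\<not> d) x y s = cb d y x s" by (simp add: cb_def mk_swap)

section \<open>The l-edges of one level, the cells they cross and their components\<close>

context
  fixes k h :: nat
  assumes k: "k < n" and h_def: "h = w (Suc k)"
begin

lemmas hw = half_width[OF k h_def]

interpretation H: hmesh C N n "\<lambda>i j. min k (lev i j)" by (rule hmesh_min)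

lemma T_k: "T k = H.M" using T[of k] k by simp

lemma H_lv: "H.lv d i q = min k (lv d i q)" by (simp add: H.lv_def lv_def)

lemma H_cell:
  assumes "k \<le> lv d i q"
  shows "H.cell d i q = cb d (2 * h * (i div (2 * h))) (2 * h * (q div (2 * h))) (2 * h)"
  using assms by (simp add: H.cell_def cb_def H.lo_def H_lv lv_swap hw)

lemma L_level_facts:
  assumes "(d, q, a, b) \<in> Lk (Suc k)"
  shows "(d, q, a, b) \<in> L" "llev q = Suc k" "2 * h dvd a" "2 * h dvd b" "2 * h dvd q - h" "h \<le> q" "2 * h * (q div (2 * h)) = q - h"
    "q + h \<le> N (\<not> d)"
proof -
  show t: "(d, q, a, b) \<in> L" "llev q = Suc k" using assms by (auto simp: Lk_def)
  show "2 * h dvd a" "2 * h dvd b" using aligned[OF t] by (simp_all add: hw)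
  show q: "2 * h dvd q - h" "h \<le> q" using llev_Suc[OF k h_def t(2)] by auto
  obtain z where "q - h = 2 * h * z" using q(1) by blast
  then have z: "q = 2 * h * z + h" using q(2) by simp
  have "q div (2 * h) = z" unfolding z using hw(1) by (intro div_nat_eqI) (auto simp: algebra_simps)
  then show "2 * h * (q div (2 * h)) = q - h" using z by simp
  have "2 * h dvd N (\<not> d)" using w_dvd_N[of k "\<not> d"] by (simp add: hw)
  moreover have "q - h < N (\<not> d)" using L_D(2)[OF t(1)] by simp
  ultimately have "q - h + 2 * h \<le> N (\<not> d)" using q by (intro dvd_less_add)
  then show "q + h \<le> N (\<not> d)" using q(2) by simp
qed

lemma crossed_cells_eq:
  assumes t: "(d, q, a, b) \<in> Lk (Suc k)"
  shows "crossed_cells (T k) (sg (d, q, a, b)) = {cb d m (q - h) (2 * h) | m. 2 * h dvd m \<and> a \<le> m \<and> m < b}"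
proof -
  note F = L_level_facts[OF t]
  note D = L_D[OF F(1)]
  have lvk: "k \<le> lv d i q \<and> H.lv d i q = k" if "a \<le> i" "i < b" for i
    using D(5)[OF that] F(2) by (auto simp: U_def H_lv)
  show ?thesis
  proof (intro equalityI subsetI)
    fix c assume "c \<in> crossed_cells (T k) (sg (d, q, a, b))"
    then have c: "c \<in> H.M" "sg (d, q, a, b) \<inter> interior (region c) \<noteq> {}" by (auto simp: crossed_cells_def T_k)
    obtain i p where ip: "i < N d" "p < N (\<not> d)" "c = H.cell d i p" using c(1) H.M_iff by blast
    obtain u where u: "C d a \<le> u" "u \<le> C d b" "mk d u (C (\<not> d) q) \<in> interior (region c)"
      using c(2) by (auto simp: sg_def seg_def)
    note bd = H.lo_bounds[OF ip(1), of p] and bd' = H.lo_bounds[OF ip(2), of i, unfolded H.lv_swap]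
    let ?x = "H.lo d i p" and ?y = "H.lo (\<not> d) p i" and ?s = "w (H.lv d i p)"
    have v: "C d ?x < u" "u < C d (?x + ?s)" "C (\<not> d) ?y < C (\<not> d) q" "C (\<not> d) q < C (\<not> d) (?y + ?s)"
      using u(3) unfolding ip(3) H.cell_def mem_interior_region by auto
    have q: "?y < q" "q < ?y + ?s" using v(3,4) bd' D(2) by (simp_all add: C_less_iff)
    \<comment> \<open>The l-edge and the open cell have a point in common, hence the projection of a
      whole unit square. Comparing levels there shows that the cell has level
      \<open>k\<close>.\<close>
    have "max a ?x < min b (?x + ?s)"
    proof (rule ccontr)
      assume n: "\<not> max a ?x < min b (?x + ?s)"
      have "C d (min b (?x + ?s)) \<le> C d (max a ?x)" using n bd D(3,4) by (intro C_le) auto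
      moreover have "C d ?x < C d (?x + ?s)" using v by linarith
      moreover have "C d a < C d b" using D(3,4) by (intro C_less) auto
      ultimately show False using u(1,2) v(1,2) unfolding min_def max_def by (auto split: if_splits)
    qed
    moreover have "C d (max a ?x) \<le> u" "u \<le> C d (min b (?x + ?s))" using u v by (auto simp: max_def min_def)
    moreover have "min b (?x + ?s) \<le> N d" using D(4) by simp
    ultimately obtain i' where i': "max a ?x \<le> i'" "i' < min b (?x + ?s)" using locate by blast
    have e: "H.lv d i' q = H.lv d i p" by (rule H.lv_in_cell) (use i' q in auto)
    then have lk: "H.lv d i p = k" using lvk[of i'] i' by auto
    have "i' div w k = i div w k" using H.lo_div[of d i p i'] i' lk by simp
    moreover have "q div w k = p div w k" using H.lo_div[of "\<not> d" p i q] q lk by (simp add: H.lv_swap)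
    ultimately have "c = cb d (2 * h * (i' div (2 * h))) (q - h) (2 * h)"
      unfolding ip(3) H.cell_def cb_def H.lo_def H.lv_swap lk hw using F(7) by simp
    moreover have "a \<le> 2 * h * (i' div (2 * h))"
    proof -
      obtain z where z: "a = 2 * h * z" using F(3) by blast
      have "z \<le> i' div (2 * h)" using i' z hw(1) by (simp add: less_eq_div_iff_mult_less_eq mult.commute)
      then show ?thesis by (simp add: z)
    qed
    moreover have "2 * h * (i' div (2 * h)) < b" using i' by (metis le_less_trans min_less_iff_conj times_div_less_eq_dividend)
    ultimately show "c \<in> {cb d m (q - h) (2 * h) | m. 2 * h dvd m \<and> a \<le> m \<and> m < b}"
      by (intro CollectI exI[of _ "2 * h * (i' div (2 * h))"] conjI) (assumption | rule dvd_triv_left)+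
  next
    fix c assume "c \<in> {cb d m (q - h) (2 * h) | m. 2 * h dvd m \<and> a \<le> m \<and> m < b}"
    then obtain m where m: "c = cb d m (q - h) (2 * h)" "2 * h dvd m" "a \<le> m" "m < b" by blast
    have "m + 2 * h \<le> b" by (rule dvd_less_add[OF m(2) F(4) m(4)])
    then have mN: "m + 2 * h \<le> N d" using D(4) by simp
    have "c = H.cell d m q" using H_cell[of d m q] lvk[OF m(3,4)] m(1,2) F(7) by auto
    moreover have "m < N d" using D(4) m(4) by simp
    ultimately have "c \<in> H.M" using H.M_iff[of c d] D(2) by blast
    moreover have "mk d ((C d m + C d (Suc m)) / 2) (C (\<not> d) q) \<in> sg (d, q, a, b)"
      using seg_unit_mid(1)[OF m(3,4) D(4), of q] by (simp add: sg_def)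
    moreover have "mk d ((C d m + C d (Suc m)) / 2) (C (\<not> d) q) \<in> interior (region c)"
    proof -
      have "C d (Suc m) \<le> C d (m + 2 * h)" using hw(1) mN by (intro C_le) auto
      moreover have "C (\<not> d) (q - h) < C (\<not> d) q" using hw(1) F(6) D(2) by (intro C_less) auto
      moreover have "C (\<not> d) q < C (\<not> d) (q - h + 2 * h)" using hw(1) F(6,8) by (intro C_less) auto
      ultimately show ?thesis unfolding m(1) cb_def mem_interior_region
        using seg_unit_mid(2,3)[OF m(3,4) D(4)] by auto
    qed
    ultimately show "c \<in> crossed_cells (T k) (sg (d, q, a, b))" unfolding crossed_cells_def T_k by blast
  qed
qed

text \<open>The hypothesis on \<open>N(t)\<close> in indices: crossed cells correspond to multiples
  of \<open>2 * h\<close>, and a length below \<open>4 * h\<close> has room for one only.\<close>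

lemma long_of_card:
  assumes t: "(d, q, a, b) \<in> Lk (Suc k)" and c: "2 \<le> card (crossed_cells (T k) (sg (d, q, a, b)))"
  shows "a + 4 * h \<le> b"
proof (rule ccontr)
  assume n: "\<not> a + 4 * h \<le> b"
  note F = L_level_facts[OF t]
  have "m = a" if "2 * h dvd m" "a \<le> m" "m < b" for m
  proof (rule ccontr)
    assume "m \<noteq> a"
    then have "a + 2 * h \<le> m" using that F(3) by (intro dvd_less_add) auto
    moreover have "m + 2 * h \<le> b" using that F(4) by (intro dvd_less_add) auto
    ultimately show False using n by simp
  qed
  then have "crossed_cells (T k) (sg (d, q, a, b)) \<subseteq> {cb d a (q - h) (2 * h)}" unfolding crossed_cells_eq[OF t] by blast
  then have "card (crossed_cells (T k) (sg (d, q, a, b))) \<le> card {cb d a (q - h) (2 * h)}" by (intro card_mono) auto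
  then show False using c by simp
qed

definition meet :: "((real \<times> real) set \<times> (real \<times> real) set) set" where
  "meet = l_edges_meet (level_l_edges T n (Suc k))"

lemma meet_iff:
  assumes "t \<in> Lk (Suc k)" "t' \<in> Lk (Suc k)"
  shows "(sg t, sg t') \<in> meet \<longleftrightarrow> sg t \<inter> sg t' \<noteq> {}"
  using assms by (auto simp: meet_def l_edges_meet_def level_l_edges_eq)

lemma meet_cases:
  assumes "(x, y) \<in> meet" obtains t t' where "t \<in> Lk (Suc k)" "t' \<in> Lk (Suc k)" "x = sg t" "y = sg t'" "sg t \<inter> sg t' \<noteq> {}"
  using assms unfolding meet_def l_edges_meet_def level_l_edges_eq by blast

lemma sg_nonempty: "t \<in> L \<Longrightarrow> sg t \<noteq> {}"
proof -
  assume t: "t \<in> L"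
  obtain d q a b where t': "t = (d, q, a, b)" by (cases t)
  show ?thesis using sg_meet[of d q a b d q a b] t unfolding t' by auto
qed

text \<open>An l-edge is not empty and so meets itself; the transitive closure is therefore already
  reflexive.\<close>

lemma equiv_meet: "equiv (sg ` Lk (Suc k)) (meet\<^sup>+)"
proof (rule equivI)
  have sub: "meet \<subseteq> sg ` Lk (Suc k) \<times> sg ` Lk (Suc k)" by (auto simp: meet_def l_edges_meet_def level_l_edges_eq)
  show "meet\<^sup>+ \<subseteq> sg ` Lk (Suc k) \<times> sg ` Lk (Suc k)" by (rule trancl_subset_Sigma[OF sub])
  show "refl_on (sg ` Lk (Suc k)) (meet\<^sup>+)"
  proof (rule refl_onI)
    fix x assume "x \<in> sg ` Lk (Suc k)"
    then obtain t where t: "t \<in> Lk (Suc k)" "x = sg t" by blast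
    have "t \<in> L" using t(1) by (auto simp: Lk_def)
    then have "sg t \<noteq> {}" by (rule sg_nonempty)
    then have "(x, x) \<in> meet" using t meet_iff by simp
    then show "(x, x) \<in> meet\<^sup>+" by blast
  qed
  have "sym meet" by (auto simp: sym_def meet_def l_edges_meet_def)
  then show "sym (meet\<^sup>+)" by (rule sym_trancl)
  show "trans (meet\<^sup>+)" by (rule trans_trancl)
qed

definition four :: "nat \<times> nat \<Rightarrow> (bool \<times> nat \<times> nat \<times> nat) set" where
  "four = (\<lambda>(A, B). {(True, B + h, A, A + 4 * h), (True, B + 3 * h, A, A + 4 * h),
     (False, A + h, B, B + 4 * h), (False, A + 3 * h, B, B + 4 * h)})"

lemma blk_four:
  assumes "blk k True A B" shows "four (A, B) \<subseteq> Lk (Suc k)"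
  using assms llev_center[OF k h_def, of A] llev_center[OF k h_def, of B]
  by (auto simp: four_def blk_def Lk_def hw simp flip: h_def)

lemma center_cases:
  assumes "2 * h dvd A" "llev q = Suc k" "A \<le> q" "q \<le> A + 4 * h"
  shows "q = A + h \<or> q = A + 3 * h"
proof -
  note q = llev_Suc[OF k h_def assms(2)]
  obtain x where x: "A = 2 * h * x" using assms(1) by blast
  obtain y where "q - h = 2 * h * y" using q(2) by blast
  then have y: "q = 2 * h * y + h" using q(3) by simp
  have "2 * h * x < 2 * h * (y + 1)" using assms(3) hw(1) by (simp add: x y)
  then have "x < y + 1" by (simp only: nat_mult_less_cancel_disj)
  moreover have "2 * h * y < 2 * h * (x + 2)" using assms(4) hw(1) by (simp add: x y)
  then have "y < x + 2" by (simp only: nat_mult_less_cancel_disj)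
  ultimately have "y = x \<or> y = x + 1" by linarith
  then show ?thesis by (auto simp: x y)
qed

text \<open>The set is closed, since an l-edge of the same level that meets one of the four runs
  along a center line of the block and is one of them. It is connected, since parallel ones are
  linked by a transversal.\<close>

lemma four_class:
  assumes b: "blk k True A B" and t: "t \<in> four (A, B)"
  shows "meet\<^sup>+ `` {sg t} = sg ` four (A, B)"
proof -
  note B = blk_four[OF b]
  have al: "2 * h dvd A" "2 * h dvd B" using b by (auto simp: blk_def hw)
  have step: "y \<in> sg ` four (A, B)" if x: "x \<in> sg ` four (A, B)" and m: "(x, y) \<in> meet" for x y
  proof -
    obtain s s' where s: "s \<in> Lk (Suc k)" "s' \<in> Lk (Suc k)" "x = sg s" "y = sg s'" "sg s \<inter> sg s' \<noteq> {}"
      using m by (rule meet_cases)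
    obtain r where r: "r \<in> four (A, B)" "x = sg r" using x by blast
    have "r \<in> L" "s \<in> L" using r B s by (auto simp: Lk_def)
    then have "r = s" using sg_inj r(2) s(3) by blast
    then have sf: "s \<in> four (A, B)" using r by simp
    obtain d q a b where s1: "s = (d, q, a, b)" by (cases s)
    obtain d' q' a' b' where s2: "s' = (d', q', a', b')" by (cases s')
    have L: "(d, q, a, b) \<in> L" "(d', q', a', b') \<in> L" "llev q' = Suc k" using s(1,2) by (auto simp: s1 s2 Lk_def)
    have "s' \<in> four (A, B)"
    proof (cases "s' = s")
      case False
      then have pr: "d' = (\<not> d)" "a \<le> q'" "q' \<le> b" "a' \<le> q" "q \<le> b'"
        using s(5) sg_meet[OF L(1,2)] by (auto simp: s1 s2)
      show ?thesis
      proof (cases d)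
        case True
        then have f: "a = A" "b = A + 4 * h" "q = B + h \<or> q = B + 3 * h" using sf by (auto simp: four_def s1)
        have q': "q' = A + h \<or> q' = A + 3 * h" using center_cases[OF al(1) L(3)] pr f by simp
        then have v: "(False, q', B, B + 4 * h) \<in> four (A, B)" by (auto simp: four_def)
        then have "(False, q', B, B + 4 * h) \<in> L" using B by (auto simp: Lk_def)
        moreover have "(False, q', a', b') \<in> L" using L(2) pr True by simp
        ultimately have "a' = B" "b' = B + 4 * h" using L_unique[of False q' a' b' B "B + 4 * h" q] pr f by auto
        then show ?thesis using v pr True by (simp add: s2)
      next
        case False
        then have f: "a = B" "b = B + 4 * h" "q = A + h \<or> q = A + 3 * h" using sf by (auto simp: four_def s1)
        have q': "q' = B + h \<or> q' = B + 3 * h" using center_cases[OF al(2) L(3)] pr f by simp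
        then have v: "(True, q', A, A + 4 * h) \<in> four (A, B)" by (auto simp: four_def)
        then have "(True, q', A, A + 4 * h) \<in> L" using B by (auto simp: Lk_def)
        moreover have "(True, q', a', b') \<in> L" using L(2) pr False by simp
        ultimately have "a' = A" "b' = A + 4 * h" using L_unique[of True q' a' b' A "A + 4 * h" q] pr f by auto
        then show ?thesis using v pr False by (simp add: s2)
      qed
    qed (use sf in simp)
    then show ?thesis using s(4) by blast
  qed
  have perp: "(sg s, sg s') \<in> meet" if "s \<in> four (A, B)" "s' \<in> four (A, B)" "fst s' \<noteq> fst s" for s s'
  proof -
    have ss: "s \<in> Lk (Suc k)" "s' \<in> Lk (Suc k)" using that B by auto
    obtain d q a b where s1: "s = (d, q, a, b)" by (cases s)
    obtain d' q' a' b' where s2: "s' = (d', q', a', b')" by (cases s')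
    have "(d, q, a, b) \<in> L" "(d', q', a', b') \<in> L" using ss by (auto simp: s1 s2 Lk_def)
    then have "sg s \<inter> sg s' \<noteq> {}" using that sg_meet[of d q a b d' q' a' b'] unfolding s1 s2 by (auto simp: four_def)
    then show ?thesis using meet_iff[OF ss] by simp
  qed
  show ?thesis
  proof (intro equalityI subsetI)
    fix y assume "y \<in> meet\<^sup>+ `` {sg t}"
    then have "(sg t, y) \<in> meet\<^sup>+" by simp
    then show "y \<in> sg ` four (A, B)"
    proof (induction rule: trancl_induct)
      case (base y)
      then show ?case using step[of "sg t" y] t by blast
    next
      case (step y z)
      then show ?case using \<open>\<And>y x. \<lbrakk>x \<in> sg ` four (A, B); (x, y) \<in> meet\<rbrakk> \<Longrightarrow> y \<in> sg ` four (A, B)\<close> by blast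
    qed
  next
    fix y assume "y \<in> sg ` four (A, B)"
    then obtain s where s: "s \<in> four (A, B)" "y = sg s" by blast
    obtain r where r: "r \<in> four (A, B)" "fst r \<noteq> fst t"
      by (cases "fst t") (auto simp: four_def intro: that[of "(False, A + h, B, B + 4 * h)"] that[of "(True, B + h, A, A + 4 * h)"])
    show "y \<in> meet\<^sup>+ `` {sg t}"
    proof (cases "fst s = fst t")
      case True
      then have "(sg t, sg r) \<in> meet" "(sg r, sg s) \<in> meet" using perp t r s by auto
      then show ?thesis using s(2) by auto
    next
      case False
      then have "(sg t, sg s) \<in> meet" using perp t s by auto
      then show ?thesis using s(2) by auto
    qed
  qed
qed

lemma divided_four:
  assumes b: "blk k True A B"
  shows "divided_cells (T k) (sg ` four (A, B)) =
    {cb True A B (2 * h), cb True (A + 2 * h) B (2 * h), cb True A (B + 2 * h) (2 * h), cb True (A + 2 * h) (B + 2 * h) (2 * h)}"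
proof -
  have al: "2 * h dvd A" "2 * h dvd B" using b by (auto simp: blk_def hw)
  have ms: "(2 * h dvd m \<and> A \<le> m \<and> m < A + 4 * h) \<longleftrightarrow> m = A \<or> m = A + 2 * h" if "2 * h dvd A" for m A
  proof
    assume m: "2 * h dvd m \<and> A \<le> m \<and> m < A + 4 * h"
    have d4: "2 * h dvd A + 4 * h" using that by (intro dvd_add) (auto intro!: dvdI[of _ _ 2])
    show "m = A \<or> m = A + 2 * h"
    proof (rule ccontr)
      assume n: "\<not> ?thesis"
      then have "A + 2 * h \<le> m" using m that by (intro dvd_less_add) auto
      moreover have "m + 2 * h \<le> A + 4 * h" using m d4 by (intro dvd_less_add) auto
      ultimately show False using n by simp
    qed
  qed (use that hw(1) in auto)
  have cc: "crossed_cells (T k) (sg (d, q, a, a + 4 * h)) = {cb d a (q - h) (2 * h), cb d (a + 2 * h) (q - h) (2 * h)}"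
    if "(d, q, a, a + 4 * h) \<in> Lk (Suc k)" for d q a
    using crossed_cells_eq[OF that] ms[OF L_level_facts(3)[OF that]] by auto
  have F: "\<And>t. t \<in> four (A, B) \<Longrightarrow> t \<in> Lk (Suc k)" using blk_four[OF b] by auto
  have e: "B + 3 * h - h = B + 2 * h" "A + 3 * h - h = A + 2 * h" by simp_all
  have 1: "crossed_cells (T k) (sg (True, B + h, A, A + 4 * h)) = {cb True A B (2 * h), cb True (A + 2 * h) B (2 * h)}"
    using cc[of True "B + h" A] F by (simp add: four_def)
  have 2: "crossed_cells (T k) (sg (True, B + 3 * h, A, A + 4 * h)) = {cb True A (B + 2 * h) (2 * h), cb True (A + 2 * h) (B + 2 * h) (2 * h)}"
    using cc[of True "B + 3 * h" A] F by (simp add: four_def e)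
  have 3: "crossed_cells (T k) (sg (False, A + h, B, B + 4 * h)) = {cb True A B (2 * h), cb True A (B + 2 * h) (2 * h)}"
    using cc[of False "A + h" B] F cb_swap[of True] by (simp add: four_def)
  have 4: "crossed_cells (T k) (sg (False, A + 3 * h, B, B + 4 * h)) = {cb True (A + 2 * h) B (2 * h), cb True (A + 2 * h) (B + 2 * h) (2 * h)}"
    using cc[of False "A + 3 * h" B] F cb_swap[of True] by (simp add: four_def e)
  show ?thesis unfolding divided_cells_def four_def by (auto simp: 1 2 3 4)
qed

end

end

section \<open>Components that divide an interior block of four cells\<close>

context hier
begin

context
  fixes k h :: nat
  assumes k: "k < n" and h_def: "h = w (Suc k)"
begin

interpretation H: hmesh C N n "\<lambda>i j. min k (lev i j)" by (rule hmesh_min)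

lemmas hw' = half_width[OF k h_def] and Tk' = T_k[OF k h_def]

abbreviation "meets \<equiv> meet k"

lemma cb_True: "cb True X Y (2 * h) = ((C True X, C False Y), (C True (X + 2 * h), C False (Y + 2 * h)))"
  by (simp add: cb_def mk_def)

text \<open>A side of the cell on the boundary of the domain would contain an edge of stage
  \<open>k\<close>, which would be a boundary edge.\<close>

lemma interior_cell_bounds:
  assumes c: "cb d x y (2 * h) \<in> interior_cells (T k)" and b: "x + 2 * h \<le> N d" "y + 2 * h \<le> N (\<not> d)"
  shows "x \<noteq> 0" "x + 2 * h \<noteq> N d"
proof -
  have cM: "cb d x y (2 * h) \<in> H.M" using c by (simp add: interior_cells_def Tk')
  have no: False if e: "e = x \<or> e = x + 2 * h" "e = 0 \<or> e = N d" for e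
  proof -
    have eN: "e \<le> N (\<not> \<not> d)" using e b by auto
    have vtx: "H.vtx (\<not> d) i e" if i: "i = y \<or> i = y + 2 * h" for i
    proof -
      have "pt (\<not> d) i e \<in> corners (cb d x y (2 * h))"
        unfolding cb_def corners_mk pt_def using e(1) i by (auto simp: mk_swap)
      then have "pt (\<not> d) i e \<in> vertices H.M" using cM unfolding vertices_def by blast
      then show ?thesis using H.pt_vertex[of i "\<not> d" e] i b(2) eN by auto
    qed
    \<comment> \<open>Boundary lines have all their unit edges, so an edge between the corners of
      the cell exists.\<close>
    have "H.U (\<not> d) i e" for i using e(2) H.U_0[of "\<not> d" i] H.U_N[of "\<not> d" i d] by auto
    then obtain a' b' where ed: "H.edg (\<not> d) e a' b'" "y \<le> a'" "b' \<le> y + 2 * h"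
      using H.edg_between[of "y + 2 * h" "\<not> d" e y y] b(2) eN vtx hw'(1) by auto
    have "seg (\<not> d) e a' b' \<subseteq> frontier (region (cb d x y (2 * h)))"
    proof
      fix p assume "p \<in> seg (\<not> d) e a' b'"
      then obtain u where u: "p = mk d (C d e) u" "C (\<not> d) a' \<le> u" "u \<le> C (\<not> d) b'" by (auto simp: seg_def mk_swap)
      have "C (\<not> d) y \<le> C (\<not> d) a'" "C (\<not> d) b' \<le> C (\<not> d) (y + 2 * h)" "C d x \<le> C d (x + 2 * h)"
        using ed b by (auto intro!: C_le simp: H.edg_def)
      then show "p \<in> frontier (region (cb d x y (2 * h)))" unfolding u(1) cb_def mem_frontier_region using u e(1) by auto
    qed
    moreover have "seg (\<not> d) e a' b' \<in> edges H.M" using ed(1) H.edges_iff by blast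
    ultimately have "seg (\<not> d) e a' b' \<in> interior_edges H.M" using c unfolding interior_cells_def Tk' by blast
    then show False using H.edg_interior_iff[OF ed(1)] e(2) by auto
  qed
  show "x \<noteq> 0" "x + 2 * h \<noteq> N d"
    by (rule notI, rule no[of x]; simp) (rule notI, rule no[of "x + 2 * h"]; simp)
qed

text \<open>One end point strictly inside the domain already makes an edge interior.\<close>

lemma interior_cell_if:
  assumes c: "cb d x y (2 * h) \<in> H.M" and x: "0 < x" "x + 2 * h < N d" "0 < y" "y + 2 * h < N (\<not> d)"
  shows "cb d x y (2 * h) \<in> interior_cells (T k)"
proof -
  have "e \<in> interior_edges H.M" if e: "e \<in> edges H.M" "e \<subseteq> frontier (region (cb d x y (2 * h)))" for e
  proof -
    obtain d' q a b where ed: "H.edg d' q a b" "e = seg d' q a b" using e(1) unfolding H.edges_iff by blast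
    have "pt d' a q \<in> e" using ed pt_in_seg[of a b d' a q q] by (auto simp: H.edg_def)
    then have p: "pt d' a q \<in> frontier (region (cb d x y (2 * h)))" using e(2) by blast
    obtain u v where uv: "pt d' a q = mk d u v" by (rule mk_cases)
    have "C d x \<le> u" "u \<le> C d (x + 2 * h)" "C (\<not> d) y \<le> v" "v \<le> C (\<not> d) (y + 2 * h)"
      using p unfolding uv cb_def mem_frontier_region by auto
    moreover have "C d 0 < C d x" "C d (x + 2 * h) < C d (N d)" "C (\<not> d) 0 < C (\<not> d) y" "C (\<not> d) (y + 2 * h) < C (\<not> d) (N (\<not> d))"
      using x by (auto intro!: C_less)
    ultimately have "pt d' a q \<notin> frontier (domain H.M)" unfolding uv H.frontier_domain_iff by auto
    then show ?thesis using \<open>pt d' a q \<in> e\<close> e(1) by (auto simp: interior_edges_def)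
  qed
  then show ?thesis using c unfolding interior_cells_def Tk' by blast
qed

lemma crossed_M: "crossed_cells (T k) s \<subseteq> H.M" by (auto simp: crossed_cells_def Tk')

lemma block_component_good:
  assumes b: "blk k True A B"
  shows "interior_2x2_block (T k) (divided_cells (T k) (sg ` four h (A, B)))"
proof -
  let ?D = "divided_cells (T k) (sg ` four h (A, B))"
  note D = divided_four[OF k h_def b]
  have bd: "0 < A" "A + 4 * h < N True" "0 < B" "B + 4 * h < N False" using b by (auto simp: blk_def simp flip: h_def)
  have "?D \<subseteq> H.M" unfolding divided_cells_def using crossed_M by blast
  then have int: "?D \<subseteq> interior_cells (T k)"
    unfolding D using bd by (auto intro!: interior_cell_if)
  have e: "A + 2 * h + 2 * h = A + 4 * h" "B + 2 * h + 2 * h = B + 4 * h" for A B :: nat by simp_all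
  have lt: "C True A < C True (A + 2 * h)" "C True (A + 2 * h) < C True (A + 4 * h)"
    "C False B < C False (B + 2 * h)" "C False (B + 2 * h) < C False (B + 4 * h)"
    using bd hw'(1) by (auto intro!: C_less)
  have "?D = {((C True A, C False B), (C True (A + 2 * h), C False (B + 2 * h))),
     ((C True (A + 2 * h), C False B), (C True (A + 4 * h), C False (B + 2 * h))),
     ((C True A, C False (B + 2 * h)), (C True (A + 2 * h), C False (B + 4 * h))),
     ((C True (A + 2 * h), C False (B + 2 * h)), (C True (A + 4 * h), C False (B + 4 * h)))}"
    unfolding D cb_True e ..
  then show ?thesis unfolding interior_2x2_block_def using int lt by blast
qed

text \<open>The component \<open>Z\<close> contains an l-edge along the center line in direction
  \<open>d\<close> of the cell with lower left corner \<open>(X, Y)\<close>, running through the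
  whole cell.\<close>

definition thr :: "(real \<times> real) set set \<Rightarrow> nat \<Rightarrow> nat \<Rightarrow> bool \<Rightarrow> bool" where
  "thr Z X Y d \<longleftrightarrow> (\<exists>a b. (d, (if d then Y else X) + h, a, b) \<in> Lk (Suc k) \<and> sg (d, (if d then Y else X) + h, a, b) \<in> Z \<and>
     a \<le> (if d then X else Y) \<and> (if d then X else Y) + 2 * h \<le> b)"

text \<open>One l-edge of the component crosses the cell. By \<open>crossing\<close> the other
  center line is there too; it meets the first and so belongs to the same component.\<close>

lemma cell_through:
  assumes Z: "Z \<in> sg ` Lk (Suc k) // (meets)\<^sup>+" and c: "c \<in> divided_cells (T k) Z"
  shows "\<exists>X Y. c = cb True X Y (2 * h) \<and> 2 * h dvd X \<and> 2 * h dvd Y \<and> X + 2 * h \<le> N True \<and> Y + 2 * h \<le> N False \<and> (\<forall>d. thr Z X Y d)"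
proof -
  obtain s where s: "s \<in> Z" "c \<in> crossed_cells (T k) s" using c by (auto simp: divided_cells_def)
  have "Z \<subseteq> sg ` Lk (Suc k)" using in_quotient_imp_subset[OF equiv_meet[OF k h_def] Z] .
  then obtain t where t: "t \<in> Lk (Suc k)" "s = sg t" using s(1) by blast
  obtain d q a b where t': "t = (d, q, a, b)" by (cases t)
  note tL = t(1)[unfolded t']
  note F = L_level_facts[OF k h_def tL]
  obtain m where m: "c = cb d m (q - h) (2 * h)" "2 * h dvd m" "a \<le> m" "m < b"
    using s(2) unfolding t(2) t' crossed_cells_eq[OF k h_def tL] by blast
  have mb: "m + 2 * h \<le> b" by (rule dvd_less_add[OF m(2) F(4) m(4)])
  obtain \<alpha> \<beta> where ab: "(\<not> d, m + h, \<alpha>, \<beta>) \<in> L" "\<alpha> + h \<le> q" "q + h \<le> \<beta>"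
    using crossing[OF k h_def F(1,2) m(2-4)] by blast
  have v: "(\<not> d, m + h, \<alpha>, \<beta>) \<in> Lk (Suc k)" using ab(1) llev_center(1)[OF k h_def m(2)] by (simp add: Lk_def)
  have "sg (d, q, a, b) \<inter> sg (\<not> d, m + h, \<alpha>, \<beta>) \<noteq> {}"
    unfolding sg_meet[OF F(1) ab(1)] using m mb ab hw'(1) by auto
  then have "(s, sg (\<not> d, m + h, \<alpha>, \<beta>)) \<in> meets" using meet_iff[OF k h_def tL v] t(2) t' by simp
  moreover obtain z where "Z = (meets)\<^sup>+ `` {z}" using Z by (rule quotientE)
  ultimately have vK: "sg (\<not> d, m + h, \<alpha>, \<beta>) \<in> Z" using s(1) by (auto intro: trancl_into_trancl)
  have tK: "sg (d, q, a, b) \<in> Z" using s(1) t(2) t' by simp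
  have q: "q = (q - h) + h" using F(6) by simp
  have ends: "m + 2 * h \<le> N d" "q - h + 2 * h \<le> N (\<not> d)" using mb L_D(4)[OF F(1)] F(6,8) by auto
  show ?thesis
  proof (cases d)
    case True
    have "thr Z m (q - h) True" unfolding thr_def using tL tK m(3) mb q True by auto
    moreover have "thr Z m (q - h) False" unfolding thr_def using v vK ab True F(6) by (intro exI[of _ \<alpha>] exI[of _ \<beta>]) auto
    ultimately have "\<forall>d. thr Z m (q - h) d" by (simp add: all_bool_eq)
    then show ?thesis using m(1,2) F(5) ends True by (intro exI[of _ m] exI[of _ "q - h"]) auto
  next
    case False
    have "thr Z (q - h) m False" unfolding thr_def using tL tK m(3) mb q False by auto
    moreover have "thr Z (q - h) m True" unfolding thr_def using v vK ab False F(6) by (intro exI[of _ \<alpha>] exI[of _ \<beta>]) auto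
    ultimately have "\<forall>d. thr Z (q - h) m d" by (simp add: all_bool_eq)
    moreover have "c = cb True (q - h) m (2 * h)" using m(1) False cb_swap[of True] by simp
    ultimately show ?thesis using m(2) F(5) ends False by (intro exI[of _ "q - h"] exI[of _ m]) auto
  qed
qed

text \<open>If the l-edge went beyond the two cells of the row, it would divide a further cell, and
  so would its component.\<close>

lemma row_extent:
  assumes 1: "(d, y + h, a, b) \<in> Lk (Suc k)" "sg (d, y + h, a, b) \<in> Z" "a \<le> A" "A + 2 * h \<le> b"
    and 2: "(d, y + h, a2, b2) \<in> Lk (Suc k)" "a2 \<le> A + 2 * h" "A + 4 * h \<le> b2"
    and m: "\<And>m. cb d m y (2 * h) \<in> divided_cells (T k) Z \<Longrightarrow> m + 2 * h \<le> N d \<Longrightarrow> m = A \<or> m = A + 2 * h"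
  shows "(d, y + h, A, A + 4 * h) \<in> L \<and> sg (d, y + h, A, A + 4 * h) \<in> Z"
proof -
  note F = L_level_facts[OF k h_def 1(1)] and F2 = L_level_facts[OF k h_def 2(1)]
  note D = L_D[OF F(1)]
  have e: "a2 = a" "b2 = b" using L_unique[OF F2(1) F(1), of "A + 2 * h"] 1 2 by auto
  have in_DC: "m = A \<or> m = A + 2 * h" if "2 * h dvd m" "a \<le> m" "m < b" for m
  proof (rule m)
    have "cb d m y (2 * h) \<in> crossed_cells (T k) (sg (d, y + h, a, b))"
      unfolding crossed_cells_eq[OF k h_def 1(1)] using that by auto
    then show "cb d m y (2 * h) \<in> divided_cells (T k) Z" unfolding divided_cells_def using 1(2) by blast
    show "m + 2 * h \<le> N d" using dvd_less_add[OF that(1) F(4) that(3)] D(4) by simp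
  qed
  have "a = A" using in_DC[of a] F(3) D(3) 1(3) by auto
  moreover have "b = A + 4 * h"
  proof -
    \<comment> \<open>The last cell that the l-edge crosses begins at
      \<open>b - 2 * h\<close>.\<close>
    have "2 * h \<le> b" using 2(3) e by simp
    moreover have "a \<le> b - 2 * h" using dvd_less_add[OF F(3,4) D(3)] by simp
    moreover have "2 * h dvd b - 2 * h" using F(4) by (simp add: dvd_diff_nat)
    ultimately have "b - 2 * h = A \<or> b - 2 * h = A + 2 * h" using hw'(1) by (intro in_DC) auto
    then show ?thesis using 2(3) e hw'(1) by auto
  qed
  ultimately show ?thesis using F(1) 1(2) by simp
qed

text \<open>Comparing corners places the four cells at \<open>A\<close>, \<open>A + 2 * h\<close>
  and \<open>B\<close>, \<open>B + 2 * h\<close>. \<open>row_extent\<close> yields the four l-edges,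
  the interior cells yield the strict bounds, and \<open>four_class\<close> shows that nothing else
  belongs to the component.\<close>

lemma good_component_block:
  assumes Z: "Z \<in> sg ` Lk (Suc k) // (meets)\<^sup>+" and good: "interior_2x2_block (T k) (divided_cells (T k) Z)"
  shows "\<exists>A B. blk k True A B \<and> Z = sg ` four h (A, B)"
proof -
  let ?D = "divided_cells (T k) Z"
  obtain x0 x1 x2 y0 y1 y2 where int: "?D \<subseteq> interior_cells (T k)"
    and D: "?D = {((x0, y0), (x1, y1)), ((x1, y0), (x2, y1)), ((x0, y1), (x1, y2)), ((x1, y1), (x2, y2))}"
    using good unfolding interior_2x2_block_def by auto
  have "((x0, y0), (x1, y1)) \<in> ?D" "((x1, y0), (x2, y1)) \<in> ?D" "((x0, y1), (x1, y2)) \<in> ?D" "((x1, y1), (x2, y2)) \<in> ?D"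
    by (simp_all add: D)
  note c = this
  obtain A B where A: "((x0, y0), (x1, y1)) = cb True A B (2 * h)" "2 * h dvd A" "2 * h dvd B"
    "A + 2 * h \<le> N True" "B + 2 * h \<le> N False" "\<And>d. thr Z A B d" using cell_through[OF Z c(1)] by blast
  have x: "x0 = C True A" "x1 = C True (A + 2 * h)" "y0 = C False B" "y1 = C False (B + 2 * h)"
    using A(1) by (simp_all add: cb_True)
  obtain X2 Y2 where 2: "((x1, y0), (x2, y1)) = cb True X2 Y2 (2 * h)"
    "X2 + 2 * h \<le> N True" "Y2 + 2 * h \<le> N False" "\<And>d. thr Z X2 Y2 d" using cell_through[OF Z c(2)] by blast
  have e2: "X2 = A + 2 * h" "Y2 = B" using 2(1-3) A(4,5) by (auto simp: cb_True x C_eq_iff)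
  obtain X3 Y3 where 3: "((x0, y1), (x1, y2)) = cb True X3 Y3 (2 * h)"
    "X3 + 2 * h \<le> N True" "Y3 + 2 * h \<le> N False" "\<And>d. thr Z X3 Y3 d" using cell_through[OF Z c(3)] by blast
  have e3: "X3 = A" "Y3 = B + 2 * h" using 3(1-3) A(4,5) by (auto simp: cb_True x C_eq_iff)
  obtain X4 Y4 where 4: "((x1, y1), (x2, y2)) = cb True X4 Y4 (2 * h)"
    "X4 + 2 * h \<le> N True" "Y4 + 2 * h \<le> N False" "\<And>d. thr Z X4 Y4 d" using cell_through[OF Z c(4)] by blast
  have e4: "X4 = A + 2 * h" "Y4 = B + 2 * h" using 4(1-3) A(4,5) by (auto simp: cb_True x C_eq_iff)
  have bd: "A + 4 * h \<le> N True" "B + 4 * h \<le> N False" using 4(2,3) e4 by auto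
  have cells: "?D = {cb True A B (2 * h), cb True (A + 2 * h) B (2 * h), cb True A (B + 2 * h) (2 * h), cb True (A + 2 * h) (B + 2 * h) (2 * h)}"
    unfolding D A(1) 2(1) 3(1) 4(1) e2 e3 e4 ..
  have coord: "(X = A \<or> X = A + 2 * h) \<and> (Y = B \<or> Y = B + 2 * h)"
    if "cb True X Y (2 * h) \<in> ?D" "X \<le> N True" "Y \<le> N False" for X Y
    using that bd unfolding cells cb_True by (auto simp: C_eq_iff)
  have coordT: "m = A \<or> m = A + 2 * h" if "cb True m y (2 * h) \<in> ?D" "m + 2 * h \<le> N True" "y \<le> N False" for m y
    using coord[of m y] that by simp
  have coordF: "m = B \<or> m = B + 2 * h" if "cb False m x (2 * h) \<in> ?D" "m + 2 * h \<le> N False" "x \<le> N True" for m x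
    using coord[of x m] that cb_swap[of True m x] by simp
  have AN: "A \<le> N True" "A + 2 * h \<le> N True" "B \<le> N False" "B + 2 * h \<le> N False" using A(4,5) by auto
  note thr = A(6) 2(4)[unfolded e2] 3(4)[unfolded e3] 4(4)[unfolded e4]
  have h1: "(True, B + h, A, A + 4 * h) \<in> L \<and> sg (True, B + h, A, A + 4 * h) \<in> Z"
    using thr(1)[of True] thr(2)[of True] row_extent[of True B _ _ Z A] coordT[OF _ _ AN(3)] unfolding thr_def by auto
  have h2: "(True, B + 2 * h + h, A, A + 4 * h) \<in> L \<and> sg (True, B + 2 * h + h, A, A + 4 * h) \<in> Z"
    using thr(3)[of True] thr(4)[of True] row_extent[of True "B + 2 * h" _ _ Z A] coordT[OF _ _ AN(4)] unfolding thr_def by auto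
  have v1: "(False, A + h, B, B + 4 * h) \<in> L \<and> sg (False, A + h, B, B + 4 * h) \<in> Z"
    using thr(1)[of False] thr(3)[of False] row_extent[of False A _ _ Z B] coordF[OF _ _ AN(1)] unfolding thr_def by auto
  have v2: "(False, A + 2 * h + h, B, B + 4 * h) \<in> L \<and> sg (False, A + 2 * h + h, B, B + 4 * h) \<in> Z"
    using thr(2)[of False] thr(4)[of False] row_extent[of False "A + 2 * h" _ _ Z B] coordF[OF _ _ AN(2)] unfolding thr_def by auto
  have i: "cb True A B (2 * h) \<in> interior_cells (T k)" "cb True (A + 2 * h) B (2 * h) \<in> interior_cells (T k)"
    "cb True A (B + 2 * h) (2 * h) \<in> interior_cells (T k)" using int unfolding cells by auto
  have "A \<noteq> 0" using interior_cell_bounds(1)[OF i(1)] A(4,5) by simp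
  moreover have "A + 4 * h \<noteq> N True" using interior_cell_bounds(2)[OF i(2)] bd AN by simp
  moreover have "B \<noteq> 0" using interior_cell_bounds(1)[of False B A] i(1) cb_swap[of True B A] A(4,5) by simp
  moreover have "B + 4 * h \<noteq> N False" using interior_cell_bounds(2)[of False "B + 2 * h" A] i(3) cb_swap[of True "B + 2 * h" A] bd AN by simp
  moreover have e: "B + 2 * h + h = B + 3 * h" "A + 2 * h + h = A + 3 * h" by simp_all
  ultimately have b: "blk k True A B"
    unfolding blk_def h_def[symmetric] using h1 h2[unfolded e] v1 v2[unfolded e] A(2,3) bd by (auto simp: hw')
  obtain z where z: "z \<in> sg ` Lk (Suc k)" "Z = (meets)\<^sup>+ `` {z}" using Z by (rule quotientE)
  have "(z, sg (True, B + h, A, A + 4 * h)) \<in> (meets)\<^sup>+" using h1 z(2) by simp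
  then have "Z = (meets)\<^sup>+ `` {sg (True, B + h, A, A + 4 * h)}"
    unfolding z(2) using equiv_class_eq[OF equiv_meet[OF k h_def]] by blast
  also have "\<dots> = sg ` four h (A, B)" by (rule four_class[OF k h_def b]) (simp add: four_def[OF k h_def])
  finally show ?thesis using b by blast
qed

lemma delta4_level_eq: "delta4_level T n (Suc k) = card (blocks k)"
proof -
  have "{Z \<in> level_components T n (Suc k). interior_2x2_block (T (Suc k - 1)) (divided_cells (T (Suc k - 1)) Z)} =
      (\<lambda>p. sg ` four h p) ` blocks k"
  proof (intro equalityI subsetI)
    fix Z assume "Z \<in> {Z \<in> level_components T n (Suc k). interior_2x2_block (T (Suc k - 1)) (divided_cells (T (Suc k - 1)) Z)}"
    then have "Z \<in> sg ` Lk (Suc k) // (meets)\<^sup>+" "interior_2x2_block (T k) (divided_cells (T k) Z)"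
      by (simp_all add: level_components_def meet_def[OF k h_def] level_l_edges_eq)
    then obtain A B where "blk k True A B" "Z = sg ` four h (A, B)" using good_component_block by blast
    then show "Z \<in> (\<lambda>p. sg ` four h p) ` blocks k" by (auto simp: blocks_def)
  next
    fix Z assume "Z \<in> (\<lambda>p. sg ` four h p) ` blocks k"
    then obtain A B where b: "blk k True A B" "Z = sg ` four h (A, B)" by (auto simp: blocks_def)
    have t: "(True, B + h, A, A + 4 * h) \<in> four h (A, B)" by (simp add: four_def[OF k h_def])
    have "Z = (meets)\<^sup>+ `` {sg (True, B + h, A, A + 4 * h)}" unfolding b(2) by (rule four_class[OF k h_def b(1) t, symmetric])
    moreover have "sg (True, B + h, A, A + 4 * h) \<in> sg ` Lk (Suc k)" using blk_four[OF k h_def b(1)] t by blast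
    ultimately have "Z \<in> level_components T n (Suc k)"
      unfolding level_components_def level_l_edges_eq[symmetric] using level_l_edges_eq[of "Suc k"]
      by (auto simp: meet_def[OF k h_def] intro: quotientI)
    then show "Z \<in> {Z \<in> level_components T n (Suc k). interior_2x2_block (T (Suc k - 1)) (divided_cells (T (Suc k - 1)) Z)}"
      using block_component_good[OF b(1)] b(2) by simp
  qed
  moreover have "inj_on (\<lambda>p. sg ` four h p) (blocks k)"
  proof (rule inj_onI)
    fix p p' assume p: "p \<in> blocks k" "p' \<in> blocks k" "sg ` four h p = sg ` four h p'"
    obtain A B A' B' where pp: "p = (A, B)" "p' = (A', B')" by (cases p, cases p')
    have b: "blk k True A B" "blk k True A' B'" using p by (auto simp: blocks_def pp)
    have L: "four h (A, B) \<subseteq> L" "four h (A', B') \<subseteq> L"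
      using blk_four[OF k h_def b(1)] blk_four[OF k h_def b(2)] by (auto simp: Lk_def)
    have mem: "t \<in> four h (A', B')" if t: "t \<in> four h (A, B)" for t
    proof -
      have "sg t \<in> sg ` four h (A', B')" using p(3) t unfolding pp by blast
      then obtain t' where t': "t' \<in> four h (A', B')" "sg t = sg t'" by blast
      have "t \<in> L" "t' \<in> L" using L t t'(1) by blast+
      then have "t = t'" using sg_inj t'(2) by simp
      then show ?thesis using t'(1) by simp
    qed
    have "A = A'" using mem[of "(True, B + h, A, A + 4 * h)"] by (auto simp: four_def[OF k h_def])
    moreover have "B = B'" using mem[of "(False, A + h, B, B + 4 * h)"] by (auto simp: four_def[OF k h_def])
    ultimately show "p = p'" by (simp add: pp)
  qed
  ultimately show ?thesis unfolding delta4_level_def by (simp add: card_image)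
qed

end

end

theorem theorem6p5:
  fixes T :: "nat \<Rightarrow> cell set" and n :: nat
  assumes "hierarchical_T_mesh T n"
    and "\<And>j t. 1 \<le> j \<Longrightarrow> t \<in> level_l_edges T n j \<Longrightarrow> 2 \<le> card (crossed_cells (T (j - 1)) t)"
  shows "int (fun_space.dim (spline_space 3 (T n))) =
           3 * int (card (boundary_vertices (T n))) + int (card (crossing_vertices (T n)))
           - 2 * int (card (interior_l_edges (T n))) + 4 + int (delta4 T n)"
proof -
  obtain C N lev where "hier C N n lev T" using hierarchical_T_mesh_hier[OF assms(1)] by blast
  then interpret hier C N n lev T .
  have long: "a + 4 * w (Suc k) \<le> b" if t: "(d, q, a, b) \<in> L" "llev q = Suc k" for k d q a b
  proof -
    have k: "k < n" using llev_le_n[of q] t(2) by simp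
    have tk: "(d, q, a, b) \<in> Lk (Suc k)" using t by (simp add: Lk_def)
    then have "2 \<le> card (crossed_cells (T k) (sg (d, q, a, b)))"
      using assms(2)[of "Suc k" "sg (d, q, a, b)"] level_l_edges_eq[of "Suc k"] by simp
    then show ?thesis by (rule long_of_card[OF k refl tk])
  qed
  have "delta4 T n = (\<Sum>k<n. card (blocks k))"
    unfolding delta4_def One_nat_def sum.atLeast1_atMost_eq by (rule sum.cong) (simp_all add: delta4_level_eq[OF _ refl])
  then have "has_dim Wd (delta4 T n)" using has_dim_Wd[OF long] by simp
  \<comment> \<open>\<open>fun_space\<close> is the instance of \<open>fv\<close> for functions on
    the plane, so the two dimensions are the same.\<close>
  then have "fun_space.dim (spline_space 3 M) + 4 * card L = 16 + 4 * card L0 + 4 * card LN + card Vint + delta4 T n"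
    by (rule dim_spline_space)
  \<comment> \<open>\<open>card Vint\<close> is eliminated with \<open>card_Vint_eq\<close>, leaving
    \<open>3 * (card L0 + card LN)\<close>. Three times the number of boundary vertices contains
    this and 12 for the corners, so 4 of the 16 bicubic monomials remain as the constant.\<close>
  then show ?thesis
    unfolding T_n card_boundary_vertices card_crossing_vertices card_interior_l_edges
    using card_Vbd card_Vint_eq by linarith
qed

end
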